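(* Let $(A,D)$ be a pseudo-Cartan inclusion with Cartan envelope $(A_1,D_1,\alpha)$. Then the following lattices of ideals are isomorphic: $\mathrm{Reg}(A)\simeq \mathrm{RegInv}_A(D)\simeq \mathrm{RegInv}_{A_1}(D_1)\simeq\mathrm{Reg}(A_1)$.
   Context: Ideals are closed and two-sided. An inclusion $(A,B)$ of $C^*$-algebras is a $C^*$-algebra $A$ with a $C^*$-subalgebra $B\subseteq A$ containing an approximate unit for $A$. $N(A,B)=\{n\in A: nBn^*\subseteq B,\ n^*Bn\subseteq B\}$; the inclusion is regular if $N(A,B)$ has dense span in $A$. It has the ideal intersection property if $J\cap B\neq\{0\}$ for every non-zero ideal $J$ of $A$. A pseudo-Cartan inclusion is a regular inclusion $(A,D)$ such that $D$ is abelian, the relative commutant $D^c$ of $D$ in $A$ is abelian, and both $(D^c,D)$ and $(A,D^c)$ have the ideal intersection property. A Cartan inclusion is a regular inclusion $(A_1,D_1)$ with $D_1$ maximal abelian in $A_1$ and with a faithful conditional expectation $A_1\to D_1$. A Cartan envelope of a regular inclusion $(A,D)$ with $D$ abelian is a triple $(A_1,D_1,\alpha)$ where: $(A_1,D_1)$ is a Cartan inclusion with faithful conditional expectation $E_1\colon A_1\to D_1$; $\alpha\colon A\to A_1$ is a $*$-monomorphism with $\alpha(N(A,D))\subseteq N(A_1,D_1)$ and $\alpha(D)\subseteq D_1$; $A_1=C^*(\alpha(A)\cup E_1(\alpha(A)))$ and $D_1=C^*(E_1(\alpha(A)))$; and $(D_1,\alpha(D))$ has the ideal intersection property. (Every pseudo-Cartan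 inclusion has a Cartan envelope.) For a subset $X$ of a $C^*$-algebra $A$, $X^\perp=\{a\in A:aX=Xa=\{0\}\}$. An ideal $J$ of $A$ is regular if $J=J^{\perp\perp}$; $\mathrm{Reg}(A)$ is the lattice of regular ideals of $A$, ordered by inclusion. For a regular inclusion $(A,B)$, an ideal $K$ of $B$ is invariant if $nKn^*\subseteq K$ for all $n\in N(A,B)$; $\mathrm{RegInv}_A(B)$ is the lattice (ordered by inclusion) of ideals of $B$ that are invariant and regular as ideals of $B$ (annihilators taken in $B$). *)

theory Defs
  imports "HOL-Analysis.Analysis"
begin

section \<open>\<open>C\<^sup>*\<close>-algebras\<close>

text \<open>
  The libraries have no complex normed algebras, so the complex scalar multiplication is added to
  \<^class>\<open>real_normed_algebra\<close>, which does not require a unit.  The first axiom makes it extend the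
  given real one.
\<close>

class cstar_algebra = real_normed_algebra + banach +
  fixes scaleC :: "complex \<Rightarrow> 'a \<Rightarrow> 'a" (infixr \<open>*\<^sub>C\<close> 75)
    and adj :: "'a \<Rightarrow> 'a"
  assumes scaleC_of_real: "complex_of_real r *\<^sub>C x = r *\<^sub>R x"
    and scaleC_add_right: "c *\<^sub>C (x + y) = c *\<^sub>C x + c *\<^sub>C y"
    and scaleC_add_left: "(c + d) *\<^sub>C x = c *\<^sub>C x + d *\<^sub>C x"
    and scaleC_scaleC: "c *\<^sub>C (d *\<^sub>C x) = (c * d) *\<^sub>C x"
    and norm_scaleC: "norm (c *\<^sub>C x) = cmod c * norm x"
    and mult_scaleC_left: "(c *\<^sub>C x) * y = c *\<^sub>C (x * y)"
    and mult_scaleC_right: "x * (c *\<^sub>C y) = c *\<^sub>C (x * y)"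
    and adj_adj: "adj (adj x) = x"
    and adj_add: "adj (x + y) = adj x + adj y"
    and adj_scaleC: "adj (c *\<^sub>C x) = cnj c *\<^sub>C adj x"
    and adj_mult: "adj (x * y) = adj y * adj x"
    and norm_adj_mult_self: "norm (adj x * x) = (norm x)\<^sup>2"

instantiation complex :: cstar_algebra
begin

definition scaleC_complex :: "complex \<Rightarrow> complex \<Rightarrow> complex"
  where "scaleC_complex c x = c * x"

definition adj_complex :: "complex \<Rightarrow> complex"
  where "adj_complex x = cnj x"

instance
  by standard
    (simp_all add: scaleC_complex_def adj_complex_def algebra_simps norm_mult power2_eq_square
      scaleR_conv_of_real)

end

global_interpretation complex_vector:
  vector_space "scaleC :: complex \<Rightarrow> 'a \<Rightarrow> 'a :: cstar_algebra"
  defines csubspace = complex_vector.subspace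
    and cspan = complex_vector.span
proof unfold_locales
  fix x :: 'a
  show "1 *\<^sub>C x = x"
    using scaleC_of_real[of 1 x] by simp
qed (simp_all add: scaleC_add_right scaleC_add_left scaleC_scaleC)

section \<open>Subalgebras, ideals and inclusions\<close>

text \<open>
  All algebras are represented as \<open>C\<^sup>*\<close>-subalgebras of a type of class \<open>cstar_algebra\<close>; the whole
  type is the case \<^term>\<open>UNIV\<close>.  Ideals, annihilators, normalizers and commutants are relative to
  such a carrier set.
\<close>

definition cstar_subalgebra :: "'a::cstar_algebra set \<Rightarrow> bool" where
  "cstar_subalgebra B \<longleftrightarrow>
     csubspace B \<and> closed B \<and> (\<forall>x\<in>B. \<forall>y\<in>B. x * y \<in> B) \<and> (\<forall>x\<in>B. adj x \<in> B)"

definition cstar_generated :: "'a::cstar_algebra set \<Rightarrow> 'a set" where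
  "cstar_generated X = cstar_subalgebra hull X"

definition cstar_ideal :: "'a::cstar_algebra set \<Rightarrow> 'a set \<Rightarrow> bool" where
  "cstar_ideal A J \<longleftrightarrow>
     J \<subseteq> A \<and> csubspace J \<and> closed J \<and> (\<forall>a\<in>A. \<forall>x\<in>J. a * x \<in> J \<and> x * a \<in> J)"

definition cstar_positive :: "'a::cstar_algebra set \<Rightarrow> 'a \<Rightarrow> bool" where
  "cstar_positive B x \<longleftrightarrow> (\<exists>b\<in>B. x = adj b * b)"

text \<open>
  An approximate unit is a net \<open>(u\<^sub>i)\<close> of positive contractions with \<open>u\<^sub>i a \<rightarrow> a\<close> and \<open>a u\<^sub>i \<rightarrow> a\<close>.
  The net enters only through its eventuality filter, and every proper filter on \<open>B\<close> is the
  eventuality filter of a net in \<open>B\<close>.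
\<close>

definition contains_approximate_unit :: "'a::cstar_algebra set \<Rightarrow> 'a set \<Rightarrow> bool" where
  "contains_approximate_unit A B \<longleftrightarrow>
     (\<exists>F::'a filter. F \<noteq> bot \<and>
        (\<forall>\<^sub>F u in F. u \<in> B \<and> cstar_positive B u \<and> norm u \<le> 1) \<and>
        (\<forall>a\<in>A. ((\<lambda>u. u * a) \<longlongrightarrow> a) F \<and> ((\<lambda>u. a * u) \<longlongrightarrow> a) F))"

definition cstar_inclusion :: "'a::cstar_algebra set \<Rightarrow> 'a set \<Rightarrow> bool" where
  "cstar_inclusion A B \<longleftrightarrow>
     cstar_subalgebra A \<and> cstar_subalgebra B \<and> B \<subseteq> A \<and> contains_approximate_unit A B"

definition normalizers :: "'a::cstar_algebra set \<Rightarrow> 'a set \<Rightarrow> 'a set" where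
  "normalizers A B = {n \<in> A. \<forall>b\<in>B. n * b * adj n \<in> B \<and> adj n * b * n \<in> B}"

definition regular_inclusion :: "'a::cstar_algebra set \<Rightarrow> 'a set \<Rightarrow> bool" where
  "regular_inclusion A B \<longleftrightarrow> cstar_inclusion A B \<and> closure (cspan (normalizers A B)) = A"

definition ideal_intersection_property :: "'a::cstar_algebra set \<Rightarrow> 'a set \<Rightarrow> bool" where
  "ideal_intersection_property A B \<longleftrightarrow>
     (\<forall>J. cstar_ideal A J \<and> J \<noteq> {0} \<longrightarrow> J \<inter> B \<noteq> {0})"

definition abelian :: "'a::cstar_algebra set \<Rightarrow> bool" where
  "abelian B \<longleftrightarrow> (\<forall>x\<in>B. \<forall>y\<in>B. x * y = y * x)"

definition relative_commutant :: "'a::cstar_algebra set \<Rightarrow> 'a set \<Rightarrow> 'a set" where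
  "relative_commutant A D = {a \<in> A. \<forall>d\<in>D. a * d = d * a}"

definition maximal_abelian :: "'a::cstar_algebra set \<Rightarrow> 'a set \<Rightarrow> bool" where
  "maximal_abelian A B \<longleftrightarrow>
     cstar_subalgebra B \<and> B \<subseteq> A \<and> abelian B \<and>
     (\<forall>C. cstar_subalgebra C \<and> C \<subseteq> A \<and> abelian C \<and> B \<subseteq> C \<longrightarrow> C = B)"

section \<open>Pseudo-Cartan inclusions and Cartan envelopes\<close>

definition pseudo_cartan_inclusion :: "'a::cstar_algebra set \<Rightarrow> 'a set \<Rightarrow> bool" where
  "pseudo_cartan_inclusion A D \<longleftrightarrow>
     regular_inclusion A D \<and> abelian D \<and> abelian (relative_commutant A D) \<and>
     ideal_intersection_property (relative_commutant A D) D \<and>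
     ideal_intersection_property A (relative_commutant A D)"

text \<open>
  Complete positivity is not demanded separately: by Tomiyama's theorem it is automatic (as are
  positivity and the bimodule property, given a linear contractive projection onto \<open>B\<close>).
\<close>

definition conditional_expectation ::
  "'a::cstar_algebra set \<Rightarrow> 'a set \<Rightarrow> ('a \<Rightarrow> 'a) \<Rightarrow> bool" where
  "conditional_expectation A B E \<longleftrightarrow>
     (\<forall>x\<in>A. E x \<in> B) \<and> (\<forall>b\<in>B. E b = b) \<and>
     (\<forall>x\<in>A. \<forall>y\<in>A. E (x + y) = E x + E y) \<and> (\<forall>c. \<forall>x\<in>A. E (c *\<^sub>C x) = c *\<^sub>C E x) \<and>
     (\<forall>x\<in>A. norm (E x) \<le> norm x) \<and>
     (\<forall>x\<in>A. cstar_positive B (E (adj x * x))) \<and>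
     (\<forall>b\<in>B. \<forall>x\<in>A. E (b * x) = b * E x \<and> E (x * b) = E x * b)"

definition faithful_conditional_expectation ::
  "'a::cstar_algebra set \<Rightarrow> 'a set \<Rightarrow> ('a \<Rightarrow> 'a) \<Rightarrow> bool" where
  "faithful_conditional_expectation A B E \<longleftrightarrow>
     conditional_expectation A B E \<and> (\<forall>x\<in>A. E (adj x * x) = 0 \<longrightarrow> x = 0)"

definition cartan_inclusion :: "'a::cstar_algebra set \<Rightarrow> 'a set \<Rightarrow> bool" where
  "cartan_inclusion A D \<longleftrightarrow>
     regular_inclusion A D \<and> maximal_abelian A D \<and>
     (\<exists>E. faithful_conditional_expectation A D E)"

definition star_monomorphism ::
  "'a::cstar_algebra set \<Rightarrow> 'b::cstar_algebra set \<Rightarrow> ('a \<Rightarrow> 'b) \<Rightarrow> bool" where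
  "star_monomorphism A B f \<longleftrightarrow>
     (\<forall>x\<in>A. f x \<in> B) \<and> inj_on f A \<and>
     (\<forall>x\<in>A. \<forall>y\<in>A. f (x + y) = f x + f y) \<and> (\<forall>c. \<forall>x\<in>A. f (c *\<^sub>C x) = c *\<^sub>C f x) \<and>
     (\<forall>x\<in>A. \<forall>y\<in>A. f (x * y) = f x * f y) \<and> (\<forall>x\<in>A. f (adj x) = adj (f x))"

definition cartan_envelope ::
  "'a::cstar_algebra set \<Rightarrow> 'a set \<Rightarrow> 'b::cstar_algebra set \<Rightarrow> 'b set \<Rightarrow> ('a \<Rightarrow> 'b) \<Rightarrow> bool" where
  "cartan_envelope A D A1 D1 \<alpha> \<longleftrightarrow>
     regular_inclusion A D \<and> abelian D \<and>
     cartan_inclusion A1 D1 \<and>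
     star_monomorphism A A1 \<alpha> \<and>
     \<alpha> ` normalizers A D \<subseteq> normalizers A1 D1 \<and> \<alpha> ` D \<subseteq> D1 \<and>
     (\<exists>E1. faithful_conditional_expectation A1 D1 E1 \<and>
        A1 = cstar_generated (\<alpha> ` A \<union> E1 ` \<alpha> ` A) \<and>
        D1 = cstar_generated (E1 ` \<alpha> ` A)) \<and>
     ideal_intersection_property D1 (\<alpha> ` D)"

section \<open>Lattices of regular ideals\<close>

definition annihilator :: "'a::cstar_algebra set \<Rightarrow> 'a set \<Rightarrow> 'a set" where
  "annihilator A X = {a \<in> A. \<forall>x\<in>X. a * x = 0 \<and> x * a = 0}"

definition Reg :: "'a::cstar_algebra set \<Rightarrow> 'a set set" where
  "Reg A = {J. cstar_ideal A J \<and> J = annihilator A (annihilator A J)}"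

definition invariant_ideal :: "'a::cstar_algebra set \<Rightarrow> 'a set \<Rightarrow> 'a set \<Rightarrow> bool" where
  "invariant_ideal A B K \<longleftrightarrow>
     cstar_ideal B K \<and> (\<forall>n\<in>normalizers A B. \<forall>k\<in>K. n * k * adj n \<in> K)"

definition RegInv :: "'a::cstar_algebra set \<Rightarrow> 'a set \<Rightarrow> 'a set set" where
  "RegInv A B = {K. invariant_ideal A B K \<and> K \<in> Reg B}"

text \<open>
  The lattice order is inclusion of sets, and a bijection preserving and reflecting the order of
  two lattices is the same as a lattice isomorphism.
\<close>

definition lattice_isomorphic :: "'a set set \<Rightarrow> 'b set set \<Rightarrow> bool" where
  "lattice_isomorphic L M \<longleftrightarrow>
     (\<exists>f. bij_betw f L M \<and> (\<forall>I\<in>L. \<forall>J\<in>L. I \<subseteq> J \<longleftrightarrow> f I \<subseteq> f J))"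

text \<open>
  \<open>Reg A\<close> and \<open>RegInv A B\<close> are closed under arbitrary intersections, including the empty one, so
  they are indeed (complete) lattices under inclusion.
\<close>

lemma annihilator_antimono: "X \<subseteq> Y \<Longrightarrow> annihilator A Y \<subseteq> annihilator A X"
  by (auto simp: annihilator_def)

lemma subset_annihilator2: "X \<subseteq> A \<Longrightarrow> X \<subseteq> annihilator A (annihilator A X)"
  by (auto simp: annihilator_def)

lemma cstar_ideal_Inter:
  assumes "cstar_subalgebra A" and "\<And>J. J \<in> S \<Longrightarrow> cstar_ideal A J"
  shows "cstar_ideal A (A \<inter> \<Inter> S)"
  using assms unfolding cstar_ideal_def cstar_subalgebra_def complex_vector.subspace_def
  by (auto intro!: closed_Int closed_Inter)

lemma Reg_Inter:
  assumes A: "cstar_subalgebra A" and S: "S \<subseteq> Reg A"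
  shows "A \<inter> \<Inter> S \<in> Reg A"
proof -
  have "annihilator A (annihilator A (A \<inter> \<Inter> S)) \<subseteq> J" if "J \<in> S" for J
  proof -
    have "annihilator A (annihilator A (A \<inter> \<Inter> S)) \<subseteq> annihilator A (annihilator A J)"
      using that by (intro annihilator_antimono) auto
    also have "\<dots> = J"
      using S that by (auto simp: Reg_def)
    finally show ?thesis .
  qed
  then have "annihilator A (annihilator A (A \<inter> \<Inter> S)) \<subseteq> A \<inter> \<Inter> S"
    by (auto simp: annihilator_def)
  moreover have "A \<inter> \<Inter> S \<subseteq> annihilator A (annihilator A (A \<inter> \<Inter> S))"
    by (rule subset_annihilator2) auto
  moreover have "cstar_ideal A (A \<inter> \<Inter> S)"
    using S by (intro cstar_ideal_Inter A) (auto simp: Reg_def)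
  ultimately show ?thesis
    by (auto simp: Reg_def)
qed

lemma RegInv_Inter:
  assumes B: "cstar_subalgebra B" and S: "S \<subseteq> RegInv A B"
  shows "B \<inter> \<Inter> S \<in> RegInv A B"
proof -
  have "B \<inter> \<Inter> S \<in> Reg B"
    using S by (intro Reg_Inter B) (auto simp: RegInv_def)
  moreover have "invariant_ideal A B (B \<inter> \<Inter> S)"
    unfolding invariant_ideal_def
  proof (intro conjI ballI)
    show "cstar_ideal B (B \<inter> \<Inter> S)"
      using S by (intro cstar_ideal_Inter B) (auto simp: RegInv_def Reg_def)
    fix n k
    assume "n \<in> normalizers A B" "k \<in> B \<inter> \<Inter> S"
    then show "n * k * adj n \<in> B \<inter> \<Inter> S"
      using S by (fastforce simp: RegInv_def invariant_ideal_def normalizers_def)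
  qed
  ultimately show ?thesis
    by (simp add: RegInv_def)
qed

end

theory Submission
  imports Defs
begin

text \<open>
  The maps behind the theorem are \<open>J \<mapsto> J \<inter> D\<close> between regular ideals of an inclusion and regular
  invariant ideals of its subalgebra, and \<open>L \<mapsto> \<alpha>\<^sup>-\<^sup>1(L)\<close> between the ideals of \<open>D\<^sub>1\<close> and of \<open>D\<close>;
  their inverses are double annihilators.  Everything rests on one principle.  If \<open>B\<close> is abelian and
  meets every non-zero ideal, then two ideals annihilate each other as soon as their traces on \<open>B\<close>
  do: an element of \<open>B\<close> in their intersection has square zero, so it vanishes; hence the intersection
  vanishes, and it contains the products of elements of the two ideals.  Since a regular ideal \<open>J = J\<^sup>\<bottom>\<^sup>\<bottom>\<close> is described by what annihilates \<open>J\<^sup>\<bottom>\<close>, it is determined by its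
  trace.

  For a regular inclusion \<open>(A, D)\<close> with \<open>D\<close> abelian and the ideal intersection property this gives
  \<open>Reg A \<simeq> RegInv A D\<close> (\<open>Reg_isomorphic_RegInv\<close>); invariance enters because the annihilator in \<open>A\<close>
  of an invariant ideal of \<open>D\<close> is an ideal of \<open>A\<close>.  It applies to the pseudo-Cartan inclusion, where
  the ideal intersection property is passed down in two steps, and to the Cartan inclusion
  \<open>(A\<^sub>1, D\<^sub>1)\<close>.

  That Cartan inclusions have the ideal intersection property (\<open>cartan_ideal_intersection\<close>) is the
  analytic heart.  Seen on the spectrum of \<open>D\<close>, a normalizer \<open>n\<close> acts as a partial homeomorphism.  Near
  an interior fixed point it agrees with \<open>E n\<close>, because \<open>n\<^sup>* E(n)\<close> commutes with \<open>D\<close>; near a point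
  that is moved it is cut to zero by a function with small support.  So a non-zero \<open>g\<close> can always
  be shrunk until \<open>g n g = g E(n) g\<close> (\<open>shrink_normalizer\<close>), and, after one such
  step for each summand, until the same holds for a finite sum of normalizers.  If \<open>a\<close> is a non-zero element of an ideal \<open>J\<close>, then \<open>h = E(a\<^sup>* a)\<close> is non-zero
  and, after such a compression by an element \<open>e\<close> of \<open>D\<close>, the element \<open>e h e\<close> of \<open>D\<close> is close to
  \<open>e a\<^sup>* a e\<close>, which lies in \<open>J\<close>.  Some non-zero \<open>f\<close> in \<open>D\<close> absorbs \<open>e h e\<close> up to an inverse, which
  forces \<open>f\<close> into \<open>J\<close>.  The functions on the spectrum that are used here come from a continuous
  functional calculus, built on enough characters of a commutative \<open>C\<^sup>*\<close>-algebra.  The characters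
  are found as minimal power-multiplicative seminorms, which turn out to be absolute values of
  characters by an argument of Gelfand--Mazur type.

  For \<open>RegInv A\<^sub>1 D\<^sub>1 \<simeq> RegInv A D\<close> (\<open>RegInv_isomorphic\<close>) the principle is applied to
  \<open>\<alpha>(D) \<subseteq> D\<^sub>1\<close>.  The one point with content is that \<open>L = \<alpha>(K)\<^sup>\<bottom>\<^sup>\<bottom>\<close> is invariant under all normalizers
  of \<open>D\<^sub>1\<close>, although \<open>K\<close> is only known to be invariant under those of \<open>D\<close>
  (\<open>pushforward_invariant\<close>).  With \<open>Q = \<alpha>(K)\<^sup>\<bottom>\<close> one has \<open>L m Q = 0\<close> for every normalizer \<open>m\<close> that
  preserves \<open>L\<close>, and these span a dense subalgebra of \<open>A\<^sub>1\<close>; hence \<open>L A\<^sub>1 Q = 0\<close>, so \<open>m L m\<^sup>*\<close>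
  annihilates \<open>Q\<close> for every normalizer \<open>m\<close>.
\<close>


section \<open>Elementary \<open>C\<^sup>*\<close>-algebra\<close>

declare adj_adj [simp] adj_add [simp] adj_scaleC [simp] adj_mult [simp]

lemma adj_zero [simp]: "adj (0 :: 'a::cstar_algebra) = 0"
  using adj_add[of "0::'a" 0] by simp

lemma adj_minus [simp]: "adj (- x) = - adj (x :: 'a::cstar_algebra)"
  using adj_add[of x "- x"] by (simp add: eq_neg_iff_add_eq_0 add.commute)

lemma adj_diff [simp]: "adj (x - y) = adj x - adj (y :: 'a::cstar_algebra)"
  using adj_add[of x "- y"] by simp

lemma norm_adj [simp]: "norm (adj x) = norm (x :: 'a::cstar_algebra)"
proof -
  have le: "norm y \<le> norm (adj y)" for y :: 'a
  proof (cases "y = 0")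
    case False
    have "norm y * norm y \<le> norm (adj y) * norm y"
      using norm_mult_ineq[of "adj y" y] by (simp add: norm_adj_mult_self power2_eq_square)
    then show ?thesis using False by simp
  qed simp
  show ?thesis using le[of x] le[of "adj x"] by simp
qed

lemma norm_mult_adj_self: "norm (x * adj x) = (norm (x :: 'a::cstar_algebra))\<^sup>2"
  using norm_adj_mult_self[of "adj x"] by simp

lemma adj_mult_self_eq_0 [simp]: "adj x * x = 0 \<longleftrightarrow> x = (0 :: 'a::cstar_algebra)"
  using norm_adj_mult_self[of x] by auto

lemma mult_adj_self_eq_0 [simp]: "x * adj x = 0 \<longleftrightarrow> x = (0 :: 'a::cstar_algebra)"
  using norm_mult_adj_self[of x] by auto

lemma bounded_linear_adj: "bounded_linear (adj :: 'a::cstar_algebra \<Rightarrow> 'a)"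
proof (rule bounded_linear_intro[where K = 1])
  fix r and x :: 'a
  have "adj (complex_of_real r *\<^sub>C x) = complex_of_real r *\<^sub>C adj x" by simp
  then show "adj (r *\<^sub>R x) = r *\<^sub>R adj x" by (simp only: scaleC_of_real)
qed simp_all

lemma bounded_linear_scaleC: "bounded_linear (scaleC c :: 'a::cstar_algebra \<Rightarrow> 'a)"
proof (rule bounded_linear_intro[where K = "cmod c"])
  fix r and x :: 'a
  have "c *\<^sub>C complex_of_real r *\<^sub>C x = complex_of_real r *\<^sub>C c *\<^sub>C x"
    by (simp add: scaleC_scaleC mult.commute)
  then show "c *\<^sub>C r *\<^sub>R x = r *\<^sub>R c *\<^sub>C x" by (simp only: scaleC_of_real)
qed (simp_all add: scaleC_add_right norm_scaleC mult.commute)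

lemmas tendsto_scaleC = bounded_linear.tendsto[OF bounded_linear_scaleC]

lemma closed_adj_vimage: "closed S \<Longrightarrow> closed {x :: 'a::cstar_algebra. adj x \<in> S}"
  using continuous_closed_vimage[of S adj] linear_continuous_at[OF bounded_linear_adj]
  unfolding vimage_def by blast

lemma cstar_subalgebra_closed: "cstar_subalgebra B \<Longrightarrow> closed B"
  by (simp add: cstar_subalgebra_def)

lemma cstar_subalgebra_mem:
  assumes "cstar_subalgebra B"
  shows "0 \<in> B" "\<And>x y. x \<in> B \<Longrightarrow> y \<in> B \<Longrightarrow> x + y \<in> B" "\<And>x. x \<in> B \<Longrightarrow> - x \<in> B"
    "\<And>x y. x \<in> B \<Longrightarrow> y \<in> B \<Longrightarrow> x - y \<in> B" "\<And>x y. x \<in> B \<Longrightarrow> y \<in> B \<Longrightarrow> x * y \<in> B"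
    "\<And>c x. x \<in> B \<Longrightarrow> c *\<^sub>C x \<in> B" "\<And>x. x \<in> B \<Longrightarrow> adj x \<in> B"
  using assms unfolding cstar_subalgebra_def
  by (auto intro: complex_vector.subspace_0 complex_vector.subspace_add complex_vector.subspace_neg
      complex_vector.subspace_diff complex_vector.subspace_scale)

text \<open>
  The Gelfand theory below is developed for a commutative subalgebra \<open>D\<close> of an arbitrary type, with
  characters as functions on the type whose values matter only on \<open>D\<close>.
\<close>

locale commutative_cstar =
  fixes D :: "'a::cstar_algebra set"
  assumes subalgebra: "cstar_subalgebra D" and commutative: "abelian D"
begin

lemmas mem [simp, intro] = cstar_subalgebra_mem[OF subalgebra]

lemma comm: "x \<in> D \<Longrightarrow> y \<in> D \<Longrightarrow> x * y = y * x"
  using commutative by (auto simp: abelian_def)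

lemma left_comm: "x \<in> D \<Longrightarrow> y \<in> D \<Longrightarrow> x * (y * z) = y * (x * z)"
  by (simp add: comm mult.assoc[symmetric])

lemmas ac = mult.assoc comm left_comm

text \<open>
  Commutativity turns the \<open>C\<^sup>*\<close>-identity, applied to \<open>x\<^sup>2\<close> and then to \<open>x\<^sup>* x\<close>, into
  power-multiplicativity of the norm.  This is the property by which characters will be found.
\<close>

lemma norm_square: "norm (x * x) = (norm x)\<^sup>2" if "x \<in> D"
proof -
  have "(norm (x * x))\<^sup>2 = norm (adj (x * x) * (x * x))"
    by (simp only: norm_adj_mult_self)
  also have "adj (x * x) * (x * x) = adj (adj x * x) * (adj x * x)"
    using that by (simp add: ac)
  also have "norm \<dots> = ((norm x)\<^sup>2)\<^sup>2"
    by (simp only: norm_adj_mult_self)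
  finally show ?thesis
    by (metis norm_ge_zero power2_eq_iff_nonneg zero_le_power2)
qed

lemma square_eq_0: "x * x = 0 \<Longrightarrow> x \<in> D \<Longrightarrow> x = 0"
  using norm_square[of x] by simp

end

section \<open>Characters of commutative \<open>C\<^sup>*\<close>-algebras\<close>

text \<open>
  Only inequalities are demanded, because they survive infima and limits; the converse inequalities
  follow from homogeneity and submultiplicativity.
\<close>

definition power_seminorm :: "'a::cstar_algebra set \<Rightarrow> ('a \<Rightarrow> real) \<Rightarrow> bool" where
  "power_seminorm D q \<longleftrightarrow>
     (\<forall>x\<in>D. 0 \<le> q x \<and> q x \<le> norm x) \<and>
     (\<forall>x\<in>D. \<forall>y\<in>D. q (x + y) \<le> q x + q y) \<and>
     (\<forall>c. \<forall>x\<in>D. q (c *\<^sub>C x) \<le> cmod c * q x) \<and>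
     (\<forall>x\<in>D. \<forall>y\<in>D. q (x * y) \<le> q x * q y) \<and>
     (\<forall>x\<in>D. (q x)\<^sup>2 \<le> q (x * x))"

lemma power_seminormD:
  assumes "power_seminorm D q"
  shows "\<And>x. x \<in> D \<Longrightarrow> 0 \<le> q x" "\<And>x. x \<in> D \<Longrightarrow> q x \<le> norm x"
    "\<And>x y. x \<in> D \<Longrightarrow> y \<in> D \<Longrightarrow> q (x + y) \<le> q x + q y"
    "\<And>c x. x \<in> D \<Longrightarrow> q (c *\<^sub>C x) \<le> cmod c * q x"
    "\<And>x y. x \<in> D \<Longrightarrow> y \<in> D \<Longrightarrow> q (x * y) \<le> q x * q y"
    "\<And>x. x \<in> D \<Longrightarrow> (q x)\<^sup>2 \<le> q (x * x)"
  using assms by (auto simp: power_seminorm_def)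

text \<open>The power \<open>y\<^sup>n\<^sup>+\<^sup>1\<close>; the algebras have no unit, hence the shift.\<close>

primrec pow_Suc :: "'a::cstar_algebra \<Rightarrow> nat \<Rightarrow> 'a" where
  "pow_Suc y 0 = y"
| "pow_Suc y (Suc n) = y * pow_Suc y n"

lemma pow_Suc_add: "pow_Suc y (m + n + 1) = pow_Suc y m * pow_Suc y n"
  by (induction m) (simp_all add: mult.assoc)

context commutative_cstar
begin

lemma pow_Suc_mem [simp]: "y \<in> D \<Longrightarrow> pow_Suc y n \<in> D"
  by (induction n) auto

lemma power_seminorm_scaleC:
  assumes "power_seminorm D q" "x \<in> D"
  shows "q (c *\<^sub>C x) = cmod c * q x"
proof (cases "c = 0")
  case True
  then show ?thesis
    using power_seminormD(1,4)[OF assms(1), of _ ] power_seminormD(2)[OF assms(1), of 0]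
      power_seminormD(1)[OF assms(1), of 0] by fastforce
next
  case False
  have "q ((1 / c) *\<^sub>C c *\<^sub>C x) \<le> cmod (1 / c) * q (c *\<^sub>C x)"
    using assms by (intro power_seminormD(4)) auto
  then have "cmod c * q x \<le> q (c *\<^sub>C x)"
    using False by (simp add: scaleC_scaleC norm_divide field_simps)
  then show ?thesis
    using power_seminormD(4)[OF assms, of c] by simp
qed

text \<open>
  Equality holds at exponents that are powers of two.  A strict inequality at one exponent would
  persist, by submultiplicativity, at all larger exponents.
\<close>

lemma power_seminorm_pow_Suc:
  assumes q: "power_seminorm D q" and y: "y \<in> D"
  shows "q (pow_Suc y n) = q y ^ Suc n"
proof -
  have nonneg: "0 \<le> q y" using power_seminormD(1)[OF q y] .
  have le: "q (pow_Suc y n) \<le> q y ^ Suc n" for n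
  proof (induction n)
    case (Suc n)
    have "q (pow_Suc y (Suc n)) \<le> q y * q (pow_Suc y n)"
      using power_seminormD(5)[OF q] y by simp
    also have "\<dots> \<le> q y * q y ^ Suc n"
      using Suc nonneg by (intro mult_left_mono) auto
    finally show ?case by simp
  qed simp
  have ge: "q y ^ (2 ^ k) \<le> q (pow_Suc y (2 ^ k - 1))" for k
  proof (induction k)
    case (Suc k)
    have e: "(2::nat) ^ Suc k - 1 = (2 ^ k - 1) + (2 ^ k - 1) + 1"
      using one_le_power[of "2::nat" k] by (simp del: one_le_power, linarith)
    have "q y ^ (2 ^ Suc k) = (q y ^ (2 ^ k))\<^sup>2"
      by (simp add: power_mult[symmetric] mult.commute)
    also have "\<dots> \<le> (q (pow_Suc y (2 ^ k - 1)))\<^sup>2"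
      using Suc nonneg by (intro power_mono) auto
    also have "\<dots> \<le> q (pow_Suc y (2 ^ k - 1) * pow_Suc y (2 ^ k - 1))"
      using power_seminormD(6)[OF q] y by simp
    finally show ?case by (simp only: e pow_Suc_add)
  qed simp
  show ?thesis
  proof (rule ccontr)
    assume "q (pow_Suc y n) \<noteq> q y ^ Suc n"
    then have less: "q (pow_Suc y n) < q y ^ Suc n" using le[of n] by simp
    then have pos: "0 < q y"
      using nonneg power_seminormD(1)[OF q, of "pow_Suc y n"] y
      by (metis less_eq_real_def not_less pow_Suc_mem power_0_Suc)
    have n2: "n + 1 < 2 ^ (n + 1)" by (rule less_exp)
    define m where "m = 2 ^ (n + 1) - 1 - (n + 1)"
    have e: "2 ^ (n + 1) - 1 = n + m + 1" "(2::nat) ^ (n + 1) = Suc n + Suc m"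
      using n2 by (simp_all add: m_def)
    have "q y ^ (2 ^ (n + 1)) \<le> q (pow_Suc y n * pow_Suc y m)"
      using ge[of "n + 1"] by (simp only: e(1) pow_Suc_add)
    also have "\<dots> \<le> q (pow_Suc y n) * q (pow_Suc y m)"
      using power_seminormD(5)[OF q] y by simp
    also have "\<dots> \<le> q (pow_Suc y n) * q y ^ Suc m"
      using le[of m] power_seminormD(1)[OF q] y by (intro mult_left_mono) auto
    also have "\<dots> < q y ^ Suc n * q y ^ Suc m"
      using less pos by (intro mult_strict_right_mono) auto
    also have "\<dots> = q y ^ (2 ^ (n + 1))"
      unfolding e(2) by (rule power_add[symmetric])
    finally show False by simp
  qed
qed


lemma power_seminorm_norm: "power_seminorm D norm"
  by (auto simp: power_seminorm_def norm_triangle_ineq norm_scaleC norm_mult_ineq norm_square)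

text \<open>
  The seminorm \<open>p x = lim q (y\<^sup>n x) / q (y)\<^sup>n\<close> concentrates \<open>q\<close> where \<open>y\<close> is largest.  It is
  dominated by \<open>q\<close> and makes \<open>y\<close> multiplicative, while elements that are already multiplicative
  for \<open>q\<close> keep both that property and their value.  Thus a minimal seminorm is multiplicative.
\<close>

lemma power_seminorm_localize:
  assumes q: "power_seminorm D q" and y: "y \<in> D" and pos: "0 < q y"
  obtains p where "power_seminorm D p" "\<forall>x\<in>D. p x \<le> q x"
    "q y \<le> p y" "\<forall>x\<in>D. q y * p x \<le> p (y * x)"
    "\<forall>z\<in>D. (\<forall>x\<in>D. q z * q x \<le> q (z * x)) \<longrightarrow>
       q z \<le> p z \<and> (\<forall>x\<in>D. q z * p x \<le> p (z * x))"
proof -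
  define a where "a n x = q (pow_Suc y n * x) / q y ^ Suc n" for n x
  define p where "p x = lim (\<lambda>n. a n x)" for x
  note qD = power_seminormD[OF q]
  have nonneg: "0 \<le> a n x" if "x \<in> D" for n x
    using that y qD(1) by (simp add: a_def divide_nonneg_nonneg less_imp_le[OF pos])
  have step: "a (Suc n) x \<le> a n x" if "x \<in> D" for n x
  proof -
    have "q (y * (pow_Suc y n * x)) \<le> q y * q (pow_Suc y n * x)"
      using that y by (intro qD) auto
    then show ?thesis
      using pos by (simp add: a_def mult.assoc field_simps)
  qed
  have lim: "(\<lambda>n. a n x) \<longlonglongrightarrow> p x" if "x \<in> D" for x
  proof -
    have "decseq (\<lambda>n. a n x)" using step[OF that] by (rule decseq_SucI)
    then have "convergent (\<lambda>n. a n x)"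
      using decseq_convergent[of "\<lambda>n. a n x" 0] nonneg[OF that] by (metis convergent_def)
    then show ?thesis unfolding p_def by (simp add: convergent_LIMSEQ_iff)
  qed
  have lim2: "(\<lambda>n. a (n + n + 1) x) \<longlonglongrightarrow> p x" if "x \<in> D" for x
    using LIMSEQ_subseq_LIMSEQ[OF lim[OF that], of "\<lambda>n. n + n + 1"] by (simp add: strict_mono_def o_def)
  have le: "p x \<le> q x" if x: "x \<in> D" for x
  proof (rule LIMSEQ_le_const2[OF lim[OF x]])
    have "q (pow_Suc y n * x) \<le> q y ^ Suc n * q x" for n
      using qD(5)[of "pow_Suc y n" x] x y by (simp only: power_seminorm_pow_Suc[OF q y] pow_Suc_mem)
    then show "\<exists>N. \<forall>n\<ge>N. a n x \<le> q x"
      using pos by (simp add: a_def divide_le_eq mult.commute del: power_Suc)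
  qed
  have e2: "pow_Suc y (n + n + 1) * (x * z) = (pow_Suc y n * x) * (pow_Suc y n * z)"
    if "x \<in> D" "z \<in> D" for n x z
    using that y by (simp only: pow_Suc_add) (simp add: ac)
  have p2: "q y ^ Suc (n + n + 1) = q y ^ Suc n * q y ^ Suc n" for n
    by (simp add: power_add)
  have seminorm: "power_seminorm D p"
    unfolding power_seminorm_def
  proof (intro conjI ballI allI)
    fix x assume x: "x \<in> D"
    show "0 \<le> p x" using LIMSEQ_le_const[OF lim[OF x]] nonneg[OF x] by blast
    show "p x \<le> norm x" using le[OF x] qD(2)[OF x] by simp
    show "p (c *\<^sub>C x) \<le> cmod c * p x" for c
    proof (rule LIMSEQ_le[OF lim tendsto_mult_left[OF lim[OF x]]])
      have "a n (c *\<^sub>C x) \<le> cmod c * a n x" for n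
        using qD(4)[of "pow_Suc y n * x" c] x y pos by (simp add: a_def mult_scaleC_right divide_right_mono)
      then show "\<exists>N. \<forall>n\<ge>N. a n (c *\<^sub>C x) \<le> cmod c * a n x" by blast
    qed (use x in auto)
    show "(p x)\<^sup>2 \<le> p (x * x)"
    proof (rule LIMSEQ_le[OF tendsto_power[OF lim[OF x]] lim2])
      have "(a n x)\<^sup>2 \<le> a (n + n + 1) (x * x)" for n
        unfolding a_def e2[OF x x] p2 using qD(6)[of "pow_Suc y n * x"] x y pos
        by (simp add: power2_eq_square divide_right_mono)
      then show "\<exists>N. \<forall>n\<ge>N. (a n x)\<^sup>2 \<le> a (n + n + 1) (x * x)" by blast
    qed (use x in auto)
    fix z assume z: "z \<in> D"
    show "p (x + z) \<le> p x + p z"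
    proof (rule LIMSEQ_le[OF lim tendsto_add[OF lim[OF x] lim[OF z]]])
      have "a n (x + z) \<le> a n x + a n z" for n
        using qD(3)[of "pow_Suc y n * x" "pow_Suc y n * z"] x z y pos
        by (simp add: a_def distrib_left add_divide_distrib[symmetric] divide_right_mono)
      then show "\<exists>N. \<forall>n\<ge>N. a n (x + z) \<le> a n x + a n z" by blast
    qed (use x z in auto)
    show "p (x * z) \<le> p x * p z"
    proof (rule LIMSEQ_le[OF lim2 tendsto_mult[OF lim[OF x] lim[OF z]]])
      have "a (n + n + 1) (x * z) \<le> a n x * a n z" for n
        unfolding a_def e2[OF x z] p2 using qD(5)[of "pow_Suc y n * x" "pow_Suc y n * z"] x z y pos
        by (simp add: divide_right_mono)
      then show "\<exists>N. \<forall>n\<ge>N. a (n + n + 1) (x * z) \<le> a n x * a n z" by blast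
    qed (use x z in auto)
  qed
  have "a n y = q y" for n
    using power_seminorm_pow_Suc[OF q y, of "Suc n"] y pos comm[OF y, of "pow_Suc y n"]
    by (simp add: a_def)
  then have at_y: "q y \<le> p y"
    using LIMSEQ_le_const[OF lim[OF y]] by fastforce
  have mult_y: "q y * p x \<le> p (y * x)" if x: "x \<in> D" for x
  proof (rule LIMSEQ_le[OF tendsto_mult_left[OF LIMSEQ_Suc[OF lim[OF x]]] lim])
    have "q y * a (Suc n) x = a n (y * x)" for n
      using x y pos by (simp add: a_def ac)
    then show "\<exists>N. \<forall>n\<ge>N. q y * a (Suc n) x \<le> a n (y * x)" by auto
  qed (use x y in auto)
  have mult_z: "q z \<le> p z \<and> (\<forall>x\<in>D. q z * p x \<le> p (z * x))"
    if z: "z \<in> D" and zm: "\<forall>x\<in>D. q z * q x \<le> q (z * x)" for z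
  proof -
  have *: "q z * q (pow_Suc y n * x) \<le> q (pow_Suc y n * (z * x))" if "x \<in> D" for n x
    using zm[rule_format, of "pow_Suc y n * x"] that z y by (simp add: ac)
  show ?thesis
  proof (intro conjI ballI)
    have "q z \<le> a n z" for n
    proof -
      have "q z * q y ^ Suc n \<le> q (pow_Suc y n * z)"
        using zm[rule_format, of "pow_Suc y n"] y z comm[of z "pow_Suc y n"]
        by (simp only: power_seminorm_pow_Suc[OF q y] pow_Suc_mem)
      then show ?thesis using pos by (simp add: a_def field_simps)
    qed
    then show "q z \<le> p z"
      using LIMSEQ_le_const[OF lim[OF z]] by blast
    fix x assume x: "x \<in> D"
    show "q z * p x \<le> p (z * x)"
    proof (rule LIMSEQ_le[OF tendsto_mult_left[OF lim[OF x]] lim])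
      have "q z * a n x \<le> a n (z * x)" for n
        using *[OF x, of n] pos by (simp add: a_def field_simps)
      then show "\<exists>N. \<forall>n\<ge>N. q z * a n x \<le> a n (z * x)" by blast
    qed (use x z in auto)
  qed
  qed
  show thesis
    by (rule that[of p]) (use seminorm le at_y mult_y mult_z in auto)
qed

text \<open>
  In a chain two members can be replaced by the smaller one, so that the two-variable inequalities
  pass to the infimum.
\<close>

lemma power_seminorm_Inf_chain:
  assumes ne: "C \<noteq> {}" and C: "\<And>q. q \<in> C \<Longrightarrow> power_seminorm D q"
    and chain: "\<And>q r. q \<in> C \<Longrightarrow> r \<in> C \<Longrightarrow> q \<le> r \<or> r \<le> q"
  shows "power_seminorm D (\<lambda>x. INF q\<in>C. q x)"
proof -
  let ?u = "\<lambda>x. INF q\<in>C. q x"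
  have bdd: "bdd_below ((\<lambda>q. q x) ` C)" if "x \<in> D" for x
    using power_seminormD(1)[OF C that] by (auto intro!: bdd_belowI[of _ 0])
  have lower: "?u x \<le> q x" if "q \<in> C" "x \<in> D" for q x
    using that by (intro cINF_lower bdd) auto
  have greatest: "b \<le> ?u x" if "\<And>q. q \<in> C \<Longrightarrow> b \<le> q x" for b x
    using that ne by (intro cINF_greatest) auto
  have nonneg: "0 \<le> ?u x" if "x \<in> D" for x
    using power_seminormD(1)[OF C that] by (intro greatest) auto
  have common: "\<exists>q\<in>C. q x \<le> q1 x \<and> q z \<le> q2 z" if "q1 \<in> C" "q2 \<in> C" for q1 q2 x z
    using chain[OF that] that by (metis le_funD order_refl)
  show ?thesis
    unfolding power_seminorm_def
  proof (intro conjI ballI allI)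
    fix x assume x: "x \<in> D"
    show "0 \<le> ?u x" using nonneg x .
    obtain q0 where q0: "q0 \<in> C" using ne by auto
    show "?u x \<le> norm x"
      using lower[OF q0 x] power_seminormD(2)[OF C[OF q0] x] by simp
    show "?u (c *\<^sub>C x) \<le> cmod c * ?u x" for c
    proof (cases "c = 0")
      case True
      then show ?thesis
        using lower[OF q0, of 0] power_seminormD(2)[OF C[OF q0], of 0] by simp
    next
      case False
      have "?u (c *\<^sub>C x) / cmod c \<le> ?u x"
      proof (rule greatest)
        fix q assume q: "q \<in> C"
        have "?u (c *\<^sub>C x) \<le> cmod c * q x"
          using lower[OF q, of "c *\<^sub>C x"] power_seminormD(4)[OF C[OF q] x, of c] x by simp
        then show "?u (c *\<^sub>C x) / cmod c \<le> q x" using False by (simp add: field_simps)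
      qed
      then show ?thesis using False by (simp add: field_simps)
    qed
    show "(?u x)\<^sup>2 \<le> ?u (x * x)"
    proof (rule greatest)
      fix q assume q: "q \<in> C"
      have "(?u x)\<^sup>2 \<le> (q x)\<^sup>2"
        using lower[OF q x] nonneg[OF x] by (rule power_mono)
      also have "\<dots> \<le> q (x * x)" using power_seminormD(6)[OF C[OF q] x] .
      finally show "(?u x)\<^sup>2 \<le> q (x * x)" .
    qed
    fix z assume z: "z \<in> D"
    have add: "?u (x + z) \<le> q1 x + q2 z" if "q1 \<in> C" "q2 \<in> C" for q1 q2
    proof -
      obtain q where q: "q \<in> C" "q x \<le> q1 x" "q z \<le> q2 z" using common[OF \<open>q1 \<in> C\<close> \<open>q2 \<in> C\<close>] by blast
      have "?u (x + z) \<le> q (x + z)" using q(1) x z by (intro lower) auto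
      also have "\<dots> \<le> q x + q z" using power_seminormD(3)[OF C[OF q(1)] x z] .
      finally show ?thesis using q by simp
    qed
    have "?u (x + z) - q2 z \<le> ?u x" if "q2 \<in> C" for q2
      using add[OF _ that] by (intro greatest) (simp add: algebra_simps)
    then have "?u (x + z) - ?u x \<le> ?u z"
      by (intro greatest) (simp add: algebra_simps)
    then show "?u (x + z) \<le> ?u x + ?u z" by simp
    have mul: "?u (x * z) \<le> q1 x * q2 z" if "q1 \<in> C" "q2 \<in> C" for q1 q2
    proof -
      obtain q where q: "q \<in> C" "q x \<le> q1 x" "q z \<le> q2 z" using common[OF \<open>q1 \<in> C\<close> \<open>q2 \<in> C\<close>] by blast
      have "?u (x * z) \<le> q (x * z)" using q(1) x z by (intro lower) auto
      also have "\<dots> \<le> q x * q z" using power_seminormD(5)[OF C[OF q(1)] x z] .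
      also have "\<dots> \<le> q1 x * q2 z"
        using q power_seminormD(1)[OF C[OF q(1)]] x z by (intro mult_mono) (auto intro: order_trans)
      finally show ?thesis .
    qed
    have div: "b \<le> s * ?u v" if "\<And>q. q \<in> C \<Longrightarrow> b \<le> s * q v" "0 \<le> s" for b s v
    proof (cases "s = 0")
      case True
      then show ?thesis using that(1)[OF q0] by simp
    next
      case False
      then have "b / s \<le> ?u v"
        using that by (intro greatest) (simp add: divide_le_eq mult.commute)
      then show ?thesis using False that(2) by (simp add: divide_le_eq mult.commute)
    qed
    have "?u (x * z) \<le> ?u x * q2 z" if "q2 \<in> C" for q2
      using div[of "?u (x * z)" "q2 z" x] mul[OF _ that] power_seminormD(1)[OF C[OF that] z]
      by (simp add: mult.commute)
    then show "?u (x * z) \<le> ?u x * ?u z"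
      using nonneg[OF x] by (intro div) auto
  qed
qed

text \<open>
  The seminorms that give \<open>x0\<close> its norm and are multiplicative in \<open>x0\<close> have a minimal element by
  Zorn's lemma, the localization of the norm at \<open>x0\<close> being one of them.  Localizing a minimal one
  at any \<open>y\<close> stays in this family and so changes nothing, which says that \<open>y\<close> is multiplicative.
\<close>

lemma multiplicative_seminorm:
  assumes x0: "x0 \<in> D" "x0 \<noteq> 0"
  obtains q where "power_seminorm D q" "q x0 = norm x0"
    "\<And>x y. x \<in> D \<Longrightarrow> y \<in> D \<Longrightarrow> q (x * y) = q x * q y"
proof -
  define S where "S = {q. power_seminorm D q \<and> (\<forall>x. x \<notin> D \<longrightarrow> q x = 0) \<and>
    norm x0 \<le> q x0 \<and> (\<forall>x\<in>D. norm x0 * q x \<le> q (x0 * x))}"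
  have truncate: "\<exists>p'\<in>S. \<forall>x\<in>D. p' x = p x"
    if p: "power_seminorm D p" "norm x0 \<le> p x0" "\<And>x. x \<in> D \<Longrightarrow> norm x0 * p x \<le> p (x0 * x)" for p
  proof
    let ?p = "\<lambda>x. if x \<in> D then p x else 0"
    have "power_seminorm D ?p"
      using p(1) unfolding power_seminorm_def by simp
    then show "?p \<in> S" using p x0 by (simp add: S_def)
  qed simp
  have "\<exists>m\<in>S. \<forall>a\<in>S. a \<le> m \<longrightarrow> a = m"
  proof (rule predicate_Zorn[of S "\<lambda>a b. b \<le> a"])
    show "partial_order_on S (relation_of (\<lambda>a b. b \<le> a) S)"
      by (rule partial_order_on_relation_ofI) auto
    fix C assume "C \<in> Chains (relation_of (\<lambda>a b. b \<le> a) S)"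
    then have CS: "C \<subseteq> S" and chain: "\<And>q r. q \<in> C \<Longrightarrow> r \<in> C \<Longrightarrow> q \<le> r \<or> r \<le> q"
      by (auto simp: Chains_def relation_of_def)
    show "\<exists>u\<in>S. \<forall>a\<in>C. u \<le> a"
    proof (cases "C = {}")
      case True
      have "0 < norm x0" using x0(2) by simp
      then obtain p where "power_seminorm D p" "norm x0 \<le> p x0"
        "\<forall>x\<in>D. norm x0 * p x \<le> p (x0 * x)"
        by (rule power_seminorm_localize[OF power_seminorm_norm x0(1)])
      then show ?thesis using truncate[of p] True by auto
    next
      case False
      let ?u = "\<lambda>x. INF q\<in>C. q x"
      have Cp: "power_seminorm D q" if "q \<in> C" for q using CS that by (auto simp: S_def)
      have lower: "?u x \<le> q x" if "q \<in> C" for q x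
      proof (rule cINF_lower[OF _ that])
        have "0 \<le> q x" if "q \<in> C" for q
          using CS that power_seminormD(1)[of D q x] by (cases "x \<in> D") (auto simp: S_def)
        then show "bdd_below ((\<lambda>q. q x) ` C)" by (auto intro!: bdd_belowI[of _ 0])
      qed
      have "?u \<in> S"
        unfolding S_def
      proof (intro CollectI conjI allI impI ballI)
        show "power_seminorm D ?u"
          using False Cp chain by (rule power_seminorm_Inf_chain)
        show "?u x = 0" if "x \<notin> D" for x
        proof -
          have "?u x = (INF q\<in>C. (0::real))"
            using CS that by (intro INF_cong) (auto simp: S_def)
          then show ?thesis using False by simp
        qed
        show "norm x0 \<le> ?u x0"
          using CS False by (intro cINF_greatest) (auto simp: S_def)
        fix x assume x: "x \<in> D"
        show "norm x0 * ?u x \<le> ?u (x0 * x)"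
        proof (rule cINF_greatest[OF False])
          fix q assume q: "q \<in> C"
          have "norm x0 * ?u x \<le> norm x0 * q x"
            using lower[OF q] by (intro mult_left_mono) auto
          also have "\<dots> \<le> q (x0 * x)" using CS q x by (auto simp: S_def)
          finally show "norm x0 * ?u x \<le> q (x0 * x)" .
        qed
      qed
      then show ?thesis
      proof (rule bexI[of _ ?u, rotated])
        show "\<forall>a\<in>C. ?u \<le> a"
        proof (rule ballI, rule le_funI)
          fix a x assume "a \<in> C"
          then show "?u x \<le> a x" by (rule lower)
        qed
      qed
    qed
  qed
  then obtain q where qS: "q \<in> S" and min: "\<And>a. a \<in> S \<Longrightarrow> a \<le> q \<Longrightarrow> a = q" by blast
  have q: "power_seminorm D q" "norm x0 \<le> q x0" "\<And>x. x \<in> D \<Longrightarrow> norm x0 * q x \<le> q (x0 * x)"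
    and out: "\<And>x. x \<notin> D \<Longrightarrow> q x = 0"
    using qS by (auto simp: S_def)
  have x0q: "q x0 = norm x0"
    using q(2) power_seminormD(2)[OF q(1) x0(1)] by simp
  have "q (x * y) = q x * q y" if x: "x \<in> D" and y: "y \<in> D" for x y
  proof (cases "q y = 0")
    case True
    then show ?thesis
      using power_seminormD(5)[OF q(1) x y] power_seminormD(1)[OF q(1), of "x * y"] x y by simp
  next
    case False
    then have "0 < q y" using power_seminormD(1)[OF q(1) y] by simp
    then obtain p where p: "power_seminorm D p" "\<forall>x\<in>D. p x \<le> q x"
      "\<forall>x\<in>D. q y * p x \<le> p (y * x)" and
      pz: "\<forall>z\<in>D. (\<forall>x\<in>D. q z * q x \<le> q (z * x)) \<longrightarrow>
       q z \<le> p z \<and> (\<forall>x\<in>D. q z * p x \<le> p (z * x))"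
      by (rule power_seminorm_localize[OF q(1) y])
    have "norm x0 \<le> p x0 \<and> (\<forall>x\<in>D. norm x0 * p x \<le> p (x0 * x))"
      using pz[rule_format, OF x0(1)] q(3) by (simp add: x0q)
    then obtain p' where p': "p' \<in> S" "\<And>x. x \<in> D \<Longrightarrow> p' x = p x"
      using truncate[OF p(1)] by blast
    have "p' \<le> q"
    proof (rule le_funI)
      fix x show "p' x \<le> q x"
        using p' p(2) out[of x] by (cases "x \<in> D") (auto simp: S_def)
    qed
    then have "p' = q" using min p'(1) by blast
    then have "q y * q x \<le> q (y * x)" using p(3) p'(2) x y by simp
    then show ?thesis
      using power_seminormD(5)[OF q(1) x y] comm[OF x y] by (simp add: mult.commute)
  qed
  then show ?thesis using that q(1) x0q by blast
qed


text \<open>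
  This is the Gelfand--Mazur theorem: for a multiplicative seminorm every element is a scalar.  Here
  \<open>e\<close> replaces the unit, and \<open>R d c\<close> is the value of the seminorm at \<open>d + c\<close> in the unitization.  The
  function \<open>N l\<close>, the value at \<open>x - l\<close>, has a minimum \<open>m\<close>.  If \<open>m\<close> were positive, then \<open>N\<close> would be
  constant on discs of radius \<open>m\<close> around minimum points, hence constant on a ray, but it tends to
  infinity.
\<close>

lemma scalar_of_multiplicative_seminorm:
  assumes q: "power_seminorm D q" and mult: "\<And>x y. x \<in> D \<Longrightarrow> y \<in> D \<Longrightarrow> q (x * y) = q x * q y"
    and e: "e \<in> D" "q e \<noteq> 0" and x: "x \<in> D"
  shows "\<exists>l. q (x * e - l *\<^sub>C e) = 0"
proof -
  note qD = power_seminormD[OF q] and qs = power_seminorm_scaleC[OF q]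
  define R where "R d c = q (d * e + c *\<^sub>C e) / q e" for d c
  have qe: "0 < q e" using qD(1)[OF e(1)] e(2) by simp
  have R_mult: "R d c * R d' c' = R (d * d' + c *\<^sub>C d' + c' *\<^sub>C d) (c * c')"
    if "d \<in> D" "d' \<in> D" for d d' c c'
  proof -
    have "(d * e + c *\<^sub>C e) * (d' * e + c' *\<^sub>C e) =
        ((d * d' + c *\<^sub>C d' + c' *\<^sub>C d) * e + (c * c') *\<^sub>C e) * e"
      using that e by (simp add: distrib_left distrib_right mult_scaleC_left mult_scaleC_right
          scaleC_scaleC scaleC_add_right ac add_ac mult.commute[of c' c])
    then have "q (d * e + c *\<^sub>C e) * q (d' * e + c' *\<^sub>C e) =
        q ((d * d' + c *\<^sub>C d' + c' *\<^sub>C d) * e + (c * c') *\<^sub>C e) * q e"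
      using that e by (metis mem(2,5,6) mult)
    then show ?thesis using qe by (simp add: R_def field_simps)
  qed
  have R_nonneg: "0 \<le> R d c" if "d \<in> D" for d c
    using that e qD(1) qe by (simp add: R_def)
  have R_add: "R d (c + v) \<le> R d c + cmod v" if "d \<in> D" for d c v
  proof -
    have "d * e + (c + v) *\<^sub>C e = (d * e + c *\<^sub>C e) + v *\<^sub>C e"
      by (simp add: scaleC_add_left add_ac)
    then have "q (d * e + (c + v) *\<^sub>C e) \<le> q (d * e + c *\<^sub>C e) + cmod v * q e"
      using qD(3)[of "d * e + c *\<^sub>C e" "v *\<^sub>C e"] that e by (simp add: qs add.assoc)
    then show ?thesis using qe by (simp add: R_def field_simps)
  qed
  define N where "N l = R x (- l)" for l
  have N_ge: "cmod l - q x \<le> N l" for l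
  proof -
    have "q (l *\<^sub>C e) \<le> q (- (x * e + (- l) *\<^sub>C e)) + q (x * e)"
      using qD(3)[of "- (x * e + (- l) *\<^sub>C e)" "x * e"] x e by simp
    moreover have "q (- (x * e + (- l) *\<^sub>C e)) = q (x * e + (- l) *\<^sub>C e)"
      using qs[of "x * e + (- l) *\<^sub>C e" "- 1"] x e by simp
    ultimately have "cmod l * q e \<le> q (x * e + (- l) *\<^sub>C e) + q x * q e"
      using x e by (simp add: qs mult)
    then show ?thesis using qe by (simp add: N_def R_def field_simps)
  qed
  have lip: "\<bar>N a - N b\<bar> \<le> cmod (a - b)" for a b
    using R_add[OF x, of "- a" "a - b"] R_add[OF x, of "- b" "b - a"]
    by (simp add: N_def abs_le_iff norm_minus_commute algebra_simps)
  have cont: "continuous_on A N" for A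
    unfolding continuous_on_iff using lip by (metis dist_complex_def dist_real_def le_less_trans)
  obtain l0 where l0: "\<And>l. N l0 \<le> N l"
  proof -
    define r where "r = N 0 + q x"
    have r: "0 \<le> r" using R_nonneg[OF x] qD(1)[OF x] by (simp add: r_def N_def)
    obtain l0 where "l0 \<in> cball 0 r" "\<And>l. l \<in> cball 0 r \<Longrightarrow> N l0 \<le> N l"
      using continuous_attains_inf[OF compact_cball[of 0 r] _ cont] r by auto
    moreover have "N l0 \<le> N l" if "l \<notin> cball 0 r" for l
      using that N_ge[of l] calculation(2)[of 0] r by (simp add: r_def)
    ultimately show ?thesis using that by blast
  qed
  have "N l0 = 0"
  proof (rule ccontr)
    define m where "m = N l0"
    assume "N l0 \<noteq> 0"
    then have m: "0 < m" using R_nonneg[OF x] by (simp add: m_def N_def order_less_le)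
    have spread: "N (l + u) = m" if l: "N l = m" and u: "cmod u < m" for l u
    proof -
      \<comment> \<open>The element \<open>d + c\<close> is \<open>(x - l)\<close> to the power \<open>2 ^ k\<close>.  Differences of squares factor, and complex
      square roots exist, so the lower bound \<open>m\<close> passes to all translates of this power.\<close>
      have *: "\<exists>d\<in>D. \<exists>c. R d c \<le> m ^ 2 ^ k \<and> (\<forall>v. m ^ 2 ^ k \<le> R d (c - v)) \<and>
          N (l + u) * m ^ (2 ^ k - 1) \<le> R d (c - u ^ 2 ^ k)" for k
      proof (induction k)
        case 0
        have "m \<le> R x (- l - v)" for v
          using l0[of "l + v"] by (simp add: N_def m_def)
        then show ?case
          using x l by (intro bexI[of _ x] exI[of _ "- l"]) (auto simp: N_def)
      next
        case (Suc k)
        then obtain d c where d: "d \<in> D" and dc: "R d c \<le> m ^ 2 ^ k"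
          "\<And>v. m ^ 2 ^ k \<le> R d (c - v)" "N (l + u) * m ^ (2 ^ k - 1) \<le> R d (c - u ^ 2 ^ k)"
          by blast
        define d' where "d' = d * d + c *\<^sub>C d + c *\<^sub>C d"
        have fac: "R d' (c * c - s * s) = R d (c - s) * R d (c + s)" for s
        proof -
          have "d * d + (c - s) *\<^sub>C d + (c + s) *\<^sub>C d = d'"
            by (simp add: d'_def complex_vector.scale_left_diff_distrib scaleC_add_left)
          moreover have "(c - s) * (c + s) = c * c - s * s" by (simp add: algebra_simps)
          ultimately show ?thesis using R_mult[OF d d, of "c - s" "c + s"] by simp
        qed
        have p2: "b ^ 2 ^ Suc k = b ^ 2 ^ k * b ^ 2 ^ k" for b :: "'b::comm_monoid_mult"
          by (simp add: power_mult power2_eq_square mult.commute[of 2])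
        have p3: "m ^ (2 ^ Suc k - 1) = m ^ (2 ^ k - 1) * m ^ 2 ^ k"
          by (simp add: power_add[symmetric] mult_2)
        have c1: "R d' (c * c) \<le> m ^ 2 ^ Suc k"
          unfolding p2 using fac[of 0] mult_mono[OF dc(1) dc(1)] R_nonneg[OF d] m by simp
        have dc2: "m ^ 2 ^ k \<le> R d (c + v)" for v
          using dc(2)[of "- v"] by simp
        have c2: "m ^ 2 ^ Suc k \<le> R d' (c * c - v)" for v
          unfolding p2
          using fac[of "csqrt v"] mult_mono[OF dc(2)[of "csqrt v"] dc2[of "csqrt v"]] R_nonneg[OF d] m
          by (simp add: power2_eq_square[symmetric])
        have c3: "N (l + u) * m ^ (2 ^ Suc k - 1) \<le> R d' (c * c - u ^ 2 ^ Suc k)"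
          using fac[of "u ^ 2 ^ k"] mult_mono[OF dc(3) dc2[of "u ^ 2 ^ k"]] R_nonneg[OF d] m
          by (simp only: p2 p3 mult.assoc) simp
        show ?case
          using c1 c2 c3 d by (intro bexI[of _ d'] exI[of _ "c * c"]) (auto simp: d'_def)
      qed
      have le: "N (l + u) \<le> m + m * (cmod u / m) ^ 2 ^ k" for k
      proof -
        obtain d c where d: "d \<in> D" and dc: "R d c \<le> m ^ 2 ^ k"
          "N (l + u) * m ^ (2 ^ k - 1) \<le> R d (c - u ^ 2 ^ k)"
          using *[of k] by blast
        have pm: "m ^ 2 ^ k = m * m ^ (2 ^ k - 1)"
          using power_minus_mult[of "2 ^ k" m] by (simp add: mult.commute)
        have "R d (c - u ^ 2 ^ k) \<le> R d c + cmod u ^ 2 ^ k"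
          using R_add[OF d, of c "- (u ^ 2 ^ k)"] by (simp add: norm_power)
        then have "N (l + u) * m ^ (2 ^ k - 1) \<le> m ^ 2 ^ k + cmod u ^ 2 ^ k"
          using dc by simp
        also have "\<dots> = (m + m * (cmod u / m) ^ 2 ^ k) * m ^ (2 ^ k - 1)"
          using m by (simp add: pm power_divide distrib_right)
        finally show ?thesis using m by simp
      qed
      have "(\<lambda>k. (cmod u / m) ^ 2 ^ k) \<longlonglongrightarrow> 0"
        using LIMSEQ_subseq_LIMSEQ[OF LIMSEQ_power_zero[of "cmod u / m"], of "\<lambda>k. 2 ^ k"] u m
        by (simp add: strict_mono_def o_def)
      then have "(\<lambda>k. m + m * (cmod u / m) ^ 2 ^ k) \<longlonglongrightarrow> m + m * 0"
        by (intro tendsto_intros)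
      then have "N (l + u) \<le> m + m * 0"
        using le by (intro LIMSEQ_le_const) auto
      then show ?thesis using l0[of "l + u"] by (simp add: m_def)
    qed
    have "N (l0 + of_nat n * (of_real (m / 2))) = m" for n
    proof (induction n)
      case (Suc n)
      show ?case
        using spread[OF Suc, of "of_real (m / 2)"] m by (simp add: algebra_simps add_divide_distrib norm_divide)
    qed (simp add: m_def)
    then have *: "cmod (l0 + of_nat n * (of_real (m / 2))) \<le> m + q x" for n
      using N_ge by (metis diff_le_eq)
    obtain n :: nat where "(m + q x + cmod l0) / (m / 2) < real n"
      using reals_Archimedean2 by blast
    then have "m + q x + cmod l0 < real n * (m / 2)"
      using m by (simp add: field_simps)
    also have "\<dots> = cmod (of_nat n * of_real (m / 2))" using m by (simp add: norm_mult)
    also have "\<dots> \<le> cmod (l0 + of_nat n * (of_real (m / 2))) + cmod l0"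
      by (metis add.commute add_diff_cancel_left' norm_triangle_ineq4)
    finally show False using *[of n] by simp
  qed
  then show ?thesis
    using qe by (intro exI[of _ l0]) (simp add: N_def R_def)
qed

end

text \<open>
  The zero functional is included; contractivity is part of the definition, so that pointwise
  estimates over all characters are available at once.
\<close>

definition character :: "'a::cstar_algebra set \<Rightarrow> ('a \<Rightarrow> complex) \<Rightarrow> bool" where
  "character D \<phi> \<longleftrightarrow>
     (\<forall>x\<in>D. \<forall>y\<in>D. \<phi> (x + y) = \<phi> x + \<phi> y) \<and> (\<forall>c. \<forall>x\<in>D. \<phi> (c *\<^sub>C x) = c * \<phi> x) \<and>
     (\<forall>x\<in>D. \<forall>y\<in>D. \<phi> (x * y) = \<phi> x * \<phi> y) \<and> (\<forall>x\<in>D. \<phi> (adj x) = cnj (\<phi> x)) \<and>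
     (\<forall>x\<in>D. cmod (\<phi> x) \<le> norm x)"

context commutative_cstar
begin

lemma characterD:
  assumes "character D \<phi>"
  shows "x \<in> D \<Longrightarrow> y \<in> D \<Longrightarrow> \<phi> (x + y) = \<phi> x + \<phi> y" "x \<in> D \<Longrightarrow> \<phi> (c *\<^sub>C x) = c * \<phi> x"
    "x \<in> D \<Longrightarrow> y \<in> D \<Longrightarrow> \<phi> (x * y) = \<phi> x * \<phi> y" "x \<in> D \<Longrightarrow> \<phi> (adj x) = cnj (\<phi> x)"
    "x \<in> D \<Longrightarrow> cmod (\<phi> x) \<le> norm x" "\<phi> 0 = 0" "x \<in> D \<Longrightarrow> \<phi> (- x) = - \<phi> x"
    "x \<in> D \<Longrightarrow> y \<in> D \<Longrightarrow> \<phi> (x - y) = \<phi> x - \<phi> y"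
proof -
  have add: "\<phi> (x + y) = \<phi> x + \<phi> y" if "x \<in> D" "y \<in> D" for x y
    using assms that by (auto simp: character_def)
  have scale: "\<phi> (c *\<^sub>C x) = c * \<phi> x" if "x \<in> D" for c x
    using assms that by (auto simp: character_def)
  show "\<phi> 0 = 0" using scale[of 0 0] by simp
  show neg: "\<phi> (- x) = - \<phi> x" if "x \<in> D" for x
    using scale[OF that, of "- 1"] by simp
  show "\<phi> (x - y) = \<phi> x - \<phi> y" if "x \<in> D" "y \<in> D"
    using add[of x "- y"] neg[of y] that by simp
qed (use assms in \<open>auto simp: character_def\<close>)

text \<open>
  Take a multiplicative seminorm \<open>q\<close> with \<open>q x0 = norm x0\<close> and let \<open>\<phi> x\<close> be the scalar that \<open>x\<close> is
  for \<open>q\<close>.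
\<close>

theorem character_attaining_norm:
  assumes x0: "x0 \<in> D"
  obtains \<phi> where "character D \<phi>" "cmod (\<phi> x0) = norm x0"
proof (cases "x0 = 0")
  case True
  show ?thesis by (rule that[of "\<lambda>_. 0"]) (simp_all add: True character_def)
next
  case False
  obtain q where q: "power_seminorm D q" and qx0: "q x0 = norm x0"
    and qm: "\<And>x y. x \<in> D \<Longrightarrow> y \<in> D \<Longrightarrow> q (x * y) = q x * q y"
    using multiplicative_seminorm[OF x0 False] by blast
  note qD = power_seminormD[OF q] and qs = power_seminorm_scaleC[OF q]
  have q0: "0 < q x0" using qx0 False by simp
  define \<phi> where "\<phi> x = (SOME l. q (x * x0 - l *\<^sub>C x0) = 0)" for x
  have \<phi>: "q (x * x0 - \<phi> x *\<^sub>C x0) = 0" if "x \<in> D" for x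
    unfolding \<phi>_def using someI_ex[OF scalar_of_multiplicative_seminorm[OF q qm x0 _ that]] q0 by simp
  have q_add0: "q (x + y) = 0" if "x \<in> D" "y \<in> D" "q x = 0" "q y = 0" for x y
    using qD(3)[OF that(1,2)] qD(1)[of "x + y"] that by simp
  have q_neg: "q (- x) = q x" if "x \<in> D" for x
    using qs[OF that, of "- 1"] by simp
  have unique: "\<phi> x = l" if x: "x \<in> D" and l: "q (x * x0 - l *\<^sub>C x0) = 0" for x l
  proof -
    have "(\<phi> x - l) *\<^sub>C x0 = (x * x0 - l *\<^sub>C x0) + - (x * x0 - \<phi> x *\<^sub>C x0)"
      by (simp add: complex_vector.scale_left_diff_distrib)
    then have "q ((\<phi> x - l) *\<^sub>C x0) = 0"
      using q_add0[of "x * x0 - l *\<^sub>C x0" "- (x * x0 - \<phi> x *\<^sub>C x0)"] q_neg[of "x * x0 - \<phi> x *\<^sub>C x0"]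
        \<phi>[OF x] l x x0 by simp
    then show ?thesis using q0 qs[OF x0] by simp
  qed
  have cmod: "cmod (\<phi> x) = q x" if x: "x \<in> D" for x
  proof -
    have e: "x * x0 = (x * x0 - \<phi> x *\<^sub>C x0) + \<phi> x *\<^sub>C x0"
      "\<phi> x *\<^sub>C x0 = - (x * x0 - \<phi> x *\<^sub>C x0) + x * x0" by simp_all
    have "q (x * x0) \<le> q (\<phi> x *\<^sub>C x0)"
      using qD(3)[of "x * x0 - \<phi> x *\<^sub>C x0" "\<phi> x *\<^sub>C x0"] \<phi>[OF x] x x0 by simp
    moreover have "q (\<phi> x *\<^sub>C x0) \<le> q (x * x0)"
      using qD(3)[of "- (x * x0 - \<phi> x *\<^sub>C x0)" "x * x0"] q_neg[of "x * x0 - \<phi> x *\<^sub>C x0"] \<phi>[OF x] x x0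
      by simp
    ultimately show ?thesis using q0 qs[OF x0] qm[OF x x0] by simp
  qed
  have add: "\<phi> (x + y) = \<phi> x + \<phi> y" if "x \<in> D" "y \<in> D" for x y
  proof (rule unique)
    have "(x + y) * x0 - (\<phi> x + \<phi> y) *\<^sub>C x0 = (x * x0 - \<phi> x *\<^sub>C x0) + (y * x0 - \<phi> y *\<^sub>C x0)"
      by (simp add: algebra_simps scaleC_add_left)
    then show "q ((x + y) * x0 - (\<phi> x + \<phi> y) *\<^sub>C x0) = 0"
      using q_add0 \<phi> that x0 by simp
  qed (use that in auto)
  have scale: "\<phi> (c *\<^sub>C x) = c * \<phi> x" if "x \<in> D" for c x
  proof (rule unique)
    have "(c *\<^sub>C x) * x0 - (c * \<phi> x) *\<^sub>C x0 = c *\<^sub>C (x * x0 - \<phi> x *\<^sub>C x0)"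
      by (simp add: mult_scaleC_left complex_vector.scale_right_diff_distrib scaleC_scaleC)
    then show "q ((c *\<^sub>C x) * x0 - (c * \<phi> x) *\<^sub>C x0) = 0"
      using qs \<phi> that x0 by simp
  qed (use that in auto)
  have mul: "\<phi> (x * y) = \<phi> x * \<phi> y" if "x \<in> D" "y \<in> D" for x y
  proof (rule unique)
    have "(x * y) * x0 - (\<phi> x * \<phi> y) *\<^sub>C x0 =
        x * (y * x0 - \<phi> y *\<^sub>C x0) + \<phi> y *\<^sub>C (x * x0 - \<phi> x *\<^sub>C x0)"
      by (simp add: mult.assoc right_diff_distrib mult_scaleC_right
          complex_vector.scale_right_diff_distrib scaleC_scaleC mult.commute)
    moreover have "q (x * (y * x0 - \<phi> y *\<^sub>C x0)) = 0" "q (\<phi> y *\<^sub>C (x * x0 - \<phi> x *\<^sub>C x0)) = 0"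
      using \<phi> that x0 qs qm[of x "y * x0 - \<phi> y *\<^sub>C x0"] by simp_all
    ultimately show "q ((x * y) * x0 - (\<phi> x * \<phi> y) *\<^sub>C x0) = 0"
      using q_add0[of "x * (y * x0 - \<phi> y *\<^sub>C x0)" "\<phi> y *\<^sub>C (x * x0 - \<phi> x *\<^sub>C x0)"] that x0 by simp
  qed (use that in auto)
  have real: "Im (\<phi> x) = 0" if x: "x \<in> D" and sa: "adj x = x" for x
  proof -
    \<comment> \<open>The \<open>C\<^sup>*\<close>-identity bounds \<open>x + i s\<close>; since \<open>\<phi>\<close> attains the norm at \<open>x0\<close>, multiplying by \<open>x0\<close>
    makes up for the missing unit without loss.\<close>
    have bound: "cmod (\<phi> x + \<i> * of_real s) ^ 2 \<le> (norm x)\<^sup>2 + s\<^sup>2" for s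
    proof -
      have ii: "\<i> * (of_real s * (\<i> * of_real s)) = - (of_real s * of_real s :: complex)"
        by (simp add: complex_eq_iff)
      have w: "x * x0 + (\<i> * of_real s) *\<^sub>C x0 \<in> D" using x x0 by simp
      have "\<phi> (x * x0 + (\<i> * of_real s) *\<^sub>C x0) = (\<phi> x + \<i> * of_real s) * \<phi> x0"
        using x x0 by (simp add: add scale mul distrib_right)
      then have "(cmod (\<phi> x + \<i> * of_real s) * norm x0)\<^sup>2 \<le> (norm (x * x0 + (\<i> * of_real s) *\<^sub>C x0))\<^sup>2"
        using cmod[OF w] cmod[OF x0] qD(1,2)[OF w] qx0 by (intro power_mono) (auto simp: norm_mult)
      also have "\<dots> = norm (adj (x * x0 + (\<i> * of_real s) *\<^sub>C x0) * (x * x0 + (\<i> * of_real s) *\<^sub>C x0))"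
        by (simp only: norm_adj_mult_self)
      also have "adj (x * x0 + (\<i> * of_real s) *\<^sub>C x0) * (x * x0 + (\<i> * of_real s) *\<^sub>C x0) =
          (x * x) * (adj x0 * x0) + (s\<^sup>2) *\<^sub>R (adj x0 * x0)"
        using x x0 by (simp add: sa distrib_left distrib_right mult_scaleC_left mult_scaleC_right
            ii left_diff_distrib right_diff_distrib complex_vector.scale_right_diff_distrib
            scaleC_add_right scaleC_scaleC ac power2_eq_square scaleC_of_real[symmetric] complex_vector.scale_minus_left)
      also have "norm \<dots> \<le> norm (x * x) * norm (adj x0 * x0) + s\<^sup>2 * norm (adj x0 * x0)"
        by (rule order_trans[OF norm_triangle_ineq]) (simp add: norm_mult_ineq)
      also have "\<dots> = ((norm x)\<^sup>2 + s\<^sup>2) * (norm x0)\<^sup>2"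
        by (simp only: norm_adj_mult_self norm_square[OF x] distrib_right)
      finally show ?thesis using False by (simp add: power_mult_distrib)
    qed
    show ?thesis
    proof (rule ccontr)
      assume nz: "Im (\<phi> x) \<noteq> 0"
      define b where "b = Im (\<phi> x)"
      have "(Re (\<phi> x))\<^sup>2 + (b + s)\<^sup>2 \<le> (norm x)\<^sup>2 + s\<^sup>2" for s
        using bound[of s] by (simp add: cmod_power2 b_def)
      then have *: "2 * b * s \<le> (norm x)\<^sup>2" for s
        by (smt (verit) power2_sum zero_le_power2 mult.assoc)
      show False
        using *[of "((norm x)\<^sup>2 + 1) / (2 * b)"] nz by (simp add: b_def)
    qed
  qed
  have adj: "\<phi> (adj x) = cnj (\<phi> x)" if x: "x \<in> D" for x
  proof -
    define a b where "a = x + adj x" and "b = \<i> *\<^sub>C (adj x - x)"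
    have "Im (\<phi> a) = 0" "Im (\<phi> b) = 0"
      using x by (auto intro!: real simp: a_def b_def add.commute
          complex_vector.scale_right_diff_distrib)
    moreover have "\<phi> a = \<phi> x + \<phi> (adj x)" "\<phi> b = \<i> * (\<phi> (adj x) - \<phi> x)"
      using x add[of "adj x" "- x"] scale[of x "- 1"] by (simp_all add: a_def b_def add scale)
    ultimately show ?thesis by (simp add: complex_eq_iff)
  qed
  have "character D \<phi>"
    using add scale mul adj cmod qD(2) by (simp add: character_def)
  then show ?thesis using that cmod[OF x0] qx0 by simp
qed


section \<open>Continuous functional calculus\<close>

lemma norm_le_characters:
  assumes "x \<in> D" "\<And>\<phi>. character D \<phi> \<Longrightarrow> cmod (\<phi> x) \<le> b"
  shows "norm x \<le> b"
proof -
  obtain \<phi> where "character D \<phi>" "cmod (\<phi> x) = norm x"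
    by (rule character_attaining_norm[OF assms(1)])
  then show ?thesis using assms(2)[of \<phi>] by simp
qed

lemma eq_characters:
  assumes "x \<in> D" "y \<in> D" "\<And>\<phi>. character D \<phi> \<Longrightarrow> \<phi> x = \<phi> y"
  shows "x = y"
  using norm_le_characters[of "x - y" 0] assms by (simp add: characterD(8))

lemma character_self_adjoint:
  assumes "character D \<phi>" "x \<in> D" "adj x = x"
  shows "\<phi> x = of_real (Re (\<phi> x))"
  using characterD(4)[OF assms(1,2)] assms(3) by (simp add: complex_eq_iff)

text \<open>
  The constant term is subtracted because \<open>D\<close> need not have a unit.
\<close>

lemma polynomial_calculus:
  assumes d: "d \<in> D" "adj d = d" and p: "real_polynomial_function p"
  shows "\<exists>y\<in>D. \<forall>\<phi>. character D \<phi> \<longrightarrow> \<phi> y = of_real (p (Re (\<phi> d)) - p 0)"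
  using p
proof (induction rule: real_polynomial_function.induct)
  case (linear f)
  have f: "f t = f 1 * t" for t
    using linear_simps(5)[OF linear, of t 1] by simp
  show ?case
  proof (intro bexI[of _ "of_real (f 1) *\<^sub>C d"] allI impI)
    fix \<phi> assume \<phi>: "character D \<phi>"
    have "\<phi> (of_real (f 1) *\<^sub>C d) = of_real (f 1) * of_real (Re (\<phi> d))"
      using character_self_adjoint[OF \<phi> d] characterD(2)[OF \<phi> d(1), of "of_real (f 1)"] by simp
    then show "\<phi> (of_real (f 1) *\<^sub>C d) = of_real (f (Re (\<phi> d)) - f 0)"
      using f[of 0] f[of "Re (\<phi> d)"] by simp
  qed (use d in simp)
next
  case (const c)
  then show ?case by (intro bexI[of _ 0]) (auto simp: characterD)
next
  case (add f g)
  then obtain y z where "y \<in> D" "z \<in> D"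
    "\<forall>\<phi>. character D \<phi> \<longrightarrow> \<phi> y = of_real (f (Re (\<phi> d)) - f 0)"
    "\<forall>\<phi>. character D \<phi> \<longrightarrow> \<phi> z = of_real (g (Re (\<phi> d)) - g 0)" by blast
  then show ?case by (intro bexI[of _ "y + z"]) (auto simp: characterD)
next
  case (mult f g)
  then obtain y z where yz: "y \<in> D" "z \<in> D"
    "\<forall>\<phi>. character D \<phi> \<longrightarrow> \<phi> y = of_real (f (Re (\<phi> d)) - f 0)"
    "\<forall>\<phi>. character D \<phi> \<longrightarrow> \<phi> z = of_real (g (Re (\<phi> d)) - g 0)" by blast
  show ?case
    using yz(1,2)
    by (intro bexI[of _ "y * z + (of_real (f 0) *\<^sub>C z + of_real (g 0) *\<^sub>C y)"])
      (auto simp: characterD yz(3,4)[rule_format] algebra_simps)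
qed

text \<open>
  The factor \<open>y\<close> plays the part of a unit: it makes room for functions \<open>F\<close> with \<open>F 0 \<noteq> 0\<close>.
  Polynomial approximations of \<open>F\<close> converge in \<open>D\<close> because characters determine the norm.
\<close>

theorem functional_calculus:
  assumes d: "d \<in> D" "adj d = d" and F: "continuous_on UNIV F" and y: "y \<in> D"
  obtains w where "w \<in> D" "\<And>\<phi>. character D \<phi> \<Longrightarrow> \<phi> w = \<phi> y * of_real (F (Re (\<phi> d)))"
proof -
  let ?S = "{- norm d .. norm d}"
  have S: "Re (\<phi> d) \<in> ?S" if "character D \<phi>" for \<phi>
    using abs_Re_le_cmod[of "\<phi> d"] characterD(5)[OF that d(1)] by (auto simp: abs_le_iff)
  have "\<exists>p. real_polynomial_function p \<and> (\<forall>t\<in>?S. \<bar>F t - p t\<bar> < 1 / real (Suc n))" for n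
    by (rule Stone_Weierstrass_real_polynomial_function[of ?S F "1 / real (Suc n)"])
      (use continuous_on_subset[OF F] in auto)
  then obtain p where p: "\<And>n. real_polynomial_function (p n)"
    and pF: "\<And>n t. t \<in> ?S \<Longrightarrow> \<bar>F t - p n t\<bar> < 1 / real (Suc n)" by metis
  have "\<exists>z\<in>D. \<forall>\<phi>. character D \<phi> \<longrightarrow> \<phi> z = of_real (p n (Re (\<phi> d)) - p n 0)" for n
    using polynomial_calculus[OF d p] .
  then obtain z where z: "\<And>n. z n \<in> D"
    and zp: "\<And>n \<phi>. character D \<phi> \<Longrightarrow> \<phi> (z n) = of_real (p n (Re (\<phi> d)) - p n 0)" by metis
  have err: "cmod (\<phi> (z n) - of_real (F (Re (\<phi> d)) - F 0)) \<le> 2 * (1 / real (Suc n))"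
    if \<phi>: "character D \<phi>" for \<phi> n
  proof -
    have "cmod (\<phi> (z n) - of_real (F (Re (\<phi> d)) - F 0)) = \<bar>(p n (Re (\<phi> d)) - p n 0) - (F (Re (\<phi> d)) - F 0)\<bar>"
      unfolding zp[OF \<phi>] of_real_diff[symmetric] by (rule norm_of_real)
    also have "\<dots> \<le> 2 * (1 / real (Suc n))"
      using pF[OF S[OF \<phi>], of n] pF[of 0 n] by auto
    finally show ?thesis .
  qed
  have bound: "norm (z n - z m) \<le> 2 * (1 / real (Suc n)) + 2 * (1 / real (Suc m))" for n m
  proof (rule norm_le_characters)
    fix \<phi> assume \<phi>: "character D \<phi>"
    show "cmod (\<phi> (z n - z m)) \<le> 2 * (1 / real (Suc n)) + 2 * (1 / real (Suc m))"
      using norm_triangle_ineq4[of "\<phi> (z n) - of_real (F (Re (\<phi> d)) - F 0)" "\<phi> (z m) - of_real (F (Re (\<phi> d)) - F 0)"]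
        err[OF \<phi>, of n] err[OF \<phi>, of m] characterD(8)[OF \<phi> z z, of n m] by simp
  qed (use z in simp)
  have "Cauchy z"
    unfolding Cauchy_def
  proof (intro allI impI)
    fix e :: real assume "0 < e"
    then obtain N where N: "1 / real (Suc N) < e / 4"
      using reals_Archimedean[of "e / 4"] by (auto simp: inverse_eq_divide)
    show "\<exists>M. \<forall>m\<ge>M. \<forall>n\<ge>M. dist (z m) (z n) < e"
    proof (intro exI allI impI)
      fix m n assume "N \<le> m" "N \<le> n"
      then have "1 / real (Suc m) \<le> 1 / real (Suc N)" "1 / real (Suc n) \<le> 1 / real (Suc N)"
        by (auto intro!: divide_left_mono)
      then show "dist (z m) (z n) < e"
        using bound[of m n] N by (simp add: dist_norm)
    qed
  qed
  then obtain u where u: "z \<longlonglongrightarrow> u" by (metis Cauchy_convergent_iff convergent_def)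
  have uD: "u \<in> D"
    using closed_sequentially[OF cstar_subalgebra_closed[OF subalgebra] _ u] z by blast
  have \<phi>u: "\<phi> u = of_real (F (Re (\<phi> d)) - F 0)" if \<phi>: "character D \<phi>" for \<phi>
  proof (rule LIMSEQ_unique)
    have "(\<lambda>n. norm (z n - u)) \<longlonglongrightarrow> 0"
      using tendsto_norm[OF LIM_zero[OF u]] by simp
    then have "(\<lambda>n. \<phi> (z n) - \<phi> u) \<longlonglongrightarrow> 0"
      by (rule Lim_null_comparison[rotated])
        (use characterD(5)[OF \<phi>, of "z _ - u"] characterD(8)[OF \<phi> z uD] z uD in auto)
    then show "(\<lambda>n. \<phi> (z n)) \<longlonglongrightarrow> \<phi> u" by (rule LIM_zero_cancel)
    have "(\<lambda>n. 2 * (1 / real (Suc n))) \<longlonglongrightarrow> 0"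
      by (rule tendsto_mult_right_zero[OF LIMSEQ_Suc[OF lim_1_over_n]])
    moreover have "\<forall>n. norm (\<phi> (z n) - of_real (F (Re (\<phi> d)) - F 0)) \<le> 2 * (1 / real (Suc n))"
      using err[OF \<phi>] by blast
    ultimately have "(\<lambda>n. \<phi> (z n) - of_real (F (Re (\<phi> d)) - F 0)) \<longlonglongrightarrow> 0"
      by (rule Lim_null_comparison[OF always_eventually, rotated])
    then show "(\<lambda>n. \<phi> (z n)) \<longlonglongrightarrow> of_real (F (Re (\<phi> d)) - F 0)" by (rule LIM_zero_cancel)
  qed
  show ?thesis
  proof (rule that)
    show "y * u + of_real (F 0) *\<^sub>C y \<in> D" using y uD by simp
    show "\<phi> (y * u + of_real (F 0) *\<^sub>C y) = \<phi> y * of_real (F (Re (\<phi> d)))" if "character D \<phi>" for \<phi>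
      using y uD by (simp add: characterD[OF that] \<phi>u[OF that] algebra_simps)
  qed
qed

text \<open>
  The spectrum is Hausdorff, in algebraic form: two characters with different values at \<open>d\<close> have
  neighbourhoods carrying functions with product zero, namely tent functions of \<open>d\<close>.
\<close>

lemma separate_characters:
  assumes \<phi>: "character D \<phi>" and \<psi>: "character D \<psi>"
    and d: "d \<in> D" "adj d = d" "\<phi> d \<noteq> \<psi> d"
    and y: "y \<in> D" "\<phi> y \<noteq> 0" and z: "z \<in> D" "\<psi> z \<noteq> 0"
  obtains f g where "f \<in> D" "g \<in> D" "f * g = 0" "\<phi> f \<noteq> 0" "\<psi> g \<noteq> 0"
proof -
  define s t where "s = Re (\<phi> d)" and "t = Re (\<psi> d)"
  have "s \<noteq> t"
    using character_self_adjoint[OF \<phi> d(1,2)] character_self_adjoint[OF \<psi> d(1,2)] d(3)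
    by (auto simp: s_def t_def)
  then have r: "0 < \<bar>s - t\<bar> / 2" by simp
  define tent where "tent c x = max 0 (\<bar>s - t\<bar> / 2 - \<bar>x - c\<bar>)" for c x :: real
  have cont: "continuous_on UNIV (tent c)" for c
    unfolding tent_def by (intro continuous_intros)
  obtain f where f: "f \<in> D" "\<And>\<phi>. character D \<phi> \<Longrightarrow> \<phi> f = \<phi> y * of_real (tent s (Re (\<phi> d)))"
    using functional_calculus[OF d(1,2) cont y(1)] by blast
  obtain g where g: "g \<in> D" "\<And>\<phi>. character D \<phi> \<Longrightarrow> \<phi> g = \<phi> z * of_real (tent t (Re (\<phi> d)))"
    using functional_calculus[OF d(1,2) cont z(1)] by blast
  have disjoint: "tent s x = 0 \<or> tent t x = 0" for x
  proof -
    have "\<bar>s - t\<bar> \<le> \<bar>x - s\<bar> + \<bar>x - t\<bar>" by arith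
    then have "\<bar>s - t\<bar> / 2 \<le> \<bar>x - s\<bar> \<or> \<bar>s - t\<bar> / 2 \<le> \<bar>x - t\<bar>"
      by (smt (verit) field_sum_of_halves)
    then show ?thesis by (auto simp: tent_def max_def)
  qed
  have "f * g = 0"
  proof (rule eq_characters)
    fix \<theta> assume \<theta>: "character D \<theta>"
    show "\<theta> (f * g) = \<theta> 0"
      using disjoint[of "Re (\<theta> d)"] f(1) g(1) by (auto simp: characterD[OF \<theta>] f(2)[OF \<theta>] g(2)[OF \<theta>])
  qed (use f g in auto)
  moreover have "\<phi> f \<noteq> 0" "\<psi> g \<noteq> 0"
    using f(2)[OF \<phi>] g(2)[OF \<psi>] y z r by (auto simp: tent_def s_def t_def)
  ultimately show ?thesis using that f g by blast
qed

end

section \<open>Annihilators\<close>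

lemma lattice_isomorphicI:
  assumes "\<And>I. I \<in> L \<Longrightarrow> f I \<in> M"
    and mono: "\<And>I J. I \<in> L \<Longrightarrow> J \<in> L \<Longrightarrow> I \<subseteq> J \<longleftrightarrow> f I \<subseteq> f J"
    and "\<And>K. K \<in> M \<Longrightarrow> \<exists>I\<in>L. f I = K"
  shows "lattice_isomorphic L M"
proof -
  have "inj_on f L" using mono by (fastforce intro!: inj_onI)
  moreover have "f ` L = M" using assms(1,3) by blast
  ultimately show ?thesis
    unfolding lattice_isomorphic_def using mono by (intro exI[of _ f]) (auto simp: bij_betw_def)
qed

lemma lattice_isomorphic_sym:
  assumes "lattice_isomorphic L M"
  shows "lattice_isomorphic M L"
proof -
  obtain f where f: "bij_betw f L M" and mono: "\<And>I J. I \<in> L \<Longrightarrow> J \<in> L \<Longrightarrow> I \<subseteq> J \<longleftrightarrow> f I \<subseteq> f J"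
    using assms by (auto simp: lattice_isomorphic_def)
  let ?g = "inv_into L f"
  show ?thesis
    unfolding lattice_isomorphic_def
  proof (intro exI[of _ ?g] conjI ballI)
    show "bij_betw ?g M L" using f by (rule bij_betw_inv_into)
    fix I J assume "I \<in> M" "J \<in> M"
    then have "?g I \<in> L" "?g J \<in> L" "f (?g I) = I" "f (?g J) = J"
      using f by (auto simp: bij_betw_def inv_into_into f_inv_into_f)
    then show "I \<subseteq> J \<longleftrightarrow> ?g I \<subseteq> ?g J" using mono by metis
  qed
qed

lemma cstar_idealD:
  assumes "cstar_ideal A J"
  shows "J \<subseteq> A" "closed J" "csubspace J" "0 \<in> J" "\<And>a x. a \<in> A \<Longrightarrow> x \<in> J \<Longrightarrow> a * x \<in> J"
    "\<And>a x. a \<in> A \<Longrightarrow> x \<in> J \<Longrightarrow> x * a \<in> J"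
    "\<And>x y. x \<in> J \<Longrightarrow> y \<in> J \<Longrightarrow> x + y \<in> J" "\<And>x y. x \<in> J \<Longrightarrow> y \<in> J \<Longrightarrow> x - y \<in> J"
  using assms unfolding cstar_ideal_def
  by (auto intro: complex_vector.subspace_0 complex_vector.subspace_add complex_vector.subspace_diff)

lemma cstar_ideal_Int:
  assumes "cstar_ideal A I" "cstar_ideal A J"
  shows "cstar_ideal A (I \<inter> J)"
  using assms by (auto simp: cstar_ideal_def intro: complex_vector.subspace_inter)

lemma cstar_ideal_Int_subalgebra:
  assumes "cstar_ideal A J" "cstar_subalgebra B" "B \<subseteq> A"
  shows "cstar_ideal B (J \<inter> B)"
  using assms
  by (auto simp: cstar_ideal_def cstar_subalgebra_def intro: complex_vector.subspace_inter)

lemma annihilator_closed_subspace: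
  assumes A: "cstar_subalgebra A"
  shows "closed (annihilator A X)" "csubspace (annihilator A X)"
proof -
  have "annihilator A X = A \<inter> (\<Inter>x\<in>X. {a. a * x = 0} \<inter> {a. x * a = 0})"
    by (auto simp: annihilator_def)
  moreover have "closed {a. a * x = 0}" "closed {a. x * a = 0}" for x :: 'a
    by (auto intro!: closed_Collect_eq continuous_intros)
  ultimately show "closed (annihilator A X)"
    using cstar_subalgebra_closed[OF A] by (auto intro!: closed_Int closed_INT)
  show "csubspace (annihilator A X)"
    using cstar_subalgebra_mem[OF A]
    by (auto simp: complex_vector.subspace_def annihilator_def distrib_left distrib_right
        mult_scaleC_left mult_scaleC_right)
qed

lemma annihilator_ideal:
  assumes A: "cstar_subalgebra A" and J: "\<And>a x. a \<in> A \<Longrightarrow> x \<in> J \<Longrightarrow> a * x \<in> J \<and> x * a \<in> J"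
  shows "cstar_ideal A (annihilator A J)"
  unfolding cstar_ideal_def
proof (intro conjI ballI annihilator_closed_subspace[OF A])
  fix a x assume a: "a \<in> A" and x: "x \<in> annihilator A J"
  have "a * x * y = 0" "x * a * y = 0" "y * (a * x) = 0" "y * (x * a) = 0" if y: "y \<in> J" for y
    using J[OF a y] x y by (simp_all add: annihilator_def mult.assoc) (metis mult.assoc mult_zero_left)+
  then show "a * x \<in> annihilator A J" "x * a \<in> annihilator A J"
    using a x cstar_subalgebra_mem(5)[OF A] by (auto simp: annihilator_def)
qed (auto simp: annihilator_def)

lemma annihilator3:
  assumes "X \<subseteq> A"
  shows "annihilator A (annihilator A (annihilator A X)) = annihilator A X"
  using annihilator_antimono[OF subset_annihilator2[OF assms]]
    subset_annihilator2[of "annihilator A X" A] by (auto simp: annihilator_def)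

section \<open>Normalizers\<close>

lemma normalizers_adj: "n \<in> normalizers A B \<Longrightarrow> cstar_subalgebra A \<Longrightarrow> adj n \<in> normalizers A B"
  by (auto simp: normalizers_def cstar_subalgebra_mem)

lemma normalizers_mult:
  assumes "cstar_subalgebra A" "m \<in> normalizers A B" "n \<in> normalizers A B"
  shows "m * n \<in> normalizers A B"
proof -
  have "m * n * b * adj (m * n) = m * (n * b * adj n) * adj m"
    "adj (m * n) * b * (m * n) = adj n * (adj m * b * m) * n" for b
    by (simp_all add: mult.assoc)
  then show ?thesis
    using assms by (auto simp: normalizers_def cstar_subalgebra_mem simp del: adj_mult)
qed

lemma subalgebra_subset_normalizers:
  assumes "cstar_subalgebra B" "B \<subseteq> A"
  shows "B \<subseteq> normalizers A B"
  using assms by (auto simp: normalizers_def cstar_subalgebra_mem)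

lemma closure_cspan_induct:
  assumes "x \<in> closure (cspan S)" "csubspace T" "closed T" "S \<subseteq> T"
  shows "x \<in> T"
  using closure_minimal[OF complex_vector.span_minimal[OF assms(4,2)] assms(3)] assms(1) by blast

lemma csubspace_kernel_mult: "csubspace {x :: 'a::cstar_algebra. a * x * b = 0}"
  by (auto simp: complex_vector.subspace_def distrib_left distrib_right
      mult_scaleC_left mult_scaleC_right)

lemma closed_kernel_mult: "closed {x :: 'a::cstar_algebra. a * x * b = 0}"
  by (auto intro!: closed_Collect_eq continuous_intros)

locale regular_abelian_inclusion =
  fixes A D :: "'a::cstar_algebra set"
  assumes regular: "regular_inclusion A D" and abelian: "abelian D"
begin

lemma A: "cstar_subalgebra A" and D: "cstar_subalgebra D" and DA: "D \<subseteq> A"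
  and approximate_unit: "contains_approximate_unit A D"
  and dense: "closure (cspan (normalizers A D)) = A"
  using regular by (auto simp: regular_inclusion_def cstar_inclusion_def)

sublocale commutative_cstar D
  by unfold_locales (fact D abelian)+

lemma normalizerD:
  assumes "n \<in> normalizers A D"
  shows "n \<in> A" "b \<in> D \<Longrightarrow> n * b * adj n \<in> D" "b \<in> D \<Longrightarrow> adj n * b * n \<in> D"
    "adj n \<in> normalizers A D"
  using assms normalizers_adj[OF assms A] by (auto simp: normalizers_def)

text \<open>
  This is where the approximate unit enters: \<open>n n\<^sup>*\<close> is the limit of the elements \<open>n u n\<^sup>*\<close> of \<open>D\<close>.
\<close>

lemma normalizer_mult_adj: "n * adj n \<in> D" if n: "n \<in> normalizers A D"
proof -
  obtain F :: "'a filter" where F: "F \<noteq> bot"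
      "\<forall>\<^sub>F u in F. u \<in> D \<and> cstar_positive D u \<and> norm u \<le> 1"
      "\<forall>a\<in>A. ((\<lambda>u. u * a) \<longlongrightarrow> a) F \<and> ((\<lambda>u. a * u) \<longlongrightarrow> a) F"
    using approximate_unit unfolding contains_approximate_unit_def by blast
  then have "((\<lambda>u. u * adj n) \<longlongrightarrow> adj n) F"
    using normalizerD[OF n] A cstar_subalgebra_mem(7) by blast
  then have lim: "((\<lambda>u. n * u * adj n) \<longlongrightarrow> n * adj n) F"
    unfolding mult.assoc by (rule tendsto_mult_left)
  have "\<forall>\<^sub>F u in F. n * u * adj n \<in> D"
    using F(2) by eventually_elim (use normalizerD[OF n] in auto)
  then show ?thesis
    using Lim_in_closed_set[OF cstar_subalgebra_closed[OF D] _ F(1) lim] by blast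
qed

lemma normalizer_adj_mult: "adj n * n \<in> D" if "n \<in> normalizers A D"
  using normalizer_mult_adj[OF normalizerD(4)[OF that]] by simp

lemma annihilator_eq: "annihilator D X = {d \<in> D. \<forall>x\<in>X. d * x = 0}" if "X \<subseteq> D"
  using that comm by (auto simp: annihilator_def subset_iff)

text \<open>
  For \<open>k\<close> in \<open>K\<close> the square of \<open>q s\<^sup>* k\<close> contains the factor \<open>q (s\<^sup>* k k\<^sup>* s)\<close>, which vanishes.  The set
  \<open>S\<close> is kept general because the image under \<open>\<alpha>\<close> of the normalizers of \<open>D\<close> will take its place.
\<close>

lemma annihilator_invariant:
  assumes S: "S \<subseteq> normalizers A D" "\<And>s. s \<in> S \<Longrightarrow> adj s \<in> S"
    and K: "K \<subseteq> D" "\<And>s k. s \<in> S \<Longrightarrow> k \<in> K \<Longrightarrow> s * k * adj s \<in> K"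
      "\<And>k. k \<in> K \<Longrightarrow> k * adj k \<in> K"
    and s: "s \<in> S" and q: "q \<in> annihilator D K"
  shows "s * q * adj s \<in> annihilator D K"
proof -
  have sN: "s \<in> normalizers A D" and qD: "q \<in> D" using S s q by (auto simp: annihilator_def)
  have "s * q * adj s * k = 0" if k: "k \<in> K" for k
  proof -
    have "adj s * (k * adj k) * adj (adj s) \<in> K" using K(2,3) S(2) s k by blast
    then have "q * (adj s * (k * adj k) * s) = 0" using q by (simp add: annihilator_def)
    then have "(q * (adj s * k)) * adj (q * (adj s * k)) = 0"
      by (simp add: mult.assoc[symmetric])
    then have "q * (adj s * k) = 0" by (simp only: mult_adj_self_eq_0)
    then show ?thesis by (simp add: mult.assoc)
  qed
  then show ?thesis
    using normalizerD(2)[OF sN qD] K(1) by (simp add: annihilator_eq)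
qed

lemma annihilator_invariant_ideal:
  assumes K: "invariant_ideal A D K"
  shows "invariant_ideal A D (annihilator D K)"
  unfolding invariant_ideal_def
proof (intro conjI ballI)
  have ideal: "cstar_ideal D K" using K by (simp add: invariant_ideal_def)
  show "cstar_ideal D (annihilator D K)"
    using D cstar_idealD[OF ideal] by (intro annihilator_ideal) auto
  show "n * q * adj n \<in> annihilator D K" if "n \<in> normalizers A D" "q \<in> annihilator D K" for n q
  proof (rule annihilator_invariant[OF order_refl normalizerD(4) _ _ _ that])
    show "K \<subseteq> D" using cstar_idealD[OF ideal] by simp
    show "s * k * adj s \<in> K" if "s \<in> normalizers A D" "k \<in> K" for s k
      using K that by (simp add: invariant_ideal_def)
    show "k * adj k \<in> K" if "k \<in> K" for k
      using that cstar_idealD[OF ideal] by auto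
  qed
qed

text \<open>
  If \<open>a\<close> annihilates \<open>K\<close>, then so does \<open>n a\<close> for a normalizer \<open>n\<close>, since the square of \<open>k n a\<close>
  contains \<open>n\<^sup>* k\<^sup>* k n\<close>, an element of \<open>K\<close>.  Density of the span of the normalizers does the rest.
\<close>

lemma annihilator_of_invariant_is_ideal:
  assumes K: "invariant_ideal A D K"
  shows "cstar_ideal A (annihilator A K)"
proof -
  have ideal: "cstar_ideal D K"
    and inv: "\<And>n k. n \<in> normalizers A D \<Longrightarrow> k \<in> K \<Longrightarrow> n * k * adj n \<in> K"
    using K by (auto simp: invariant_ideal_def)
  note iD = cstar_idealD[OF ideal]
  have left: "k * b * a = 0" if a: "a \<in> annihilator A K" and b: "b \<in> A" and k: "k \<in> K" for a b k
  proof -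
    have "normalizers A D \<subseteq> {b. k * b * a = 0}"
    proof (intro subsetI CollectI)
      fix n assume n: "n \<in> normalizers A D"
      have "adj n * (adj k * k) * n \<in> K"
        using inv[OF normalizerD(4)[OF n], of "adj k * k"] iD(1,5) k by auto
      then have "adj n * (adj k * k) * n * a = 0" using a by (simp add: annihilator_def)
      then have "adj (k * n * a) * (k * n * a) = 0" by (simp add: mult.assoc)
      then show "k * n * a = 0" by (simp only: adj_mult_self_eq_0)
    qed
    then show ?thesis
      using closure_cspan_induct[OF _ csubspace_kernel_mult closed_kernel_mult] b dense by blast
  qed
  have right: "a * b * k = 0" if a: "a \<in> annihilator A K" and b: "b \<in> A" and k: "k \<in> K" for a b k
  proof -
    have "normalizers A D \<subseteq> {b. a * b * k = 0}"
    proof (intro subsetI CollectI)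
      fix n assume n: "n \<in> normalizers A D"
      have "n * (k * adj k) * adj n \<in> K"
        using inv[OF n, of "k * adj k"] iD(1,6) k by auto
      then have "a * (n * (k * adj k) * adj n) = 0" using a by (simp add: annihilator_def)
      then have "a * (n * (k * adj k) * adj n) * adj a = 0" by simp
      then have "(a * n * k) * adj (a * n * k) = 0" by (simp add: mult.assoc)
      then show "a * n * k = 0" by (simp only: mult_adj_self_eq_0)
    qed
    then show ?thesis
      using closure_cspan_induct[OF _ csubspace_kernel_mult closed_kernel_mult] b dense by blast
  qed
  have mem: "a * b \<in> annihilator A K" "b * a \<in> annihilator A K"
    if a: "a \<in> annihilator A K" and b: "b \<in> A" for a b
  proof -
    have "k * (a * b) = 0" "b * a * k = 0" if "k \<in> K" for k
      using a that by (simp_all add: annihilator_def mult.assoc) (simp add: mult.assoc[symmetric])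
    then show "a * b \<in> annihilator A K" "b * a \<in> annihilator A K"
      using a b left[OF a b] right[OF a b] cstar_subalgebra_mem(5)[OF A]
      by (auto simp: annihilator_def mult.assoc)
  qed
  show ?thesis
    unfolding cstar_ideal_def
    by (intro conjI ballI annihilator_closed_subspace[OF A] mem) (auto simp: annihilator_def)
qed

end

section \<open>Regular ideals of an inclusion with the ideal intersection property\<close>

lemma invariant_double_annihilator_Int:
  fixes A D :: "'a::cstar_algebra set"
  assumes "K \<in> Reg D" "K \<subseteq> D" "D \<subseteq> A"
  shows "annihilator A (annihilator A K) \<inter> D = K"
proof
  show "K \<subseteq> annihilator A (annihilator A K) \<inter> D"
    using subset_annihilator2[of K A] assms by auto
  have "annihilator A (annihilator A K) \<inter> D \<subseteq> annihilator D (annihilator D K)"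
    using assms by (auto simp: annihilator_def subset_iff)
  then show "annihilator A (annihilator A K) \<inter> D \<subseteq> K"
    using assms by (auto simp: Reg_def)
qed

text \<open>
  The isomorphism is \<open>J \<mapsto> J \<inter> D\<close>.  To see that \<open>J \<inter> D\<close> is regular in \<open>D\<close>, let \<open>K\<close> be its double
  annihilator in \<open>D\<close> and \<open>M\<close> the double annihilator of \<open>K\<close> in \<open>A\<close>.  An element \<open>x\<close> of
  \<open>M \<inter> J\<^sup>\<bottom> \<inter> D\<close> annihilates \<open>J \<inter> D\<close>, hence \<open>K\<close>, hence itself.  So \<open>M \<inter> J\<^sup>\<bottom> = 0\<close>, and \<open>K\<close>
  annihilates \<open>J\<^sup>\<bottom>\<close>.
\<close>

theorem (in regular_abelian_inclusion) Reg_isomorphic_RegInv: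
  assumes iip: "ideal_intersection_property A D"
  shows "lattice_isomorphic (Reg A) (RegInv A D)"
proof (rule lattice_isomorphicI[where f = "\<lambda>J. J \<inter> D"])
  have trivial: "J \<subseteq> {0}" if J: "cstar_ideal A J" and 0: "\<And>x. x \<in> J \<Longrightarrow> x \<in> D \<Longrightarrow> x = 0" for J
  proof -
    have "J \<inter> D = {0}" using 0 cstar_idealD(4)[OF J] by auto
    then show ?thesis using iip J by (auto simp: ideal_intersection_property_def)
  qed
  have ann: "cstar_ideal A (annihilator A J)" if "cstar_ideal A J" for J
    using cstar_idealD[OF that] by (intro annihilator_ideal[OF A]) auto
  show "J \<inter> D \<in> RegInv A D" if J: "J \<in> Reg A" for J
  proof -
    have ideal: "cstar_ideal A J" and reg: "annihilator A (annihilator A J) = J"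
      using J by (auto simp: Reg_def)
    define I where "I = annihilator A J"
    have I: "cstar_ideal A I" unfolding I_def using ann[OF ideal] .
    have JD: "cstar_ideal D (J \<inter> D)"
      using cstar_ideal_Int_subalgebra[OF ideal D DA] .
    have inv: "invariant_ideal A D (J \<inter> D)"
      unfolding invariant_ideal_def
    proof (intro conjI ballI JD)
      fix n k assume n: "n \<in> normalizers A D" and k: "k \<in> J \<inter> D"
      have "n * k * adj n \<in> J"
        using k normalizerD(1)[OF n] normalizerD(1)[OF normalizerD(4)[OF n]] cstar_idealD(5,6)[OF ideal]
        by auto
      then show "n * k * adj n \<in> J \<inter> D" using k normalizerD(2)[OF n] by simp
    qed
    define K where "K = annihilator D (annihilator D (J \<inter> D))"
    have K: "invariant_ideal A D K"
      unfolding K_def by (intro annihilator_invariant_ideal inv)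
    define M where "M = annihilator A (annihilator A K)"
    have M: "cstar_ideal A M"
      unfolding M_def by (intro ann annihilator_of_invariant_is_ideal K)
    have KM: "K \<subseteq> M"
      unfolding M_def using DA by (intro subset_annihilator2) (auto simp: K_def annihilator_def)
    have MI: "M \<inter> I \<subseteq> {0}"
    proof (rule trivial[OF cstar_ideal_Int[OF M I]])
      fix x assume x: "x \<in> M \<inter> I" and xD: "x \<in> D"
      have "x \<in> annihilator D (J \<inter> D)" using x xD by (auto simp: I_def annihilator_def)
      then have "x \<in> annihilator A K" using x DA xD by (auto simp: K_def annihilator_def)
      then have "x * x = 0" using x by (auto simp: M_def annihilator_def)
      then show "x = 0" using xD square_eq_0 by blast
    qed
    have "K \<subseteq> J"
    proof
      fix d assume d: "d \<in> K"
      then have dA: "d \<in> A" using DA by (auto simp: K_def annihilator_def)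
      have dM: "d \<in> M" using d KM by auto
      have "d * i \<in> M \<inter> I" "i * d \<in> M \<inter> I" if i: "i \<in> I" for i
        using i dA dM cstar_idealD(1)[OF I] cstar_idealD(5,6)[OF M] cstar_idealD(5,6)[OF I] by auto
      then have "d \<in> annihilator A I" using MI dA by (auto simp: annihilator_def)
      then show "d \<in> J" using reg by (simp add: I_def)
    qed
    then have "K = J \<inter> D"
      using subset_annihilator2[of "J \<inter> D" D] by (auto simp: K_def annihilator_def)
    then show ?thesis
      using inv JD by (auto simp: RegInv_def Reg_def K_def)
  qed
  show "I \<subseteq> J \<longleftrightarrow> I \<inter> D \<subseteq> J \<inter> D" if I: "I \<in> Reg A" and J: "J \<in> Reg A" for I J
  proof
    have ideals: "cstar_ideal A I" "cstar_ideal A J" and reg: "annihilator A (annihilator A J) = J"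
      using I J by (auto simp: Reg_def)
    assume sub: "I \<inter> D \<subseteq> J \<inter> D"
    have zero: "I \<inter> annihilator A J \<subseteq> {0}"
    proof (rule trivial[OF cstar_ideal_Int[OF ideals(1) ann[OF ideals(2)]]])
      fix x assume x: "x \<in> I \<inter> annihilator A J" "x \<in> D"
      then have "x * x = 0" using sub by (auto simp: annihilator_def)
      then show "x = 0" using x square_eq_0 by blast
    qed
    have "I \<subseteq> annihilator A (annihilator A J)"
    proof
      fix x assume x: "x \<in> I"
      have xy: "x * y \<in> I \<inter> annihilator A J" "y * x \<in> I \<inter> annihilator A J" if y: "y \<in> annihilator A J" for y
        using x y cstar_idealD(1)[OF ideals(1)] cstar_idealD(1)[OF ann[OF ideals(2)]]
          cstar_idealD(5,6)[OF ideals(1)] cstar_idealD(5,6)[OF ann[OF ideals(2)]] by auto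
      have "x * y = 0 \<and> y * x = 0" if "y \<in> annihilator A J" for y
        using subsetD[OF zero xy(1)[OF that]] subsetD[OF zero xy(2)[OF that]] by simp
      then show "x \<in> annihilator A (annihilator A J)"
        using x cstar_idealD(1)[OF ideals(1)] by (auto simp: annihilator_def[of A "annihilator A J"])
    qed
    then show "I \<subseteq> J" using reg by simp
  qed auto
  show "\<exists>J\<in>Reg A. J \<inter> D = K" if K: "K \<in> RegInv A D" for K
  proof
    have inv: "invariant_ideal A D K" and reg: "K \<in> Reg D" using K by (auto simp: RegInv_def)
    have KD: "K \<subseteq> D" using reg by (auto simp: Reg_def cstar_ideal_def)
    then have KA: "K \<subseteq> A" using DA by simp
    show "annihilator A (annihilator A K) \<inter> D = K"
      using reg KD DA by (rule invariant_double_annihilator_Int)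
    show "annihilator A (annihilator A K) \<in> Reg A"
      using annihilator3[OF KA] ann[OF annihilator_of_invariant_is_ideal[OF inv]]
      by (auto simp: Reg_def)
  qed
qed

lemma pseudo_cartan_ideal_intersection:
  assumes "pseudo_cartan_inclusion A D"
  shows "ideal_intersection_property A D"
proof -
  let ?C = "relative_commutant A D"
  have *: "regular_inclusion A D" "abelian D" "ideal_intersection_property ?C D"
    "ideal_intersection_property A ?C"
    using assms by (auto simp: pseudo_cartan_inclusion_def)
  interpret regular_abelian_inclusion A D using * by unfold_locales
  have C: "?C \<subseteq> A" "D \<subseteq> ?C" using DA comm by (auto simp: relative_commutant_def)
  show ?thesis
    unfolding ideal_intersection_property_def
  proof (intro allI impI, elim conjE)
    fix J assume J: "cstar_ideal A J" "J \<noteq> {0}"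
    have "closed {a. a * d = d * a}" for d :: 'a
      by (intro closed_Collect_eq continuous_intros)
    moreover have "?C = A \<inter> (\<Inter>d\<in>D. {a. a * d = d * a})" by (auto simp: relative_commutant_def)
    ultimately have closed: "closed ?C"
      using cstar_subalgebra_closed[OF A] by (auto intro!: closed_Int closed_INT)
    have "csubspace ?C"
      using cstar_subalgebra_mem[OF A]
      by (auto simp: relative_commutant_def complex_vector.subspace_def distrib_left distrib_right
          mult_scaleC_left mult_scaleC_right)
    then have "cstar_ideal ?C (J \<inter> ?C)"
      using J(1) closed C(1) cstar_subalgebra_mem(5)[OF A]
      by (auto simp: cstar_ideal_def relative_commutant_def subset_iff mult.assoc
          intro: complex_vector.subspace_inter) (metis mult.assoc)+
    moreover have "J \<inter> ?C \<noteq> {0}" using *(4) J by (auto simp: ideal_intersection_property_def)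
    ultimately have "J \<inter> ?C \<inter> D \<noteq> {0}" using *(3) by (simp add: ideal_intersection_property_def)
    moreover have "J \<inter> ?C \<inter> D = J \<inter> D" using C(2) by auto
    ultimately show "J \<inter> D \<noteq> {0}" by simp
  qed
qed

section \<open>Commutants and maximal abelian subalgebras\<close>

definition commutant :: "'a::cstar_algebra set \<Rightarrow> 'a set" where
  "commutant X = {a. \<forall>x\<in>X. a * x = x * a}"

lemma commutant_subalgebra:
  assumes X: "\<And>x. x \<in> X \<Longrightarrow> adj x \<in> X"
  shows "cstar_subalgebra (commutant X)"
  unfolding cstar_subalgebra_def
proof (intro conjI ballI)
  show "csubspace (commutant X)"
    by (auto simp: commutant_def complex_vector.subspace_def distrib_left distrib_right
        mult_scaleC_left mult_scaleC_right)
  have "commutant X = (\<Inter>x\<in>X. {a. a * x = x * a})" by (auto simp: commutant_def)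
  then show "closed (commutant X)"
    by (auto intro!: closed_INT closed_Collect_eq continuous_intros)
  fix a assume a: "a \<in> commutant X"
  have "adj a * x = x * adj a" if "x \<in> X" for x
  proof -
    have "a * adj x = adj x * a" using a X that by (auto simp: commutant_def)
    from arg_cong[OF this, of adj] show ?thesis by simp
  qed
  then show "adj a \<in> commutant X" by (simp add: commutant_def)
  fix b assume "b \<in> commutant X"
  then show "a * b \<in> commutant X"
    using a unfolding commutant_def by (simp add: mult.assoc) (simp add: mult.assoc[symmetric])
qed

text \<open>
  The double commutant of a commuting self-adjoint set is commutative.
\<close>

lemma commuting_set_in_commutative_subalgebra:
  assumes A: "cstar_subalgebra A" and X: "X \<subseteq> A" "\<And>x. x \<in> X \<Longrightarrow> adj x \<in> X"
    and comm: "\<And>x y. x \<in> X \<Longrightarrow> y \<in> X \<Longrightarrow> x * y = y * x"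
  obtains C where "commutative_cstar C" "X \<subseteq> C" "C \<subseteq> A"
proof
  let ?C = "A \<inter> commutant (commutant X)"
  have sub: "cstar_subalgebra (commutant X)" using X(2) by (rule commutant_subalgebra)
  have sub2: "cstar_subalgebra (commutant (commutant X))"
    by (rule commutant_subalgebra) (rule cstar_subalgebra_mem(7)[OF sub])
  show "commutative_cstar ?C"
  proof
    show "cstar_subalgebra ?C"
      using A sub2 by (auto simp: cstar_subalgebra_def intro: complex_vector.subspace_inter)
    have "X \<subseteq> commutant X" using comm by (auto simp: commutant_def)
    then have sub': "commutant (commutant X) \<subseteq> commutant X" by (auto simp: commutant_def)
    show "abelian ?C"
      unfolding abelian_def
    proof (intro ballI)
      fix x y assume "x \<in> ?C" "y \<in> ?C"
      then have "x \<in> commutant (commutant X)" "y \<in> commutant X" using sub' by auto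
      then show "x * y = y * x" by (simp add: commutant_def[of "commutant X"])
    qed
  qed
  show "X \<subseteq> ?C" using X(1) by (auto simp: commutant_def)
qed simp

lemma self_adjoint_decomposition:
  "x = (1 / 2) *\<^sub>C ((x + adj x) + (- \<i>) *\<^sub>C (\<i> *\<^sub>C (x - adj x)))"
  by (simp add: scaleC_scaleC complex_vector.scale_right_diff_distrib scaleC_add_right
      scaleC_add_left[symmetric])

lemma self_adjoint_parts: "adj (x + adj x) = x + adj x" "adj (\<i> *\<^sub>C (x - adj x)) = \<i> *\<^sub>C (x - adj x)"
  by (simp_all add: add.commute complex_vector.scale_right_diff_distrib)

text \<open>
  A self-adjoint element of the commutant generates together with \<open>D\<close> a commutative algebra, which
  must be \<open>D\<close>.  Real and imaginary parts reduce the general case to this one.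
\<close>

lemma maximal_abelian_commutant:
  assumes A: "cstar_subalgebra A" and D: "maximal_abelian A D"
  shows "relative_commutant A D \<subseteq> D"
proof
  have sub: "cstar_subalgebra D" "D \<subseteq> A" and ab: "abelian D"
    and max: "\<And>C. cstar_subalgebra C \<Longrightarrow> C \<subseteq> A \<Longrightarrow> abelian C \<Longrightarrow> D \<subseteq> C \<Longrightarrow> C = D"
    using D by (auto simp: maximal_abelian_def)
  have sa: "h \<in> D" if h: "h \<in> A" "adj h = h" "\<And>d. d \<in> D \<Longrightarrow> h * d = d * h" for h
  proof -
    obtain C where C: "commutative_cstar C" "insert h D \<subseteq> C" "C \<subseteq> A"
    proof (rule commuting_set_in_commutative_subalgebra[OF A])
      show "insert h D \<subseteq> A" using h sub by auto
      show "adj x \<in> insert h D" if "x \<in> insert h D" for x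
        using that h(2) cstar_subalgebra_mem(7)[OF sub(1)] by auto
      show "x * y = y * x" if "x \<in> insert h D" "y \<in> insert h D" for x y
        using that h(3) ab by (auto simp: abelian_def)
    qed
    then show ?thesis using max[of C] by (auto simp: commutative_cstar_def)
  qed
  fix a assume "a \<in> relative_commutant A D"
  then have a: "a \<in> A" "\<And>d. d \<in> D \<Longrightarrow> a * d = d * a" by (auto simp: relative_commutant_def)
  have ad: "adj a * d = d * adj a" if "d \<in> D" for d
    using arg_cong[OF a(2)[OF cstar_subalgebra_mem(7)[OF sub(1) that]], of adj] by simp
  have "a + adj a \<in> D"
  proof (rule sa)
    show "a + adj a \<in> A"
      using a(1) by (simp add: cstar_subalgebra_mem[OF A])
    show "(a + adj a) * d = d * (a + adj a)" if "d \<in> D" for d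
      using a(2)[OF that] ad[OF that] by (simp only: distrib_left distrib_right)
  qed (rule self_adjoint_parts)
  moreover have "\<i> *\<^sub>C (a - adj a) \<in> D"
  proof (rule sa)
    show "\<i> *\<^sub>C (a - adj a) \<in> A"
      using a(1) by (simp add: cstar_subalgebra_mem[OF A])
    show "\<i> *\<^sub>C (a - adj a) * d = d * \<i> *\<^sub>C (a - adj a)" if "d \<in> D" for d
      using a(2)[OF that] ad[OF that]
      by (simp only: mult_scaleC_left mult_scaleC_right left_diff_distrib right_diff_distrib)
  qed (rule self_adjoint_parts)
  ultimately have "(1 / 2) *\<^sub>C ((a + adj a) + (- \<i>) *\<^sub>C (\<i> *\<^sub>C (a - adj a))) \<in> D"
    by (rule cstar_subalgebra_mem(6)[OF sub(1) cstar_subalgebra_mem(2)[OF sub(1) _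
            cstar_subalgebra_mem(6)[OF sub(1)]]])
  then show "a \<in> D" by (simp only: self_adjoint_decomposition[symmetric])
qed

section \<open>Quasi-inverses\<close>

text \<open>
  The solution \<open>y\<close> plays the part of \<open>(1 - z)\<^sup>-\<^sup>1 - 1\<close>, without a unit.
\<close>

lemma quasi_inverse:
  fixes z :: "'a::cstar_algebra"
  assumes z: "norm z < 1" and T: "closed T" "z \<in> T" "\<And>y. y \<in> T \<Longrightarrow> z + z * y \<in> T"
  obtains y where "y \<in> T" "z + z * y = y"
proof -
  have "\<exists>!y\<in>T. z + z * y = y"
  proof (rule Banach_fix)
    show "complete T" using T(1) by (simp add: complete_eq_closed)
    show "dist (z + z * x) (z + z * y) \<le> norm z * dist x y" for x y
      using norm_mult_ineq[of z] by (simp add: dist_norm right_diff_distrib[symmetric])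
  qed (use z T in auto)
  then show ?thesis using that by blast
qed

text \<open>
  In the quotient by \<open>J\<close> the relation reads \<open>f = v f\<close>, which is impossible for non-zero \<open>f\<close>.  The
  iteration \<open>x \<mapsto> (f - v f) + v x\<close> avoids the quotient: it stays in \<open>J\<close> and converges to \<open>f\<close>.
\<close>

lemma ideal_absorb:
  assumes J: "cstar_ideal A J" and A: "cstar_subalgebra A" and f: "f \<in> A" "v \<in> A" "norm v < 1"
    and fv: "f - v * f \<in> J"
  shows "f \<in> J"
proof -
  define j where "j k = rec_nat 0 (\<lambda>_ x. (f - v * f) + v * x) k" for k :: nat
  have j0: "j 0 = 0" and jS: "j (Suc k) = (f - v * f) + v * j k" for k
    by (simp_all add: j_def)
  have jJ: "j k \<in> J" for k
    by (induction k) (use j0 jS fv f cstar_idealD[OF J] in auto)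
  have bound: "norm (j k - f) \<le> norm v ^ k * norm f" for k
  proof (induction k)
    case (Suc k)
    have "j (Suc k) - f = v * (j k - f)" by (simp add: jS algebra_simps)
    also have "norm \<dots> \<le> norm v * norm (j k - f)" by (rule norm_mult_ineq)
    also have "\<dots> \<le> norm v * (norm v ^ k * norm f)" using Suc by (intro mult_left_mono) auto
    finally show ?case by (simp add: mult.assoc)
  qed (simp add: j0)
  have lim: "(\<lambda>k. norm v ^ k * norm f) \<longlonglongrightarrow> 0"
    by (rule tendsto_mult_left_zero[OF LIMSEQ_power_zero]) (use f in simp)
  have "(\<lambda>k. j k - f) \<longlonglongrightarrow> 0"
    by (rule Lim_null_comparison[OF always_eventually lim]) (simp add: bound)
  then have "j \<longlonglongrightarrow> f" by (rule LIM_zero_cancel)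
  then show ?thesis using closed_sequentially[OF cstar_idealD(2)[OF J]] jJ by blast
qed

context commutative_cstar
begin

text \<open>
  If \<open>\<psi> b\<close> exceeds \<open>norm b\<close> in modulus, scale \<open>b\<close> to \<open>z\<close> with \<open>\<psi> z = 1\<close> and norm below 1; applying \<open>\<psi>\<close> to
  \<open>y = z + z y\<close> then gives \<open>0 = 1\<close>.
\<close>

lemma multiplicative_functional_contractive:
  assumes add: "\<And>x y. x \<in> D \<Longrightarrow> y \<in> D \<Longrightarrow> \<psi> (x + y) = \<psi> x + \<psi> y"
    and scale: "\<And>c x. x \<in> D \<Longrightarrow> \<psi> (c *\<^sub>C x) = c * \<psi> x"
    and mult: "\<And>x y. x \<in> D \<Longrightarrow> y \<in> D \<Longrightarrow> \<psi> (x * y) = \<psi> x * \<psi> y"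
    and b: "b \<in> D"
  shows "cmod (\<psi> b) \<le> norm b"
proof (rule ccontr)
  assume "\<not> cmod (\<psi> b) \<le> norm b"
  then have less: "norm b < cmod (\<psi> b)" by simp
  then have nz: "\<psi> b \<noteq> 0" using norm_ge_zero[of b] by auto
  define z where "z = (1 / \<psi> b) *\<^sub>C b"
  have z: "z \<in> D" "\<psi> z = 1" "norm z < 1"
    using b nz less by (simp_all add: z_def scale norm_scaleC norm_divide)
  obtain y where y: "y \<in> D" "z + z * y = y"
    by (rule quasi_inverse[OF z(3) cstar_subalgebra_closed[OF subalgebra] z(1)]) (use z in auto)
  have "\<psi> y = \<psi> (z + z * y)" using y(2) by simp
  also have "\<dots> = 1 + \<psi> y" using y(1) z by (simp add: add mult)
  finally show False by simp
qed

end

section \<open>Cartan inclusions have the ideal intersection property\<close>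

locale cartan = regular_abelian_inclusion +
  fixes E
  assumes commutant: "relative_commutant A D \<subseteq> D"
    and expectation: "faithful_conditional_expectation A D E"
begin

lemma expectationD:
  shows "\<And>x. x \<in> A \<Longrightarrow> E x \<in> D" "\<And>b. b \<in> D \<Longrightarrow> E b = b"
    "\<And>x y. x \<in> A \<Longrightarrow> y \<in> A \<Longrightarrow> E (x + y) = E x + E y"
    "\<And>c x. x \<in> A \<Longrightarrow> E (c *\<^sub>C x) = c *\<^sub>C E x" "\<And>x. x \<in> A \<Longrightarrow> norm (E x) \<le> norm x"
    "\<And>x. x \<in> A \<Longrightarrow> cstar_positive D (E (adj x * x))"
    "\<And>b x. b \<in> D \<Longrightarrow> x \<in> A \<Longrightarrow> E (b * x) = b * E x" "\<And>b x. b \<in> D \<Longrightarrow> x \<in> A \<Longrightarrow> E (x * b) = E x * b"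
    "\<And>x. x \<in> A \<Longrightarrow> E (adj x * x) = 0 \<Longrightarrow> x = 0"
  using expectation by (auto simp: faithful_conditional_expectation_def conditional_expectation_def)

lemmas memA [simp, intro] = cstar_subalgebra_mem[OF A]

lemma D_in_A [simp, intro]: "d \<in> D \<Longrightarrow> d \<in> A"
  using DA by auto

lemma E_self_adjoint: "x \<in> A \<Longrightarrow> adj (E (adj x * x)) = E (adj x * x)"
  using expectationD(6)[of x] by (auto simp: cstar_positive_def)

text \<open>
  The elements \<open>E ((x + c b)\<^sup>* (x + c b))\<close> are self-adjoint for \<open>c = 1\<close> and \<open>c = i\<close>; by polarization
  \<open>E (x\<^sup>*) b = E (x)\<^sup>* b\<close> for all \<open>b\<close> in \<open>D\<close>.
\<close>

lemma E_adj: "E (adj x) = adj (E x)" if x: "x \<in> A"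
proof -
  have *: "E (adj x) * b = adj (E x) * b" if b: "b \<in> D" for b
  proof -
    define P Q where "P = E (adj x) * b" and "Q = adj b * E x"
    have expand: "E (adj (x + c *\<^sub>C b) * (x + c *\<^sub>C b)) =
        E (adj x * x) + c *\<^sub>C P + cnj c *\<^sub>C Q + (cnj c * c) *\<^sub>C (adj b * b)" for c
    proof -
      have "adj (x + c *\<^sub>C b) * (x + c *\<^sub>C b) =
          adj x * x + c *\<^sub>C (adj x * b) + cnj c *\<^sub>C (adj b * x) + (cnj c * c) *\<^sub>C (adj b * b)"
        by (simp add: distrib_left distrib_right mult_scaleC_left mult_scaleC_right scaleC_scaleC
            scaleC_add_right add_ac mult.commute)
      then show ?thesis
        using x b by (simp add: expectationD P_def Q_def)
    qed
    have "c *\<^sub>C P + cnj c *\<^sub>C Q = cnj c *\<^sub>C adj P + c *\<^sub>C adj Q" for c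
    proof -
      have "x + c *\<^sub>C b \<in> A" using x b by simp
      then have "adj (E (adj (x + c *\<^sub>C b) * (x + c *\<^sub>C b))) = E (adj (x + c *\<^sub>C b) * (x + c *\<^sub>C b))"
        by (rule E_self_adjoint)
      then show ?thesis
        unfolding expand using E_self_adjoint[OF x] by (simp add: mult.commute[of c])
    qed
    from this[of 1] this[of \<i>] have "P + Q = adj P + adj Q" "\<i> *\<^sub>C (P - Q) = \<i> *\<^sub>C (adj Q - adj P)"
      by (simp_all add: complex_vector.scale_right_diff_distrib)
    then have "P + Q = adj P + adj Q" "P - Q = adj Q - adj P"
      by (simp_all add: complex_vector.scale_cancel_left)
    then have "(P + Q) + (P - Q) = (adj P + adj Q) + (adj Q - adj P)" by (simp only:)
    then have "P + P = adj Q + adj Q" by simp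
    then have "(2::real) *\<^sub>R P = 2 *\<^sub>R adj Q" by (simp add: scaleR_2)
    then show ?thesis by (simp add: P_def Q_def)
  qed
  have "(E (adj x) - adj (E x)) * adj (E (adj x) - adj (E x)) = 0"
    using *[of "adj (E (adj x) - adj (E x))"] x expectationD(1) by (simp add: left_diff_distrib)
  then show ?thesis by (simp only: mult_adj_self_eq_0) simp
qed

lemma normalizer_push: "n * d * adj n * n = n * adj n * n * d"
  if n: "n \<in> normalizers A D" and d: "d \<in> D"
proof -
  have "n * d * adj n * n = n * (d * (adj n * n))" by (simp add: mult.assoc)
  also have "\<dots> = n * ((adj n * n) * d)" using comm[OF d normalizer_adj_mult[OF n]] by simp
  finally show ?thesis by (simp add: mult.assoc)
qed

text \<open>
  The element \<open>n\<^sup>* E(n)\<close> commutes with \<open>D\<close>, so it lies in \<open>D\<close> and is fixed by \<open>E\<close>.  On the spectrum: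
  where \<open>E n\<close> does not vanish, \<open>n\<close> coincides with it.
\<close>

lemma normalizer_E:
  assumes n: "n \<in> normalizers A D"
  shows "adj (E n) * n = adj (E n) * E n"
proof -
  note nA = normalizerD(1)[OF n] and nn = normalizer_mult_adj[OF n] normalizer_adj_mult[OF n]
  define y where "y = E n"
  have y: "y \<in> D" using expectationD(1) nA by (simp add: y_def)
  have commute: "adj n * y * d = d * (adj n * y)" if d: "d \<in> D" for d
  proof -
    define x where "x = adj n * y * d - d * (adj n * y)"
    have "E (n * d * adj n * n) = E (n * adj n * n * d)"
      using normalizer_push[OF n d] by simp
    then have push: "n * d * adj n * y = n * adj n * y * d"
      using expectationD(7)[OF normalizerD(2)[OF n d] nA] expectationD(8)[OF d, of "n * adj n * n"] expectationD(7)[OF nn(1) nA] nA nn d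
      by (simp add: y_def)
    have "adj n * n * (d * (adj n * y)) = adj n * (n * d * adj n * y)" by (simp add: mult.assoc)
    also have "\<dots> = adj n * n * (adj n * y * d)" unfolding push by (simp add: mult.assoc)
    finally have nnx: "adj n * n * x = 0" by (simp add: x_def right_diff_distrib)
    have "adj (n * x) * (n * x) = adj x * (adj n * n * x)" by (simp add: mult.assoc)
    then have nx: "n * x = 0" using nnx by (simp del: adj_mult)
    have "adj (n * (adj d * x)) * (n * (adj d * x)) = adj x * d * ((adj n * n) * adj d) * x"
      by (simp add: mult.assoc)
    also have "\<dots> = adj x * d * adj d * (adj n * n * x)"
      using comm[OF nn(2), of "adj d"] d by (simp add: mult.assoc)
    finally have ndx: "n * (adj d * x) = 0" using nnx by (simp del: adj_mult)
    have "adj x * x = adj d * adj y * (n * x) - adj y * (n * (adj d * x))"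
      by (simp add: x_def[THEN arg_cong[where f = adj]] left_diff_distrib mult.assoc)
    then have "x = 0" using nx ndx by simp
    then show ?thesis by (simp add: x_def)
  qed
  have ny: "adj n * y \<in> D"
    using commutant commute y nA by (auto simp: relative_commutant_def)
  have "adj n * y = E (adj n * y)" using expectationD(2)[OF ny] by simp
  also have "\<dots> = adj y * y" using expectationD(8)[OF y, of "adj n"] nA by (simp add: E_adj y_def)
  finally have "adj (adj n * y) = adj (adj y * y)" by simp
  then show ?thesis by (simp add: y_def)
qed

text \<open>
  This is the action of \<open>n\<close> on the spectrum of \<open>D\<close>; multiplicativity is the relation
  \<open>n x n\<^sup>* n = n n\<^sup>* n x\<close>, which holds because \<open>n\<^sup>* n\<close> commutes with \<open>x\<close>.
\<close>

lemma transported_character: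
  assumes \<phi>: "character D \<phi>" and n: "n \<in> normalizers A D" and nz: "\<phi> (n * adj n) \<noteq> 0"
  shows "character D (\<lambda>b. \<phi> (n * b * adj n) / \<phi> (n * adj n))"
proof -
  note nn = normalizer_mult_adj[OF n] and nD = normalizerD(2)[OF n] and \<phi>D = characterD[OF \<phi>]
  let ?\<psi> = "\<lambda>b. \<phi> (n * b * adj n) / \<phi> (n * adj n)"
  have add: "?\<psi> (x + y) = ?\<psi> x + ?\<psi> y" if "x \<in> D" "y \<in> D" for x y
    using \<phi>D(1)[OF nD nD, OF that] by (simp add: distrib_left distrib_right add_divide_distrib)
  have scale: "?\<psi> (c *\<^sub>C x) = c * ?\<psi> x" if "x \<in> D" for c x
    using \<phi>D(2)[OF nD[OF that], of c] by (simp add: mult_scaleC_left mult_scaleC_right)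
  have mult: "?\<psi> (x * y) = ?\<psi> x * ?\<psi> y" if x: "x \<in> D" and y: "y \<in> D" for x y
  proof -
    have "(n * x * adj n) * (n * y * adj n) = (n * x * adj n * n) * (y * adj n)"
      by (simp add: mult.assoc)
    also have "\<dots> = (n * adj n) * (n * (x * y) * adj n)"
      unfolding normalizer_push[OF n x] by (simp add: mult.assoc)
    finally have "\<phi> (n * x * adj n) * \<phi> (n * y * adj n) = \<phi> (n * adj n) * \<phi> (n * (x * y) * adj n)"
      using \<phi>D(3) nD nn x y by (metis mem(5))
    then show ?thesis using nz by (simp add: field_simps)
  qed
  have real: "cnj (\<phi> (n * adj n)) = \<phi> (n * adj n)"
    using \<phi>D(4)[OF nn] by simp
  have adj: "?\<psi> (adj x) = cnj (?\<psi> x)" if "x \<in> D" for x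
    using \<phi>D(4)[OF nD[OF that]] real by (simp add: mult.assoc)
  show ?thesis
    unfolding character_def
  proof (intro conjI ballI allI)
    fix x assume x: "x \<in> D"
    show "?\<psi> (c *\<^sub>C x) = c * ?\<psi> x" for c by (rule scale[OF x])
    show "?\<psi> (adj x) = cnj (?\<psi> x)" by (rule adj[OF x])
    show "cmod (?\<psi> x) \<le> norm x"
      by (rule multiplicative_functional_contractive[of ?\<psi>, OF add scale mult x])
    fix y assume y: "y \<in> D"
    show "?\<psi> (x + y) = ?\<psi> x + ?\<psi> y" by (rule add[OF x y])
    show "?\<psi> (x * y) = ?\<psi> x * ?\<psi> y" by (rule mult[OF x y])
  qed
qed


lemma non_commuting_self_adjoint:
  assumes z: "z \<in> A" "z \<notin> D"
  obtains d where "d \<in> D" "adj d = d" "z * d \<noteq> d * z"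
proof (rule ccontr)
  assume neg: "\<not> thesis"
  have sa: "z * d = d * z" if "d \<in> D" "adj d = d" for d
    using that neg \<open>\<And>d. d \<in> D \<Longrightarrow> adj d = d \<Longrightarrow> z * d \<noteq> d * z \<Longrightarrow> thesis\<close> by metis
  have "z * d = d * z" if d: "d \<in> D" for d
  proof -
    have parts: "z * (d + adj d) = (d + adj d) * z"
      by (rule sa[OF _ self_adjoint_parts(1)]) (use d in simp)
    have parts': "z * (\<i> *\<^sub>C (d - adj d)) = (\<i> *\<^sub>C (d - adj d)) * z"
      by (rule sa[OF _ self_adjoint_parts(2)]) (use d in simp)
    have "z * ((1 / 2) *\<^sub>C ((d + adj d) + (- \<i>) *\<^sub>C (\<i> *\<^sub>C (d - adj d)))) =
        ((1 / 2) *\<^sub>C ((d + adj d) + (- \<i>) *\<^sub>C (\<i> *\<^sub>C (d - adj d)))) * z"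
      by (simp only: mult_scaleC_left mult_scaleC_right parts parts'[simplified mult_scaleC_left mult_scaleC_right]
          distrib_left[of z "d + adj d" "(- \<i>) *\<^sub>C (\<i> *\<^sub>C (d - adj d))"]
          distrib_right[of "d + adj d" "(- \<i>) *\<^sub>C (\<i> *\<^sub>C (d - adj d))" z])
    then show ?thesis by (simp only: self_adjoint_decomposition[symmetric])
  qed
  then have "z \<in> relative_commutant A D" using z by (auto simp: relative_commutant_def)
  then show False using z commutant by blast
qed

text \<open>
  Where \<open>E n\<close> does not vanish, \<open>n\<close> agrees with \<open>E n\<close>.  If \<open>E n\<close> vanishes on the support of \<open>g0\<close>
  and \<open>g0 n\<close> lies in \<open>D\<close>, then \<open>g0 n = E (g0 n) = 0\<close>.  Otherwise \<open>g0 n\<close> fails to commute with some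
  \<open>d\<close>, so \<open>n\<close> moves a character \<open>\<phi>\<close> in the support of \<open>g0\<close> to a different character \<open>\<psi>\<close>.  With
  orthogonal \<open>f\<close> around \<open>\<phi>\<close> and \<open>g\<close> around \<open>\<psi>\<close>, the part \<open>f n g g\<^sup>* n\<^sup>*\<close> of \<open>f\<close> is carried by \<open>n\<close>
  into the support of \<open>g\<close>, away from itself.
\<close>

lemma shrink_normalizer:
  assumes n: "n \<in> normalizers A D" and g0: "g0 \<in> D" "g0 \<noteq> 0"
  shows "\<exists>c\<in>D. g0 * c \<noteq> 0 \<and> (g0 * c) * n * (g0 * c) = (g0 * c) * E n * (g0 * c)"
proof -
  note nA = normalizerD(1)[OF n] and nn = normalizer_mult_adj[OF n] and n'n = normalizer_adj_mult[OF n]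
  have y: "E n \<in> D" using expectationD(1) nA by blast
  consider "g0 * E n \<noteq> 0" | "g0 * E n = 0" "g0 * n \<in> D" | "g0 * E n = 0" "g0 * n \<notin> D" by blast
  then show ?thesis
  proof cases
    case 1
    have "g0 * adj (E n) \<noteq> 0"
    proof
      assume "g0 * adj (E n) = 0"
      then have "(g0 * adj (E n)) * (E n * adj g0) = 0" by simp
      then have "(g0 * E n) * adj (g0 * E n) = 0"
        using y g0 by (simp add: ac)
      then show False using 1 by (simp only: mult_adj_self_eq_0)
    qed
    moreover have "g0 * adj (E n) * n = g0 * adj (E n) * E n"
      using normalizer_E[OF n] by (simp add: mult.assoc)
    ultimately show ?thesis using y by (intro bexI[of _ "adj (E n)"]) auto
  next
    case 2
    have "g0 * n = E (g0 * n)" using expectationD(2)[OF 2(2)] by simp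
    also have "\<dots> = 0" using expectationD(7)[OF g0(1) nA] 2(1) by simp
    finally have gn: "g0 * n = 0" .
    have "g0 * adj g0 * n = 0" "g0 * adj g0 * E n = 0"
      using gn 2(1) comm[OF g0(1), of "adj g0"] g0(1) by (simp_all add: mult.assoc)
    then show ?thesis using g0 by (intro bexI[of _ "adj g0"]) auto
  next
    case 3
    obtain d where d: "d \<in> D" "adj d = d" and ne: "g0 * n * d \<noteq> d * (g0 * n)"
      using non_commuting_self_adjoint[OF _ 3(2)] g0 nA by (metis D_in_A memA(5))
    define k where "k = n * d * adj n - d * (n * adj n)"
    define w where "w = g0 * n * d - d * (g0 * n)"
    have k: "k \<in> D" using d nn normalizerD(2)[OF n] by (simp add: k_def)
    have w_adj: "w * adj n = g0 * k"
      using left_comm[OF d(1) g0(1)] by (simp add: w_def k_def algebra_simps)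
    have "g0 * k \<noteq> 0"
    proof
      assume "g0 * k = 0"
      then have wn: "w * adj n = 0" using w_adj by simp
      have "(w * (d * adj n)) * adj (w * (d * adj n)) = w * (d * (adj n * n) * d) * adj w"
        using d(2) by (simp add: mult.assoc)
      also have "d * (adj n * n) * d = adj n * (n * (d * d))"
        using comm[OF d(1) n'n] by (simp add: mult.assoc)
      also have "w * (adj n * (n * (d * d))) * adj w = (w * adj n) * (n * (d * d) * adj w)"
        by (simp add: mult.assoc)
      finally have wdn: "w * (d * adj n) = 0"
        using wn by (simp only: mult_zero_left mult_adj_self_eq_0)
      have "w * adj w = (w * (d * adj n)) * adj g0 - (w * adj n) * adj g0 * d"
        using d(2) by (subst (2) w_def) (simp add: right_diff_distrib mult.assoc)
      then have "w * adj w = 0" using wn wdn by simp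
      then show False using ne by (simp only: mult_adj_self_eq_0) (simp add: w_def)
    qed
    moreover obtain \<phi> where \<phi>: "character D \<phi>" "cmod (\<phi> (g0 * k)) = norm (g0 * k)"
      using character_attaining_norm[of "g0 * k"] g0 k by blast
    ultimately have "\<phi> (g0 * k) \<noteq> 0" by auto
    note \<phi>D = characterD[OF \<phi>(1)]
    have \<phi>g0: "\<phi> g0 \<noteq> 0" and \<phi>k: "\<phi> k \<noteq> 0"
      using \<open>\<phi> (g0 * k) \<noteq> 0\<close> \<phi>D(3)[OF g0(1) k] by auto
    define q where "q = \<phi> (n * adj n)"
    have \<phi>k_eq: "\<phi> k = \<phi> (n * d * adj n) - \<phi> d * q"
      using \<phi>D(8,3) d nn normalizerD(2)[OF n d(1)] by (simp add: k_def q_def)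
    have q: "q \<noteq> 0"
    proof
      assume "q = 0"
      have "(n * d * adj n) * adj (n * d * adj n) = n * d * (adj n * n) * d * adj n"
        using d(2) by (simp add: mult.assoc)
      also have "\<dots> = (n * d * adj n * n) * (d * adj n)" by (simp add: mult.assoc)
      also have "\<dots> = (n * adj n) * (n * (d * d) * adj n)"
        unfolding normalizer_push[OF n d(1)] by (simp add: mult.assoc)
      finally have "\<phi> (n * d * adj n) * cnj (\<phi> (n * d * adj n)) = q * \<phi> (n * (d * d) * adj n)"
        using \<phi>D(3,4) normalizerD(2)[OF n] d nn unfolding q_def
        by (metis mem(5) mem(7))
      then have "\<phi> (n * d * adj n) = 0" using \<open>q = 0\<close> by simp
      then show False using \<phi>k \<phi>k_eq \<open>q = 0\<close> by simp
    qed
    define \<psi> where "\<psi> b = \<phi> (n * b * adj n) / \<phi> (n * adj n)" for b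
    have \<psi>: "character D \<psi>"
      unfolding \<psi>_def using transported_character[OF \<phi>(1) n] q by (simp add: q_def)
    have \<psi>d: "\<phi> d \<noteq> \<psi> d"
      using \<phi>k \<phi>k_eq q by (auto simp: \<psi>_def q_def[symmetric] field_simps)
    have "n * (adj n * n) * adj n = (n * adj n) * (n * adj n)" by (simp add: mult.assoc)
    then have \<psi>n: "\<psi> (adj n * n) \<noteq> 0"
      using \<phi>D(3)[OF nn nn] q by (simp add: \<psi>_def q_def)
    obtain f g where f: "f \<in> D" "\<phi> f \<noteq> 0" and g: "g \<in> D" "\<psi> g \<noteq> 0" and fg: "f * g = 0"
      using separate_characters[OF \<phi>(1) \<psi> d \<psi>d g0(1) \<phi>g0 n'n \<psi>n] by blast
    define u where "u = n * (g * adj g) * adj n"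
    have u: "u \<in> D" using normalizerD(2)[OF n] g by (simp add: u_def)
    have "\<psi> (g * adj g) \<noteq> 0"
      using g characterD(3,4)[OF \<psi>] by simp
    then have \<phi>u: "\<phi> u \<noteq> 0" by (auto simp: u_def \<psi>_def)
    have unf: "u * n * f = 0"
    proof -
      have "u * n * f = n * adj n * n * (g * adj g) * f"
        using normalizer_push[OF n, of "g * adj g"] g by (simp add: u_def)
      also have "\<dots> = n * adj n * n * (adj g * (f * g))"
        using f g by (simp add: ac)
      finally show ?thesis using fg by simp
    qed
    have "g0 * (f * u) \<noteq> 0"
    proof
      assume "g0 * (f * u) = 0"
      then have "\<phi> g0 * (\<phi> f * \<phi> u) = 0"
        using \<phi>D(3) \<phi>D(6) g0 f u by (metis mem(5))
      then show False using \<phi>g0 f \<phi>u by simp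
    qed
    moreover have "(g0 * (f * u)) * n * (g0 * (f * u)) = g0 * f * (u * n * f) * (g0 * u)"
      by (simp add: mult.assoc left_comm[OF g0(1) f(1)])
    moreover have "(g0 * (f * u)) * E n * (g0 * (f * u)) = f * u * (g0 * E n) * (g0 * (f * u))"
      using comm[OF g0(1), of "f * u"] f u by (simp add: mult.assoc)
    ultimately show ?thesis
      using unf 3(1) f u by (intro bexI[of _ "f * u"]) auto
  qed
qed

lemma shrink_span:
  assumes b: "b \<in> cspan (normalizers A D)" and g0: "g0 \<in> D" "g0 \<noteq> 0"
  shows "\<exists>c\<in>D. g0 * c \<noteq> 0 \<and> (g0 * c) * b * (g0 * c) = (g0 * c) * E b * (g0 * c)"
proof -
  let ?P = "\<lambda>b. b \<in> A \<and> (\<forall>g0\<in>D. g0 \<noteq> 0 \<longrightarrow>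
    (\<exists>c\<in>D. g0 * c \<noteq> 0 \<and> (g0 * c) * b * (g0 * c) = (g0 * c) * E b * (g0 * c)))"
  have "?P b"
    using b
  proof (rule complex_vector.span_induct)
    show "?P n" if "n \<in> normalizers A D" for n
      using shrink_normalizer[OF that] normalizerD(1)[OF that] by blast
    show "csubspace (Collect ?P)"
      unfolding complex_vector.subspace_def
    proof (intro conjI ballI allI)
      have "E 0 = 0" using expectationD(2)[of 0] by simp
      then have "?P 0"
        by (intro conjI ballI impI) (auto intro!: bexI[of _ "adj _"])
      then show "0 \<in> Collect ?P" by simp
      fix x assume x: "x \<in> Collect ?P"
      show "c *\<^sub>C x \<in> Collect ?P" for c
      proof -
        have "c *\<^sub>C x \<in> A" using x by auto
        moreover have "\<exists>e\<in>D. g0 * e \<noteq> 0 \<and> (g0 * e) * (c *\<^sub>C x) * (g0 * e) = (g0 * e) * E (c *\<^sub>C x) * (g0 * e)"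
          if g0: "g0 \<in> D" "g0 \<noteq> 0" for g0
        proof -
          obtain e where "e \<in> D" "g0 * e \<noteq> 0" "(g0 * e) * x * (g0 * e) = (g0 * e) * E x * (g0 * e)"
            using x g0 by blast
          then show ?thesis
            using x expectationD(4)[of x c] by (intro bexI[of _ e]) (auto simp: mult_scaleC_left mult_scaleC_right)
        qed
        ultimately show ?thesis by blast
      qed
      fix y assume y: "y \<in> Collect ?P"
      have "\<exists>e\<in>D. g0 * e \<noteq> 0 \<and> (g0 * e) * (x + y) * (g0 * e) = (g0 * e) * E (x + y) * (g0 * e)"
        if g0: "g0 \<in> D" "g0 \<noteq> 0" for g0
      proof -
        obtain c where c: "c \<in> D" "g0 * c \<noteq> 0" and cx: "(g0 * c) * x * (g0 * c) = (g0 * c) * E x * (g0 * c)"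
          using x g0 by blast
        obtain e where e: "e \<in> D" "g0 * c * e \<noteq> 0"
          and ey: "(g0 * c * e) * y * (g0 * c * e) = (g0 * c * e) * E y * (g0 * c * e)"
          using bspec[OF conjunct2[OF CollectD[OF y]], OF mem(5)[OF g0(1) c(1)]] c(2) by blast
        have swap: "g0 * c * e = e * (g0 * c)" using comm[of "g0 * c" e] g0 c e by simp
        have "(g0 * c * e) * x * (g0 * c * e) = e * ((g0 * c) * x * (g0 * c)) * e"
          by (subst swap) (simp add: mult.assoc)
        also have "\<dots> = (g0 * c * e) * E x * (g0 * c * e)"
          unfolding cx by (subst swap) (simp add: mult.assoc)
        finally have "(g0 * (c * e)) * (x + y) * (g0 * (c * e)) = (g0 * (c * e)) * E (x + y) * (g0 * (c * e))"
          using ey x y expectationD(3)[of x y] by (simp add: distrib_left distrib_right mult.assoc)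
        then show ?thesis using c e by (intro bexI[of _ "c * e"]) (auto simp: mult.assoc)
      qed
      then show "x + y \<in> Collect ?P" using x y by simp
    qed
  qed
  then show ?thesis using g0 by blast
qed


text \<open>
  Suppose that \<open>J \<inter> D = 0\<close> and \<open>a\<close> is a non-zero element of \<open>J\<close>; put \<open>h = E (a\<^sup>* a)\<close>.  The elements of
  \<open>D\<close> constructed in the proof are functions on the spectrum: \<open>g\<close> lives where \<open>h\<close> exceeds half its norm
  and compresses an approximation \<open>n\<close> of \<open>a\<^sup>* a\<close> to \<open>D\<close>; \<open>e\<close> is a multiple of \<open>g\<close> with values in
  \<open>[0, 1]\<close>; \<open>f\<close> is supported where \<open>e = 1\<close>; and \<open>m\<close> inverts \<open>h\<close> there.  Hence \<open>f = e h e m f\<close>, and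
  replacing \<open>e h e\<close> by the nearby element \<open>e a\<^sup>* a e\<close> of \<open>J\<close> costs a factor \<open>v\<close> of norm below 1.
\<close>

theorem ideal_intersection: "ideal_intersection_property A D"
  unfolding ideal_intersection_property_def
proof (intro allI impI notI, elim conjE)
  fix J assume J: "cstar_ideal A J" and "J \<noteq> {0}" and JD: "J \<inter> D = {0}"
  note JI = cstar_idealD[OF J]
  obtain a where a: "a \<in> J" "a \<noteq> 0" using \<open>J \<noteq> {0}\<close> JI(4) by blast
  have aA: "a \<in> A" using a JI(1) by auto
  have aaA: "adj a * a \<in> A" using aA by simp
  define h where "h = E (adj a * a)"
  have h0: "h \<noteq> 0" using expectationD(9)[OF aA] a(2) by (auto simp: h_def)
  have hD: "h \<in> D" using expectationD(1)[OF aaA] by (simp add: h_def)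
  obtain b where b: "b \<in> D" "h = adj b * b"
    using expectationD(6)[OF aA] by (auto simp: h_def cstar_positive_def)
  have h_adj: "adj h = h" by (simp add: b(2))
  have h_pos: "\<phi> h = of_real (Re (\<phi> h)) \<and> 0 \<le> Re (\<phi> h)" if "character D \<phi>" for \<phi>
    using characterD(3,4)[OF that] b by (simp add: complex_eq_iff)
  define \<eta> where "\<eta> = norm h / 2"
  have \<eta>: "0 < \<eta>" using h0 by (simp add: \<eta>_def)
  have cont_cut: "continuous_on UNIV (\<lambda>t. max 0 (t - r))" for r :: real
    by (intro continuous_intros)
  obtain g0 where g0: "g0 \<in> D"
    and \<phi>g0: "\<And>\<phi>. character D \<phi> \<Longrightarrow> \<phi> g0 = \<phi> h * of_real (max 0 (Re (\<phi> h) - \<eta>))"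
    using functional_calculus[OF hD h_adj cont_cut hD] by blast
  have "g0 \<noteq> 0"
  proof -
    obtain \<phi> where \<phi>: "character D \<phi>" "cmod (\<phi> h) = norm h"
      by (rule character_attaining_norm[OF hD])
    have "cmod (\<phi> h) = Re (\<phi> h)" using h_pos[OF \<phi>(1)] by (metis abs_of_nonneg norm_of_real)
    then have "Re (\<phi> h) - \<eta> = \<eta>" using \<phi>(2) by (simp add: \<eta>_def)
    then have "\<phi> g0 \<noteq> 0" using \<phi>g0[OF \<phi>(1)] \<eta> \<phi>(2) h0 by auto
    then show ?thesis using characterD(6)[OF \<phi>(1)] by auto
  qed
  have "adj a * a \<in> closure (cspan (normalizers A D))" using aaA dense by simp
  then obtain n where n: "n \<in> cspan (normalizers A D)" "dist n (adj a * a) < \<eta> / 8"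
    using \<eta> by (meson closure_approachable divide_pos_pos zero_less_numeral)
  have nA: "n \<in> A" using n(1) dense closure_subset by blast
  obtain c where c: "c \<in> D" "g0 * c \<noteq> 0" and cn: "(g0 * c) * n * (g0 * c) = (g0 * c) * E n * (g0 * c)"
    using shrink_span[OF n(1) g0 \<open>g0 \<noteq> 0\<close>] by blast
  define g where "g = g0 * c"
  have gD: "g \<in> D" using g0 c by (simp add: g_def)
  define X where "X = adj g * g"
  have XD: "X \<in> D" and X_adj: "adj X = X" using gD by (simp_all add: X_def)
  have \<phi>X: "\<phi> X = of_real (Re (\<phi> X)) \<and> 0 \<le> Re (\<phi> X)" if "character D \<phi>" for \<phi>
    using characterD(3,4)[OF that] gD by (simp add: X_def complex_eq_iff)
  define s where "s = norm X / 2"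
  have s: "0 < s" using c(2) by (simp add: s_def X_def g_def del: adj_mult)
  have contX: "continuous_on UNIV (\<lambda>t. 1 / max t s)"
  proof -
    have "max t s \<noteq> 0" for t using s max.cobounded2[of s t] by linarith
    then show ?thesis by (intro continuous_intros) simp_all
  qed
  obtain e' where e': "e' \<in> D"
    and \<phi>e': "\<And>\<phi>. character D \<phi> \<Longrightarrow> \<phi> e' = \<phi> (adj g) * of_real (1 / max (Re (\<phi> X)) s)"
    using functional_calculus[OF XD X_adj contX mem(7)[OF gD]] by blast
  define e where "e = e' * g"
  have eD: "e \<in> D" using e' gD by (simp add: e_def)
  have \<phi>e: "\<phi> e = of_real (Re (\<phi> X) / max (Re (\<phi> X)) s)" if \<phi>: "character D \<phi>" for \<phi>
  proof -
    have "\<phi> e = \<phi> X * of_real (1 / max (Re (\<phi> X)) s)"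
      using characterD(3)[OF \<phi>] \<phi>e'[OF \<phi>] e' gD by (simp add: e_def X_def)
    then show ?thesis using \<phi>X[OF \<phi>] by (metis of_real_mult times_divide_eq_right mult.right_neutral)
  qed
  have e1: "norm e \<le> 1"
  proof (rule norm_le_characters[OF eD])
    fix \<phi> assume \<phi>: "character D \<phi>"
    show "cmod (\<phi> e) \<le> 1"
      unfolding \<phi>e[OF \<phi>] norm_of_real using s \<phi>X[OF \<phi>] by (auto simp: max_def divide_le_eq)
  qed
  obtain f where fD: "f \<in> D"
    and \<phi>f: "\<And>\<phi>. character D \<phi> \<Longrightarrow> \<phi> f = \<phi> X * of_real (max 0 (Re (\<phi> X) - s))"
    using functional_calculus[OF XD X_adj cont_cut XD] by blast
  have "f \<noteq> 0"
  proof -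
    obtain \<phi> where \<phi>: "character D \<phi>" "cmod (\<phi> X) = norm X"
      by (rule character_attaining_norm[OF XD])
    have "cmod (\<phi> X) = Re (\<phi> X)" using \<phi>X[OF \<phi>(1)] by (metis abs_of_nonneg norm_of_real)
    then have "Re (\<phi> X) - s = s" using \<phi>(2) by (simp add: s_def)
    then have "\<phi> f \<noteq> 0" using \<phi>f[OF \<phi>(1)] s \<phi>(2) by (auto simp: s_def)
    then show ?thesis using characterD(6)[OF \<phi>(1)] by auto
  qed
  have conth: "continuous_on UNIV (\<lambda>t. 1 / (max t \<eta>)\<^sup>2)"
  proof -
    have "max t \<eta> \<noteq> 0" for t using \<eta> max.cobounded2[of \<eta> t] by linarith
    then show ?thesis by (intro continuous_intros) simp_all
  qed
  obtain m where mD: "m \<in> D"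
    and \<phi>m: "\<And>\<phi>. character D \<phi> \<Longrightarrow> \<phi> m = \<phi> h * of_real (1 / (max (Re (\<phi> h)) \<eta>)\<^sup>2)"
    using functional_calculus[OF hD h_adj conth hD] by blast
  have m1: "norm m \<le> 1 / \<eta>"
  proof (rule norm_le_characters[OF mD])
    fix \<phi> assume \<phi>: "character D \<phi>"
    define t where "t = Re (\<phi> h)"
    have t: "0 \<le> t" "\<phi> h = of_real t" using h_pos[OF \<phi>] by (auto simp: t_def)
    have "\<phi> m = of_real (t / (max t \<eta>)\<^sup>2)" using \<phi>m[OF \<phi>] t(2) by simp
    then have "cmod (\<phi> m) = t / (max t \<eta>)\<^sup>2" using t(1) by (simp only: norm_of_real) simp
    also have "\<dots> \<le> max t \<eta> / (max t \<eta>)\<^sup>2" by (intro divide_right_mono) auto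
    also have "\<dots> = 1 / max t \<eta>" using \<eta> by (simp add: power2_eq_square)
    also have "\<dots> \<le> 1 / \<eta>" using \<eta> by (intro divide_left_mono) auto
    finally show "cmod (\<phi> m) \<le> 1 / \<eta>" .
  qed
  have key: "e * h * e * m * f = f"
  proof (rule eq_characters)
    fix \<phi> assume \<phi>: "character D \<phi>"
    note \<phi>D = characterD[OF \<phi>]
    have eq: "\<phi> (e * h * e * m * f) = \<phi> e * \<phi> h * \<phi> e * \<phi> m * \<phi> f"
      using eD hD mD fD by (simp add: \<phi>D(3))
    show "\<phi> (e * h * e * m * f) = \<phi> f"
    proof (cases "\<phi> f = 0")
      case False
      then have Xs: "s < Re (\<phi> X)" using \<phi>f[OF \<phi>] by (auto simp: max_def split: if_splits)
      then have "\<phi> X \<noteq> 0" using s by auto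
      then have "\<phi> g \<noteq> 0" using \<phi>D(3) gD by (auto simp: X_def)
      then have "\<phi> g0 \<noteq> 0" using \<phi>D(3)[OF g0 c(1)] by (auto simp: g_def)
      then have h\<eta>: "\<eta> < Re (\<phi> h)" using \<phi>g0[OF \<phi>] by (auto simp: max_def split: if_splits)
      have "\<phi> e = 1" using \<phi>e[OF \<phi>] Xs s by simp
      moreover have "\<phi> h * \<phi> m = 1"
      proof -
        define t where "t = Re (\<phi> h)"
        have "\<phi> h = of_real t" "max t \<eta> = t" "t \<noteq> 0" using h_pos[OF \<phi>] h\<eta> \<eta> by (auto simp: t_def)
        then show ?thesis using \<phi>m[OF \<phi>] by (simp add: power2_eq_square)
      qed
      ultimately show ?thesis using eq by simp
    qed (simp add: eq)
  qed (use eD hD mD fD in auto)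
  have ene: "e * n * e = e * E n * e"
  proof -
    have eg: "e = g * e'" using comm e' gD by (simp add: e_def)
    have "e * n * e = e' * (g * n * g) * e'" by (subst (2) eg) (simp add: e_def mult.assoc)
    also have "\<dots> = e' * (g * E n * g) * e'" using cn by (simp add: g_def)
    also have "\<dots> = e * E n * e" by (subst (2) eg) (simp add: e_def mult.assoc)
    finally show ?thesis .
  qed
  define v where "v = (e * h * e - e * (adj a * a) * e) * m"
  have vA: "v \<in> A" using eD hD mD aA by (simp add: v_def)
  have sandwich: "norm (e * x * e) \<le> norm x" for x
  proof -
    have "norm (e * x * e) \<le> norm e * norm x * norm e"
      by (meson mult_right_mono norm_ge_zero norm_mult_ineq order_trans)
    also have "\<dots> \<le> 1 * norm x * 1" using e1 by (intro mult_mono) auto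
    finally show ?thesis by simp
  qed
  \<comment> \<open>As \<open>e n e = e E(n) e\<close>, both \<open>e h e\<close> and \<open>e a\<^sup>* a e\<close> are within \<open>\<eta> / 8\<close> of this element.\<close>
  have "norm v \<le> (\<eta> / 8 + \<eta> / 8) * (1 / \<eta>)"
  proof -
    have diff: "norm (adj a * a - n) < \<eta> / 8" using n(2) by (simp add: dist_norm norm_minus_commute)
    have "h = E (adj a * a - n) + E n"
      using expectationD(3)[of "adj a * a - n" n] aaA nA by (simp add: h_def)
    then have "e * h * e - e * (adj a * a) * e = e * E (adj a * a - n) * e - e * (adj a * a - n) * e"
      using ene by (simp add: algebra_simps)
    then have "norm (e * h * e - e * (adj a * a) * e)
        \<le> norm (E (adj a * a - n)) + norm (adj a * a - n)"
      using norm_triangle_ineq4[of "e * E (adj a * a - n) * e" "e * (adj a * a - n) * e"]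
        sandwich[of "E (adj a * a - n)"] sandwich[of "adj a * a - n"] by simp
    also have "\<dots> \<le> \<eta> / 8 + \<eta> / 8"
      using expectationD(5)[of "adj a * a - n"] diff aaA nA by simp
    finally have "norm (e * h * e - e * (adj a * a) * e) * norm m \<le> (\<eta> / 8 + \<eta> / 8) * (1 / \<eta>)"
      using m1 \<eta> by (intro mult_mono) auto
    then show ?thesis
      unfolding v_def using norm_mult_ineq order_trans by blast
  qed
  then have v1: "norm v < 1" using \<eta> by simp
  have "f - v * f = e * (adj a * a) * e * m * f"
    using key by (simp add: v_def left_diff_distrib)
  moreover have "e * (adj a * a) * e * m * f \<in> J"
    using a(1) aA eD mD fD JI(5,6) by (simp add: D_in_A)
  ultimately have "f \<in> J"
    using ideal_absorb[OF J A D_in_A[OF fD] vA v1] by simp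
  then show False using JD fD \<open>f \<noteq> 0\<close> by auto
qed

end

lemma cartan_ideal_intersection:
  assumes "cartan_inclusion A D"
  shows "ideal_intersection_property A D"
proof -
  obtain E where E: "faithful_conditional_expectation A D E" and *: "regular_inclusion A D" "maximal_abelian A D"
    using assms by (auto simp: cartan_inclusion_def)
  interpret regular_abelian_inclusion A D
    using * by unfold_locales (auto simp: maximal_abelian_def)
  interpret cartan A D E
    using E maximal_abelian_commutant[OF A *(2)] by unfold_locales
  show ?thesis by (rule ideal_intersection)
qed

section \<open>Passing to the Cartan envelope\<close>

lemma closed_preimage:
  assumes "closed B" "\<And>x. isCont f x"
  shows "closed {x. f x \<in> B}"
  using continuous_closed_vimage[OF assms] by (simp add: vimage_def)

lemma csubspace_closure:
  assumes "csubspace S"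
  shows "csubspace (closure S)"
  unfolding complex_vector.subspace_def
proof (intro conjI ballI allI)
  show "0 \<in> closure S" using complex_vector.subspace_0[OF assms] closure_subset by blast
  fix x assume "x \<in> closure S"
  then obtain f where f: "\<And>n. f n \<in> S" "f \<longlonglongrightarrow> x" by (auto simp: closure_sequential)
  show "c *\<^sub>C x \<in> closure S" for c
    unfolding closure_sequential
    by (intro exI[of _ "\<lambda>n. c *\<^sub>C f n"] conjI allI complex_vector.subspace_scale[OF assms] f(1)
        tendsto_scaleC[OF f(2)])
  fix y assume "y \<in> closure S"
  then obtain g where g: "\<And>n. g n \<in> S" "g \<longlonglongrightarrow> y" by (auto simp: closure_sequential)
  show "x + y \<in> closure S"
    unfolding closure_sequential
    by (intro exI[of _ "\<lambda>n. f n + g n"] conjI allI complex_vector.subspace_add[OF assms] f(1) g(1)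
        tendsto_add[OF f(2) g(2)])
qed

text \<open>
  Membership of products is extended from \<open>G\<close> to the closed span in one factor at a time.
\<close>

lemma closure_cspan_subalgebra:
  fixes G :: "'a::cstar_algebra set"
  assumes mult: "\<And>x y. x \<in> G \<Longrightarrow> y \<in> G \<Longrightarrow> x * y \<in> G" and adj: "\<And>x. x \<in> G \<Longrightarrow> adj x \<in> G"
  shows "cstar_subalgebra (closure (cspan G))"
proof -
  define B where "B = closure (cspan G)"
  have B: "csubspace B" "closed B" "G \<subseteq> B"
    using csubspace_closure[OF complex_vector.subspace_span, of G] complex_vector.span_superset[of G]
      closure_subset[of "cspan G"] by (auto simp: B_def)
  note Bs = complex_vector.subspace_0[OF B(1)] complex_vector.subspace_add[OF B(1)]
    complex_vector.subspace_scale[OF B(1)]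
  have left: "x * y \<in> B" if x: "x \<in> B" and y: "y \<in> G" for x y
  proof -
    have "x \<in> {x. x * y \<in> B}"
    proof (rule closure_cspan_induct[OF x[unfolded B_def]])
      show "csubspace {x. x * y \<in> B}"
        using Bs by (auto simp: complex_vector.subspace_def distrib_right mult_scaleC_left)
      show "closed {x. x * y \<in> B}" using B(2) by (rule closed_preimage) (intro continuous_intros)
      show "G \<subseteq> {x. x * y \<in> B}" using mult y B(3) by blast
    qed
    then show ?thesis by simp
  qed
  have "x * y \<in> B" if x: "x \<in> B" and y: "y \<in> B" for x y
  proof -
    have "y \<in> {y. x * y \<in> B}"
    proof (rule closure_cspan_induct[OF y[unfolded B_def]])
      show "csubspace {y. x * y \<in> B}"
        using Bs by (auto simp: complex_vector.subspace_def distrib_left mult_scaleC_right)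
      show "closed {y. x * y \<in> B}" using B(2) by (rule closed_preimage) (intro continuous_intros)
      show "G \<subseteq> {y. x * y \<in> B}" using left x by blast
    qed
    then show ?thesis by simp
  qed
  moreover have "adj x \<in> B" if x: "x \<in> B" for x
  proof -
    have "x \<in> {x. adj x \<in> B}"
    proof (rule closure_cspan_induct[OF x[unfolded B_def]])
      show "csubspace {x. adj x \<in> B}"
        using Bs by (auto simp: complex_vector.subspace_def)
      show "closed {x. adj x \<in> B}" using B(2) by (rule closed_adj_vimage)
      show "G \<subseteq> {x. adj x \<in> B}" using adj B(3) by blast
    qed
    then show ?thesis by simp
  qed
  ultimately show ?thesis
    using B unfolding B_def[symmetric] cstar_subalgebra_def by blast
qed

lemma (in commutative_cstar) annihilator_ideal_commutative:
  assumes "X \<subseteq> D"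
  shows "cstar_ideal D (annihilator D X)"
  unfolding cstar_ideal_def
proof (intro conjI ballI annihilator_closed_subspace[OF subalgebra])
  fix a x assume a: "a \<in> D" and x: "x \<in> annihilator D X"
  then have xD: "x \<in> D" by (simp add: annihilator_def)
  have "a * x * y = 0" "y * (a * x) = 0" if y: "y \<in> X" for y
    using x y a xD assms left_comm[of y a x] by (auto simp: annihilator_def mult.assoc)
  then show ax: "a * x \<in> annihilator D X" using a xD by (simp add: annihilator_def)
  then show "x * a \<in> annihilator D X" using comm[OF a xD] by simp
qed (auto simp: annihilator_def)

locale star_mono =
  fixes A :: "'a::cstar_algebra set" and A1 :: "'b::cstar_algebra set" and \<alpha>
  assumes subA: "cstar_subalgebra A" and subA1: "cstar_subalgebra A1"
    and mono: "star_monomorphism A A1 \<alpha>"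
begin

lemma hom:
  shows "x \<in> A \<Longrightarrow> \<alpha> x \<in> A1" "x \<in> A \<Longrightarrow> y \<in> A \<Longrightarrow> \<alpha> (x + y) = \<alpha> x + \<alpha> y"
    "x \<in> A \<Longrightarrow> \<alpha> (c *\<^sub>C x) = c *\<^sub>C \<alpha> x" "x \<in> A \<Longrightarrow> y \<in> A \<Longrightarrow> \<alpha> (x * y) = \<alpha> x * \<alpha> y"
    "x \<in> A \<Longrightarrow> \<alpha> (adj x) = adj (\<alpha> x)"
  using mono by (auto simp: star_monomorphism_def)

lemma hom_zero: "\<alpha> 0 = 0"
  using hom(3)[OF cstar_subalgebra_mem(1)[OF subA], of 0] by simp

lemma hom_eq_0: "x \<in> A \<Longrightarrow> \<alpha> x = 0 \<longleftrightarrow> x = 0"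
  using mono hom_zero cstar_subalgebra_mem(1)[OF subA] unfolding star_monomorphism_def inj_on_def
  by metis

lemma hom_diff: "x \<in> A \<Longrightarrow> y \<in> A \<Longrightarrow> \<alpha> (x - y) = \<alpha> x - \<alpha> y"
  using hom(2)[of x "- y"] hom(3)[of y "- 1"] cstar_subalgebra_mem(3)[OF subA] by simp

text \<open>
  For \<open>h = x\<^sup>* x\<close> choose a character \<open>\<phi>\<close> on a commutative subalgebra containing the image of a
  commutative subalgebra around \<open>h\<close>, with \<open>\<phi> (\<alpha> h)\<close> of maximal modulus.  Then \<open>\<phi> \<circ> \<alpha>\<close> is
  multiplicative, hence contractive.
\<close>

lemma contractive: "norm (\<alpha> x) \<le> norm x" if x: "x \<in> A"
proof -
  define h where "h = adj x * x"
  have h: "h \<in> A" "adj h = h" using x cstar_subalgebra_mem[OF subA] by (simp_all add: h_def)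
  obtain C where C: "commutative_cstar C" "{h} \<subseteq> C" "C \<subseteq> A"
    by (rule commuting_set_in_commutative_subalgebra[OF subA, of "{h}"]) (use h in auto)
  interpret C: commutative_cstar C by (fact C(1))
  have CA: "x \<in> A" if "x \<in> C" for x using that C(3) by auto
  obtain C1 where C1: "commutative_cstar C1" "\<alpha> ` C \<subseteq> C1" "C1 \<subseteq> A1"
  proof (rule commuting_set_in_commutative_subalgebra[OF subA1, of "\<alpha> ` C"])
    show "\<alpha> ` C \<subseteq> A1" using hom(1) C(3) by auto
    show "adj u \<in> \<alpha> ` C" if u: "u \<in> \<alpha> ` C" for u
    proof -
      obtain w where w: "w \<in> C" "u = \<alpha> w" using u by auto
      then have "adj u = \<alpha> (adj w)" using hom(5)[OF CA] by simp
      then show ?thesis using w(1) by auto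
    qed
    show "u * v = v * u" if uv: "u \<in> \<alpha> ` C" "v \<in> \<alpha> ` C" for u v
    proof -
      obtain w z where "w \<in> C" "u = \<alpha> w" "z \<in> C" "v = \<alpha> z" using uv by auto
      then show ?thesis using hom(4)[OF CA CA] C.comm by metis
    qed
  qed
  interpret C1: commutative_cstar C1 by (fact C1(1))
  have C1m: "\<alpha> x \<in> C1" if "x \<in> C" for x using that C1(2) by auto
  have hC: "h \<in> C" using C(2) by simp
  obtain \<phi> where \<phi>: "character C1 \<phi>" "cmod (\<phi> (\<alpha> h)) = norm (\<alpha> h)"
    by (rule C1.character_attaining_norm[OF C1m[OF hC]])
  have "cmod (\<phi> (\<alpha> h)) \<le> norm h"
    by (rule C.multiplicative_functional_contractive[of "\<lambda>x. \<phi> (\<alpha> x)"])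
      (simp_all add: hC CA C1m hom C1.characterD[OF \<phi>(1)])
  then have "norm (\<alpha> h) \<le> norm h" using \<phi>(2) by simp
  moreover have "norm (\<alpha> h) = (norm (\<alpha> x))\<^sup>2"
    using x cstar_subalgebra_mem(7)[OF subA] by (simp add: h_def hom norm_adj_mult_self)
  ultimately have "(norm (\<alpha> x))\<^sup>2 \<le> (norm x)\<^sup>2" by (simp add: h_def norm_adj_mult_self)
  then show ?thesis by (rule power2_le_imp_le) simp
qed

lemma image_closure_span:
  assumes A: "A = closure (cspan N)" and B: "csubspace B" "closed B" and N: "\<alpha> ` N \<subseteq> B"
  shows "\<alpha> ` A \<subseteq> B"
proof -
  have "x \<in> {x \<in> A. \<alpha> x \<in> B}" if x: "x \<in> A" for x
  proof (rule closure_cspan_induct)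
    show "x \<in> closure (cspan N)" using x A by simp
    show "csubspace {x \<in> A. \<alpha> x \<in> B}"
      using complex_vector.subspace_0[OF B(1)] complex_vector.subspace_add[OF B(1)]
        complex_vector.subspace_scale[OF B(1)] cstar_subalgebra_mem[OF subA]
      by (simp add: complex_vector.subspace_def hom hom_zero)
    show "closed {x \<in> A. \<alpha> x \<in> B}"
      unfolding closed_sequential_limits
    proof (intro allI impI, elim conjE)
      fix f l assume f: "\<forall>n. f n \<in> {x \<in> A. \<alpha> x \<in> B}" and l: "f \<longlonglongrightarrow> l"
      have lA: "l \<in> A"
        using closed_sequentially[OF cstar_subalgebra_closed[OF subA] _ l] f by blast
      have lim: "(\<lambda>n. norm (f n - l)) \<longlonglongrightarrow> 0"
        using tendsto_norm[OF LIM_zero[OF l]] by simp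
      have bound: "norm (\<alpha> (f n) - \<alpha> l) \<le> norm (f n - l)" for n
        using contractive[of "f n - l"] f lA cstar_subalgebra_mem(4)[OF subA] by (simp add: hom_diff)
      have "(\<lambda>n. \<alpha> (f n) - \<alpha> l) \<longlonglongrightarrow> 0"
        by (rule Lim_null_comparison[OF always_eventually lim]) (simp add: bound)
      then have \<alpha>l: "(\<lambda>n. \<alpha> (f n)) \<longlonglongrightarrow> \<alpha> l" by (rule LIM_zero_cancel)
      have "\<alpha> (f n) \<in> B" for n using f by simp
      then have "\<alpha> l \<in> B" by (rule closed_sequentially[OF B(2) _ \<alpha>l])
      then show "l \<in> {x \<in> A. \<alpha> x \<in> B}" using lA by simp
    qed
    show "N \<subseteq> {x \<in> A. \<alpha> x \<in> B}"
      using N complex_vector.span_superset[of N] closure_subset[of "cspan N"] A by auto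
  qed
  then show ?thesis by auto
qed

end

text \<open>
  What the second isomorphism uses of a Cartan envelope: normalizers are mapped to normalizers,
  \<open>\<alpha>(D)\<close> meets every non-zero ideal of \<open>D\<^sub>1\<close>, and \<open>A\<^sub>1\<close> is generated by \<open>\<alpha>(A)\<close> and \<open>D\<^sub>1\<close>.
\<close>

locale essential_extension = base: regular_abelian_inclusion A D +
  env: regular_abelian_inclusion A1 D1 + star_mono A A1 \<alpha>
  for A D :: "'a::cstar_algebra set" and A1 D1 :: "'b::cstar_algebra set" and \<alpha> +
  assumes \<alpha>N: "\<alpha> ` normalizers A D \<subseteq> normalizers A1 D1" and \<alpha>D: "\<alpha> ` D \<subseteq> D1"
    and essential: "ideal_intersection_property D1 (\<alpha> ` D)"
    and generated: "A1 = cstar_generated (\<alpha> ` A \<union> D1)"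
begin

lemma \<alpha>D_mem: "d \<in> D \<Longrightarrow> \<alpha> d \<in> D1" using \<alpha>D by auto

lemma DA_mem: "d \<in> D \<Longrightarrow> d \<in> A" using base.DA by auto

lemma mult_eq_0: "x \<in> D \<Longrightarrow> y \<in> D \<Longrightarrow> \<alpha> x * \<alpha> y = 0 \<longleftrightarrow> x * y = 0"
  using hom(4)[OF DA_mem DA_mem] hom_eq_0[OF DA_mem] by (metis base.mem(5))

lemma trivial:
  assumes M: "cstar_ideal D1 M" and 0: "\<And>d. d \<in> D \<Longrightarrow> \<alpha> d \<in> M \<Longrightarrow> d = 0"
  shows "M \<subseteq> {0}"
proof -
  have "0 \<in> \<alpha> ` D" using hom_zero base.mem(1) by (metis imageI)
  then have "M \<inter> \<alpha> ` D = {0}" using 0 cstar_idealD(4)[OF M] hom_zero by auto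
  then show ?thesis using essential M by (auto simp: ideal_intersection_property_def)
qed

definition pullback where "pullback L = {d \<in> D. \<alpha> d \<in> L}"

text \<open>
  Being a double annihilator also makes the pullback closed.  If \<open>d\<close> is in the double annihilator of
  the pullback, then \<open>{\<alpha>(d)}\<^sup>\<bottom>\<^sup>\<bottom> \<inter> L\<^sup>\<bottom>\<close> contains no non-zero \<open>\<alpha>(d')\<close>: such a \<open>d'\<close> annihilates the
  pullback, hence \<open>d d' = 0\<close>, and therefore \<open>\<alpha>(d')\<close> has square zero.  So \<open>\<alpha>(d)\<close> annihilates \<open>L\<^sup>\<bottom>\<close>.
\<close>

lemma pullback_double_annihilator:
  assumes L: "L \<in> Reg D1"
  shows "annihilator D (annihilator D (pullback L)) = pullback L"
proof
  show "pullback L \<subseteq> annihilator D (annihilator D (pullback L))"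
    by (rule subset_annihilator2) (auto simp: pullback_def)
  have LD: "L \<subseteq> D1" and reg: "annihilator D1 (annihilator D1 L) = L"
    using L by (auto simp: Reg_def cstar_ideal_def)
  define Q where "Q = annihilator D1 L"
  have Q: "cstar_ideal D1 Q" unfolding Q_def by (rule env.annihilator_ideal_commutative[OF LD])
  show "annihilator D (annihilator D (pullback L)) \<subseteq> pullback L"
  proof
    fix d assume d: "d \<in> annihilator D (annihilator D (pullback L))"
    then have dD: "d \<in> D" by (simp add: annihilator_def)
    define P where "P = annihilator D1 {\<alpha> d}"
    have PD: "P \<subseteq> D1" by (auto simp: P_def annihilator_def)
    define M where "M = annihilator D1 P"
    have M: "cstar_ideal D1 M"
      unfolding M_def using PD by (rule env.annihilator_ideal_commutative)
    have \<alpha>dM: "\<alpha> d \<in> M"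
      using subset_annihilator2[of "{\<alpha> d}" D1] \<alpha>D_mem[OF dD] by (auto simp: M_def P_def)
    have MQ: "M \<inter> Q \<subseteq> {0}"
    proof (rule trivial[OF cstar_ideal_Int[OF M Q]])
      fix d' assume d': "d' \<in> D" "\<alpha> d' \<in> M \<inter> Q"
      have "d' * k = 0 \<and> k * d' = 0" if k: "k \<in> pullback L" for k
      proof -
        have "k \<in> D" "\<alpha> k \<in> L" using k by (auto simp: pullback_def)
        moreover have "\<alpha> d' * \<alpha> k = 0 \<and> \<alpha> k * \<alpha> d' = 0"
          using d'(2) \<open>\<alpha> k \<in> L\<close> by (auto simp: Q_def annihilator_def)
        ultimately show ?thesis using mult_eq_0 d'(1) by blast
      qed
      then have "d' \<in> annihilator D (pullback L)" using d'(1) by (simp add: annihilator_def)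
      then have "d * d' = 0" "d' * d = 0" using d by (auto simp: annihilator_def)
      then have "\<alpha> d' \<in> P"
        using mult_eq_0[OF dD d'(1)] mult_eq_0[OF d'(1) dD] \<alpha>D_mem[OF d'(1)]
        by (simp add: P_def annihilator_def)
      then have "\<alpha> d' * \<alpha> d' = 0" using d'(2) by (auto simp: M_def annihilator_def)
      then have "\<alpha> d' = 0" using env.square_eq_0 \<alpha>D_mem[OF d'(1)] by blast
      then show "d' = 0" using hom_eq_0[OF DA_mem[OF d'(1)]] by simp
    qed
    have "\<alpha> d * q = 0 \<and> q * \<alpha> d = 0" if q: "q \<in> Q" for q
    proof -
      have qD: "q \<in> D1" using q cstar_idealD(1)[OF Q] by auto
      have "\<alpha> d * q \<in> M \<inter> Q" "q * \<alpha> d \<in> M \<inter> Q"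
        using cstar_idealD(5,6)[OF M] cstar_idealD(5,6)[OF Q] q qD \<alpha>dM \<alpha>D_mem[OF dD] by auto
      then show ?thesis using MQ by blast
    qed
    then have "\<alpha> d \<in> annihilator D1 Q" using \<alpha>D_mem[OF dD] by (simp add: annihilator_def)
    then show "d \<in> pullback L" using reg dD by (simp add: Q_def pullback_def)
  qed
qed

lemma pullback_RegInv:
  assumes L: "L \<in> RegInv A1 D1"
  shows "pullback L \<in> RegInv A D"
proof -
  have reg: "L \<in> Reg D1" and inv: "\<And>n l. n \<in> normalizers A1 D1 \<Longrightarrow> l \<in> L \<Longrightarrow> n * l * adj n \<in> L"
    using L by (auto simp: RegInv_def invariant_ideal_def)
  have "annihilator D (pullback L) \<subseteq> D" by (auto simp: annihilator_def)
  then have ideal: "cstar_ideal D (pullback L)"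
    using base.annihilator_ideal_commutative pullback_double_annihilator[OF reg] by metis
  have "n * k * adj n \<in> pullback L" if n: "n \<in> normalizers A D" and k: "k \<in> pullback L" for n k
  proof -
    have kD: "k \<in> D" "\<alpha> k \<in> L" using k by (auto simp: pullback_def)
    note nA = base.normalizerD(1)[OF n] base.normalizerD(1)[OF base.normalizerD(4)[OF n]]
    have "\<alpha> (n * k * adj n) = \<alpha> n * \<alpha> k * adj (\<alpha> n)"
      using nA DA_mem[OF kD(1)] cstar_subalgebra_mem(5)[OF subA] by (simp add: hom)
    moreover have "\<alpha> n \<in> normalizers A1 D1" using \<alpha>N n by auto
    ultimately show ?thesis
      using inv[OF _ kD(2)] base.normalizerD(2)[OF n kD(1)] by (simp add: pullback_def)
  qed
  then show ?thesis
    using ideal pullback_double_annihilator[OF reg]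
    by (auto simp: RegInv_def invariant_ideal_def Reg_def)
qed

lemma pullback_reflects:
  assumes L: "L \<in> Reg D1" and L': "L' \<in> Reg D1" and sub: "pullback L \<subseteq> pullback L'"
  shows "L \<subseteq> L'"
proof -
  have ideals: "cstar_ideal D1 L" "cstar_ideal D1 L'" and reg: "annihilator D1 (annihilator D1 L') = L'"
    using L L' by (auto simp: Reg_def)
  define Q where "Q = annihilator D1 L'"
  have Q: "cstar_ideal D1 Q"
    unfolding Q_def by (rule env.annihilator_ideal_commutative[OF cstar_idealD(1)[OF ideals(2)]])
  have zero: "L \<inter> Q \<subseteq> {0}"
  proof (rule trivial[OF cstar_ideal_Int[OF ideals(1) Q]])
    fix d assume d: "d \<in> D" "\<alpha> d \<in> L \<inter> Q"
    then have "\<alpha> d \<in> L'" using sub by (auto simp: pullback_def)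
    then have "\<alpha> d * \<alpha> d = 0" using d(2) by (auto simp: Q_def annihilator_def)
    then have "\<alpha> d = 0" using env.square_eq_0 \<alpha>D_mem[OF d(1)] by blast
    then show "d = 0" using hom_eq_0[OF DA_mem[OF d(1)]] by simp
  qed
  have "x \<in> annihilator D1 Q" if x: "x \<in> L" for x
  proof -
    have xD: "x \<in> D1" using x cstar_idealD(1)[OF ideals(1)] by auto
    have "x * q = 0 \<and> q * x = 0" if q: "q \<in> Q" for q
    proof -
      have qD: "q \<in> D1" using q cstar_idealD(1)[OF Q] by auto
      have "x * q \<in> L \<inter> Q" "q * x \<in> L \<inter> Q"
        using cstar_idealD(5,6)[OF ideals(1)] cstar_idealD(5,6)[OF Q] q qD x xD by auto
      then show ?thesis using zero by blast
    qed
    then show ?thesis using xD by (simp add: annihilator_def)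
  qed
  then show ?thesis using reg by (auto simp: Q_def)
qed

text \<open>
  The normalizers \<open>m\<close> with \<open>m L m\<^sup>* \<subseteq> L\<close> and \<open>m\<^sup>* L m \<subseteq> L\<close> form a self-adjoint semigroup \<open>G\<close> that
  contains \<open>D\<^sub>1\<close> and the images of the normalizers of \<open>D\<close>, so its closed span is all of \<open>A\<^sub>1\<close>.  As
  \<open>l m q = 0\<close> for \<open>l\<close> in \<open>L\<close>, \<open>m\<close> in \<open>G\<close> and \<open>q\<close> in \<open>Q\<close>, the same holds with any element of
  \<open>A\<^sub>1\<close> in place of \<open>m\<close>, in particular with \<open>m\<^sup>*\<close> for an arbitrary normalizer \<open>m\<close>.
\<close>

lemma pushforward_invariant:
  assumes K: "invariant_ideal A D K"
  shows "invariant_ideal A1 D1 (annihilator D1 (annihilator D1 (\<alpha> ` K)))"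
proof -
  have ideal: "cstar_ideal D K" and inv: "\<And>n k. n \<in> normalizers A D \<Longrightarrow> k \<in> K \<Longrightarrow> n * k * adj n \<in> K"
    using K by (auto simp: invariant_ideal_def)
  have KD: "k \<in> D" if "k \<in> K" for k using cstar_idealD(1)[OF ideal] that by auto
  have \<alpha>K: "\<alpha> ` K \<subseteq> D1" using KD \<alpha>D_mem by auto
  define Q where "Q = annihilator D1 (\<alpha> ` K)"
  define L where "L = annihilator D1 Q"
  have QD: "Q \<subseteq> D1" by (auto simp: Q_def annihilator_def)
  have Q: "cstar_ideal D1 Q" unfolding Q_def using \<alpha>K by (rule env.annihilator_ideal_commutative)
  have L: "cstar_ideal D1 L" unfolding L_def using QD by (rule env.annihilator_ideal_commutative)
  have LD: "L \<subseteq> D1" using cstar_idealD(1)[OF L] .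
  define S where "S = \<alpha> ` normalizers A D"
  have S: "S \<subseteq> normalizers A1 D1" using \<alpha>N by (simp add: S_def)
  have S_adj: "adj s \<in> S" if "s \<in> S" for s
  proof -
    obtain n where n: "n \<in> normalizers A D" "s = \<alpha> n" using \<open>s \<in> S\<close> by (auto simp: S_def)
    have "adj s = \<alpha> (adj n)" using n hom(5)[OF base.normalizerD(1)[OF n(1)]] by simp
    then show ?thesis using base.normalizerD(4)[OF n(1)] by (auto simp: S_def)
  qed
  have QS: "s * q * adj s \<in> Q" if "s \<in> S" "q \<in> Q" for s q
    unfolding Q_def
  proof (rule env.annihilator_invariant[OF S S_adj \<alpha>K _ _ that[unfolded Q_def]])
    fix k assume "k \<in> \<alpha> ` K"
    then obtain k' where k': "k' \<in> K" "k = \<alpha> k'" by auto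
    note k'A = DA_mem[OF KD[OF k'(1)]]
    have "k * adj k = \<alpha> (k' * adj k')"
      using k' k'A cstar_subalgebra_mem(7)[OF subA] by (simp add: hom)
    moreover have "k' * adj k' \<in> K"
      using cstar_idealD(6)[OF ideal _ k'(1)] KD[OF k'(1)] by simp
    ultimately show "k * adj k \<in> \<alpha> ` K" by simp
    fix s assume "s \<in> S"
    then obtain n where n: "n \<in> normalizers A D" "s = \<alpha> n" by (auto simp: S_def)
    have "s * k * adj s = \<alpha> (n * k' * adj n)"
      using n k' k'A base.normalizerD(1)[OF n(1)] base.normalizerD(1)[OF base.normalizerD(4)[OF n(1)]]
        cstar_subalgebra_mem(5)[OF subA] by (simp add: hom)
    then show "s * k * adj s \<in> \<alpha> ` K" using inv[OF n(1) k'(1)] by simp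
  qed
  have LS: "s * l * adj s \<in> L" if "s \<in> S" "l \<in> L" for s l
    unfolding L_def
  proof (rule env.annihilator_invariant[OF S S_adj QD QS _ that[unfolded L_def]])
    show "q * adj q \<in> Q" if "q \<in> Q" for q
      using cstar_idealD(6)[OF Q _ that] QD that by auto
  qed
  define G where "G = {m \<in> normalizers A1 D1. \<forall>l\<in>L. m * l * adj m \<in> L \<and> adj m * l * m \<in> L}"
  have GN: "m \<in> normalizers A1 D1" if "m \<in> G" for m using that by (simp add: G_def)
  have G_adj: "adj m \<in> G" if "m \<in> G" for m
    using that env.normalizerD(4)[OF GN[OF that]] by (simp add: G_def)
  have G_mult: "m * n \<in> G" if m: "m \<in> G" and n: "n \<in> G" for m n
  proof -
    have "m * n * l * adj (m * n) \<in> L \<and> adj (m * n) * l * (m * n) \<in> L" if l: "l \<in> L" for l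
    proof -
      have "m * (n * l * adj n) * adj m \<in> L" "adj n * (adj m * l * m) * n \<in> L"
        using m n l by (auto simp: G_def)
      then show ?thesis by (simp add: mult.assoc)
    qed
    then show ?thesis
      using normalizers_mult[OF env.A GN[OF m] GN[OF n]] by (simp add: G_def)
  qed
  have DG: "D1 \<subseteq> G"
  proof
    fix d assume d: "d \<in> D1"
    have "d * l * adj d \<in> L \<and> adj d * l * d \<in> L" if "l \<in> L" for l
      using d that cstar_idealD(5,6)[OF L] by simp
    then show "d \<in> G"
      using subalgebra_subset_normalizers[OF env.D env.DA] d by (auto simp: G_def)
  qed
  have SG: "S \<subseteq> G"
  proof
    fix s assume s: "s \<in> S"
    have "adj s * l * s \<in> L" if "l \<in> L" for l
      using LS[OF S_adj[OF s] that] by simp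
    then show "s \<in> G" using LS[OF s] S s by (auto simp: G_def)
  qed
  define B where "B = closure (cspan G)"
  have B: "cstar_subalgebra B"
    unfolding B_def by (rule closure_cspan_subalgebra[OF G_mult G_adj])
  have GB: "G \<subseteq> B"
    using complex_vector.span_superset[of G] closure_subset[of "cspan G"] by (auto simp: B_def)
  have "\<alpha> ` A \<subseteq> B"
    by (rule image_closure_span[of "normalizers A D"])
      (use base.dense B GB SG in \<open>auto simp: cstar_subalgebra_def S_def\<close>)
  then have "cstar_generated (\<alpha> ` A \<union> D1) \<subseteq> B"
    unfolding cstar_generated_def using B DG GB by (intro hull_minimal) auto
  then have A1B: "A1 \<subseteq> B" using generated by simp
  have kill: "l * a * q = 0" if l: "l \<in> L" and a: "a \<in> A1" and q: "q \<in> Q" for l a q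
  proof -
    have "a \<in> {a. l * a * q = 0}"
    proof (rule closure_cspan_induct[OF _ csubspace_kernel_mult closed_kernel_mult])
      show "a \<in> closure (cspan G)" using a A1B by (auto simp: B_def)
      show "G \<subseteq> {a. l * a * q = 0}"
      proof (intro subsetI CollectI)
        fix m assume m: "m \<in> G"
        have "adj l * l \<in> L" using l LD cstar_idealD(5)[OF L] by auto
        then have "adj m * (adj l * l) * m \<in> L" using m by (auto simp: G_def)
        then have "adj m * (adj l * l) * m * q = 0" using q by (auto simp: L_def annihilator_def)
        then have "adj (l * m * q) * (l * m * q) = 0" by (simp add: mult.assoc)
        then show "l * m * q = 0" by (simp only: adj_mult_self_eq_0)
      qed
    qed
    then show ?thesis by simp
  qed
  have "m * l * adj m \<in> L" if m: "m \<in> normalizers A1 D1" and l: "l \<in> L" for m l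
  proof -
    have "m * l * adj m * q = 0" if q: "q \<in> Q" for q
    proof -
      have "l * adj m * q = 0"
        using kill[OF l _ q] env.normalizerD(1)[OF env.normalizerD(4)[OF m]] by blast
      then show ?thesis by (simp add: mult.assoc)
    qed
    moreover have "m * l * adj m \<in> D1" using env.normalizerD(2)[OF m] l LD by auto
    ultimately show ?thesis unfolding L_def using env.annihilator_eq[OF QD] by simp
  qed
  then show ?thesis
    using L unfolding invariant_ideal_def L_def[symmetric] Q_def[symmetric] by blast
qed

theorem RegInv_isomorphic: "lattice_isomorphic (RegInv A1 D1) (RegInv A D)"
proof (rule lattice_isomorphicI[where f = pullback])
  show "pullback L \<in> RegInv A D" if "L \<in> RegInv A1 D1" for L
    using that by (rule pullback_RegInv)
  show "L \<subseteq> L' \<longleftrightarrow> pullback L \<subseteq> pullback L'" if L: "L \<in> RegInv A1 D1" and L': "L' \<in> RegInv A1 D1" for L L'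
  proof
    assume "pullback L \<subseteq> pullback L'"
    then show "L \<subseteq> L'" using L L' by (intro pullback_reflects) (auto simp: RegInv_def)
  qed (auto simp: pullback_def)
  show "\<exists>L\<in>RegInv A1 D1. pullback L = K" if K: "K \<in> RegInv A D" for K
  proof
    have inv: "invariant_ideal A D K" and reg: "annihilator D (annihilator D K) = K" and KD: "K \<subseteq> D"
      using K by (auto simp: RegInv_def Reg_def cstar_ideal_def)
    have \<alpha>K: "\<alpha> ` K \<subseteq> D1" using KD \<alpha>D_mem by auto
    define Q where "Q = annihilator D1 (\<alpha> ` K)"
    have inv1: "invariant_ideal A1 D1 (annihilator D1 Q)"
      unfolding Q_def using inv by (rule pushforward_invariant)
    have "annihilator D1 Q \<in> Reg D1"
      using inv1 annihilator3[of Q D1] by (auto simp: Reg_def invariant_ideal_def Q_def annihilator_def)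
    then show "annihilator D1 Q \<in> RegInv A1 D1" using inv1 by (simp add: RegInv_def)
    show "pullback (annihilator D1 Q) = K"
    proof
      show "K \<subseteq> pullback (annihilator D1 Q)"
        using subset_annihilator2[OF \<alpha>K] KD by (auto simp: pullback_def Q_def)
      show "pullback (annihilator D1 Q) \<subseteq> K"
      proof
        fix d assume "d \<in> pullback (annihilator D1 Q)"
        then have d: "d \<in> D" "\<alpha> d \<in> annihilator D1 Q" by (auto simp: pullback_def)
        have "d * d' = 0 \<and> d' * d = 0" if "d' \<in> annihilator D K" for d'
        proof -
          have d': "d' \<in> D" "\<And>k. k \<in> K \<Longrightarrow> d' * k = 0 \<and> k * d' = 0"
            using that by (auto simp: annihilator_def)
          have "\<alpha> d' * \<alpha> k = 0 \<and> \<alpha> k * \<alpha> d' = 0" if "k \<in> K" for k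
            using mult_eq_0[of d' k] mult_eq_0[of k d'] d' that KD by auto
          then have "\<alpha> d' \<in> Q" using \<alpha>D_mem[OF d'(1)] by (auto simp: Q_def annihilator_def)
          then have "\<alpha> d * \<alpha> d' = 0 \<and> \<alpha> d' * \<alpha> d = 0" using d(2) by (auto simp: annihilator_def)
          then show ?thesis using mult_eq_0[OF d(1) d'(1)] mult_eq_0[OF d'(1) d(1)] by simp
        qed
        then have "d \<in> annihilator D (annihilator D K)" using d(1) by (simp add: annihilator_def)
        then show "d \<in> K" using reg by simp
      qed
    qed
  qed
qed

end

theorem theorem3p16:
  fixes A D :: "'a::cstar_algebra set"
    and A1 D1 :: "'b::cstar_algebra set"
    and \<alpha> :: "'a \<Rightarrow> 'b"
  assumes "pseudo_cartan_inclusion A D"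
    and "cartan_envelope A D A1 D1 \<alpha>"
  shows "lattice_isomorphic (Reg A) (RegInv A D) \<and>
    lattice_isomorphic (RegInv A D) (RegInv A1 D1) \<and>
    lattice_isomorphic (RegInv A1 D1) (Reg A1)"
proof -
  have env: "regular_inclusion A D" "abelian D" "cartan_inclusion A1 D1" "star_monomorphism A A1 \<alpha>"
    "\<alpha> ` normalizers A D \<subseteq> normalizers A1 D1" "\<alpha> ` D \<subseteq> D1" "ideal_intersection_property D1 (\<alpha> ` D)"
    using assms(2) by (auto simp: cartan_envelope_def)
  obtain E1 where E1: "faithful_conditional_expectation A1 D1 E1"
    and gen: "A1 = cstar_generated (\<alpha> ` A \<union> E1 ` \<alpha> ` A)"
    using assms(2) by (auto simp: cartan_envelope_def)
  interpret base: regular_abelian_inclusion A D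
    using env(1,2) by unfold_locales
  interpret env: regular_abelian_inclusion A1 D1
    using env(3) by unfold_locales (auto simp: cartan_inclusion_def maximal_abelian_def)
  interpret mono: star_mono A A1 \<alpha>
    using env(4) base.A env.A by unfold_locales
  have \<alpha>A: "\<alpha> ` A \<subseteq> A1" using mono.hom(1) by auto
  have E1A: "E1 ` \<alpha> ` A \<subseteq> D1"
    using E1 \<alpha>A by (auto simp: faithful_conditional_expectation_def conditional_expectation_def)
  have "A1 = cstar_generated (\<alpha> ` A \<union> D1)"
  proof
    show "A1 \<subseteq> cstar_generated (\<alpha> ` A \<union> D1)"
      unfolding gen cstar_generated_def using E1A by (intro hull_mono) auto
    show "cstar_generated (\<alpha> ` A \<union> D1) \<subseteq> A1"
      unfolding cstar_generated_def using \<alpha>A env.DA env.A by (intro hull_minimal) auto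
  qed
  then interpret essential_extension A D A1 D1 \<alpha>
    using env(5-7) by unfold_locales
  have "lattice_isomorphic (Reg A) (RegInv A D)"
    by (rule base.Reg_isomorphic_RegInv[OF pseudo_cartan_ideal_intersection[OF assms(1)]])
  moreover have "lattice_isomorphic (RegInv A D) (RegInv A1 D1)"
    by (rule lattice_isomorphic_sym[OF RegInv_isomorphic])
  moreover have "lattice_isomorphic (RegInv A1 D1) (Reg A1)"
    by (rule lattice_isomorphic_sym[OF env.Reg_isomorphic_RegInv[OF cartan_ideal_intersection[OF env(3)]]])
  ultimately show ?thesis by blast
qed

end
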